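(* Let $R$ be a principal ideal domain which is not a field, and let $\mathbf D^b(\mathbf{mod}\,R)$ be the bounded derived category of the abelian category $\mathbf{mod}\,R$ of finitely generated $R$-modules. Then $\mathsf{Stab}\,\mathbf D^b(\mathbf{mod}\,R)$ is empty.
   Context: For a triangulated category $\mathbf D$, $\mathsf{Stab}\,\mathbf D$ is the set of locally finite stability conditions on $\mathbf D$ in the sense of Bridgeland. *)

theory Defs
  imports Complex_Main "HOL-Algebra.Ring_Divisibility" "HOL-Algebra.Module"
    "HOL-Algebra.Free_Abelian_Groups" "HOL-Algebra.Generated_Groups"
begin

section \<open>Stability conditions on a triangulated category\<close>

text \<open>
  The data of a triangulated category: a preadditive category given by its Hom sets, the shift
  functor \<open>[1]\<close> on objects and on morphisms, and the class of distinguished triangles, a triangle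
  \<open>A \<rightarrow> B \<rightarrow> C \<rightarrow> A[1]\<close> being recorded by its three morphisms.  Composition \<open>Cmp D g f\<close> is
  \<open>g\<close> after \<open>f\<close>.
\<close>

record ('o, 'h) tricat =
  Obj :: "'o set"
  Hom :: "'o \<Rightarrow> 'o \<Rightarrow> 'h set"
  Idn :: "'o \<Rightarrow> 'h"
  Cmp :: "'h \<Rightarrow> 'h \<Rightarrow> 'h"
  Zer :: "'o \<Rightarrow> 'o \<Rightarrow> 'h"
  Add :: "'h \<Rightarrow> 'h \<Rightarrow> 'h"
  Shift :: "'o \<Rightarrow> 'o"
  Shift_mor :: "'h \<Rightarrow> 'h"
  Triangles :: "('h \<times> 'h \<times> 'h) set"

definition iso_mor :: "('o, 'h) tricat \<Rightarrow> 'o \<Rightarrow> 'o \<Rightarrow> 'h \<Rightarrow> bool" where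
  "iso_mor D X Y f \<longleftrightarrow> f \<in> Hom D X Y \<and>
     (\<exists>g \<in> Hom D Y X. Cmp D g f = Idn D X \<and> Cmp D f g = Idn D Y)"

definition isomorphic :: "('o, 'h) tricat \<Rightarrow> 'o \<Rightarrow> 'o \<Rightarrow> bool" where
  "isomorphic D X Y \<longleftrightarrow> (\<exists>f. iso_mor D X Y f)"

definition zero_object :: "('o, 'h) tricat \<Rightarrow> 'o \<Rightarrow> bool" where
  "zero_object D X \<longleftrightarrow> X \<in> Obj D \<and> Idn D X = Zer D X X"

definition direct_sum :: "('o, 'h) tricat \<Rightarrow> 'o \<Rightarrow> 'o \<Rightarrow> 'o \<Rightarrow> bool" where
  "direct_sum D A B S \<longleftrightarrow> S \<in> Obj D \<and>
     (\<exists>i \<in> Hom D A S. \<exists>j \<in> Hom D B S. \<exists>p \<in> Hom D S A. \<exists>q \<in> Hom D S B.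
        Cmp D p i = Idn D A \<and> Cmp D q j = Idn D B \<and>
        Cmp D q i = Zer D A B \<and> Cmp D p j = Zer D B A \<and>
        Add D (Cmp D i p) (Cmp D j q) = Idn D S)"

text \<open>Full subcategories are given by their sets of objects and are taken closed under
  isomorphism.\<close>

definition full_additive_subcategory :: "('o, 'h) tricat \<Rightarrow> 'o set \<Rightarrow> bool" where
  "full_additive_subcategory D S \<longleftrightarrow> S \<subseteq> Obj D \<and>
     (\<forall>X \<in> S. \<forall>Y \<in> Obj D. isomorphic D X Y \<longrightarrow> Y \<in> S) \<and>
     (\<exists>X \<in> S. zero_object D X) \<and>
     (\<forall>A \<in> S. \<forall>B \<in> S. \<exists>C \<in> S. direct_sum D A B C)"

definition triangle ::
  "('o, 'h) tricat \<Rightarrow> 'o \<Rightarrow> 'o \<Rightarrow> 'o \<Rightarrow> 'h \<Rightarrow> 'h \<Rightarrow> 'h \<Rightarrow> bool" where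
  "triangle D A B C f g h \<longleftrightarrow> A \<in> Obj D \<and> B \<in> Obj D \<and> C \<in> Obj D \<and>
     f \<in> Hom D A B \<and> g \<in> Hom D B C \<and> h \<in> Hom D C (Shift D A) \<and> (f, g, h) \<in> Triangles D"

subsection \<open>The Grothendieck group\<close>

definition K0_relations :: "('o, 'h) tricat \<Rightarrow> ('o \<Rightarrow>\<^sub>0 int) set" where
  "K0_relations D = generate (free_Abelian_group (Obj D))
     {frag_of B - frag_of A - frag_of C |A B C. \<exists>f g h. triangle D A B C f g h}"

definition K0 :: "('o, 'h) tricat \<Rightarrow> ('o \<Rightarrow>\<^sub>0 int) set monoid" where
  "K0 D = free_Abelian_group (Obj D) Mod K0_relations D"

definition K0_class :: "('o, 'h) tricat \<Rightarrow> 'o \<Rightarrow> ('o \<Rightarrow>\<^sub>0 int) set" where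
  "K0_class D E = K0_relations D #>\<^bsub>free_Abelian_group (Obj D)\<^esub> frag_of E"

definition complex_group :: "complex monoid" where
  "complex_group = \<lparr>carrier = UNIV, monoid.mult = (+), one = 0\<rparr>"

subsection \<open>Slicings and stability conditions\<close>

text \<open>A Harder--Narasimhan filtration \<open>0 = E 0 \<rightarrow> E 1 \<rightarrow> \<dots> \<rightarrow> E n = X\<close> whose \<open>j\<close>-th cone \<open>A j\<close>,
  for \<open>j < n\<close>, lies in \<open>P (\<phi> j)\<close>, with \<open>\<phi> 0 > \<phi> 1 > \<dots> > \<phi> (n - 1)\<close>.\<close>

definition HN_filtration ::
  "('o, 'h) tricat \<Rightarrow> (real \<Rightarrow> 'o set) \<Rightarrow> 'o \<Rightarrow> nat \<Rightarrow> (nat \<Rightarrow> real) \<Rightarrow>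
   (nat \<Rightarrow> 'o) \<Rightarrow> (nat \<Rightarrow> 'o) \<Rightarrow> bool" where
  "HN_filtration D P X n \<phi> E A \<longleftrightarrow>
     zero_object D (E 0) \<and> E n = X \<and>
     (\<forall>i j. i < j \<and> j < n \<longrightarrow> \<phi> j < \<phi> i) \<and>
     (\<forall>j < n. A j \<in> P (\<phi> j) \<and> (\<exists>f g h. triangle D (E j) (E (Suc j)) (A j) f g h))"

definition slicing :: "('o, 'h) tricat \<Rightarrow> (real \<Rightarrow> 'o set) \<Rightarrow> bool" where
  "slicing D P \<longleftrightarrow>
     (\<forall>\<phi>. full_additive_subcategory D (P \<phi>)) \<and>
     (\<forall>\<phi>. P (\<phi> + 1) = {X \<in> Obj D. \<exists>E \<in> P \<phi>. isomorphic D X (Shift D E)}) \<and>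
     (\<forall>\<phi> \<psi> A B. \<psi> < \<phi> \<and> A \<in> P \<phi> \<and> B \<in> P \<psi> \<longrightarrow> Hom D A B = {Zer D A B}) \<and>
     (\<forall>X \<in> Obj D. \<not> zero_object D X \<longrightarrow> (\<exists>n \<phi> E A. HN_filtration D P X n \<phi> E A))"

text \<open>The central charge is a homomorphism on \<open>K0 D\<close>; extensionality fixes its values outside of
  the carrier.\<close>

definition stability_condition ::
  "('o, 'h) tricat \<Rightarrow> (('o \<Rightarrow>\<^sub>0 int) set \<Rightarrow> complex) \<Rightarrow> (real \<Rightarrow> 'o set) \<Rightarrow> bool" where
  "stability_condition D Z P \<longleftrightarrow>
     Z \<in> hom (K0 D) complex_group \<and> Z \<in> extensional (carrier (K0 D)) \<and>
     slicing D P \<and>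
     (\<forall>\<phi>. \<forall>E \<in> P \<phi>. \<not> zero_object D E \<longrightarrow>
        (\<exists>m::real. 0 < m \<and>
           Z (K0_class D E) = of_real m * exp (\<i> * of_real pi * of_real \<phi>)))"

subsection \<open>Local finiteness\<close>

inductive_set extension_closure :: "('o, 'h) tricat \<Rightarrow> 'o set \<Rightarrow> 'o set"
  for D :: "('o, 'h) tricat" and S :: "'o set" where
  base: "X \<in> S \<Longrightarrow> X \<in> extension_closure D S"
| ext: "A \<in> extension_closure D S \<Longrightarrow> C \<in> extension_closure D S \<Longrightarrow>
    triangle D A B C f g h \<Longrightarrow> B \<in> extension_closure D S"

definition slice_interval :: "('o, 'h) tricat \<Rightarrow> (real \<Rightarrow> 'o set) \<Rightarrow> real set \<Rightarrow> 'o set" where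
  "slice_interval D P I = extension_closure D (\<Union>\<phi> \<in> I. P \<phi>)"

text \<open>Kernels, cokernels, strict morphisms and strict subobjects inside the full subcategory of
  \<open>D\<close> on the set of objects \<open>S\<close>.\<close>

definition is_kernel ::
  "('o, 'h) tricat \<Rightarrow> 'o set \<Rightarrow> 'o \<Rightarrow> 'o \<Rightarrow> 'h \<Rightarrow> 'o \<Rightarrow> 'h \<Rightarrow> bool" where
  "is_kernel D S X Y f K k \<longleftrightarrow> K \<in> S \<and> k \<in> Hom D K X \<and> Cmp D f k = Zer D K Y \<and>
     (\<forall>T \<in> S. \<forall>t \<in> Hom D T X. Cmp D f t = Zer D T Y \<longrightarrow>
        (\<exists>!u. u \<in> Hom D T K \<and> Cmp D k u = t))"

definition is_cokernel ::
  "('o, 'h) tricat \<Rightarrow> 'o set \<Rightarrow> 'o \<Rightarrow> 'o \<Rightarrow> 'h \<Rightarrow> 'o \<Rightarrow> 'h \<Rightarrow> bool" where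
  "is_cokernel D S X Y f Q q \<longleftrightarrow> Q \<in> S \<and> q \<in> Hom D Y Q \<and> Cmp D q f = Zer D X Q \<and>
     (\<forall>T \<in> S. \<forall>t \<in> Hom D Y T. Cmp D t f = Zer D X T \<longrightarrow>
        (\<exists>!u. u \<in> Hom D Q T \<and> Cmp D u q = t))"

text \<open>A morphism \<open>f\<close> is strict if the canonical morphism \<open>u : coim f \<rightarrow> im f\<close>, determined by
  \<open>f = i \<circ> u \<circ> c\<close>, is an isomorphism, where \<open>c : X \<rightarrow> coim f\<close> is the cokernel of the kernel of
  \<open>f\<close> and \<open>i : im f \<rightarrow> Y\<close> is the kernel of its cokernel.\<close>

definition strict_mor ::
  "('o, 'h) tricat \<Rightarrow> 'o set \<Rightarrow> 'o \<Rightarrow> 'o \<Rightarrow> 'h \<Rightarrow> bool" where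
  "strict_mor D S X Y f \<longleftrightarrow> X \<in> S \<and> Y \<in> S \<and> f \<in> Hom D X Y \<and>
     (\<exists>K k I c Q q J i u.
        is_kernel D S X Y f K k \<and> is_cokernel D S K X k I c \<and>
        is_cokernel D S X Y f Q q \<and> is_kernel D S Y Q q J i \<and>
        f = Cmp D i (Cmp D u c) \<and> iso_mor D I J u)"

definition mono_mor ::
  "('o, 'h) tricat \<Rightarrow> 'o set \<Rightarrow> 'o \<Rightarrow> 'o \<Rightarrow> 'h \<Rightarrow> bool" where
  "mono_mor D S X Y f \<longleftrightarrow> X \<in> S \<and> Y \<in> S \<and> f \<in> Hom D X Y \<and>
     (\<forall>T \<in> S. \<forall>u \<in> Hom D T X. \<forall>v \<in> Hom D T X. Cmp D f u = Cmp D f v \<longrightarrow> u = v)"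

definition strict_subobject ::
  "('o, 'h) tricat \<Rightarrow> 'o set \<Rightarrow> 'o \<Rightarrow> 'o \<times> 'h \<Rightarrow> bool" where
  "strict_subobject D S E a \<longleftrightarrow>
     mono_mor D S (fst a) E (snd a) \<and> strict_mor D S (fst a) E (snd a)"

definition subobject_le :: "('o, 'h) tricat \<Rightarrow> 'o \<times> 'h \<Rightarrow> 'o \<times> 'h \<Rightarrow> bool" where
  "subobject_le D a b \<longleftrightarrow> (\<exists>u \<in> Hom D (fst a) (fst b). Cmp D (snd b) u = snd a)"

definition noetherian_cat :: "('o, 'h) tricat \<Rightarrow> 'o set \<Rightarrow> bool" where
  "noetherian_cat D S \<longleftrightarrow> (\<forall>E \<in> S. \<forall>a :: nat \<Rightarrow> 'o \<times> 'h.
     (\<forall>n. strict_subobject D S E (a n)) \<and> (\<forall>n. subobject_le D (a n) (a (Suc n))) \<longrightarrow>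
     (\<exists>N. \<forall>n \<ge> N. subobject_le D (a (Suc n)) (a n)))"

definition artinian_cat :: "('o, 'h) tricat \<Rightarrow> 'o set \<Rightarrow> bool" where
  "artinian_cat D S \<longleftrightarrow> (\<forall>E \<in> S. \<forall>a :: nat \<Rightarrow> 'o \<times> 'h.
     (\<forall>n. strict_subobject D S E (a n)) \<and> (\<forall>n. subobject_le D (a (Suc n)) (a n)) \<longrightarrow>
     (\<exists>N. \<forall>n \<ge> N. subobject_le D (a n) (a (Suc n))))"

definition finite_length_cat :: "('o, 'h) tricat \<Rightarrow> 'o set \<Rightarrow> bool" where
  "finite_length_cat D S \<longleftrightarrow> artinian_cat D S \<and> noetherian_cat D S"

text \<open>The bound \<open>\<eta> < 1/2\<close> makes the intervals shorter than \<open>1\<close>, which is what ensures that the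
  subcategories in question are quasi-abelian.\<close>

definition locally_finite :: "('o, 'h) tricat \<Rightarrow> (real \<Rightarrow> 'o set) \<Rightarrow> bool" where
  "locally_finite D P \<longleftrightarrow> (\<exists>\<eta>::real. 0 < \<eta> \<and> \<eta> < 1/2 \<and>
     (\<forall>t. finite_length_cat D (slice_interval D P {t - \<eta> <..< t + \<eta>})))"

definition Stab ::
  "('o, 'h) tricat \<Rightarrow> ((('o \<Rightarrow>\<^sub>0 int) set \<Rightarrow> complex) \<times> (real \<Rightarrow> 'o set)) set" where
  "Stab D = {(Z, P). stability_condition D Z P \<and> locally_finite D P}"


section \<open>Complexes of finitely generated modules\<close>

definition fin_gen_module :: "('a, 'r) ring_scheme \<Rightarrow> ('a, 'm) module \<Rightarrow> bool" where
  "fin_gen_module R M \<longleftrightarrow> module R M \<and>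
     (\<exists>S. finite S \<and> S \<subseteq> carrier M \<and> (\<forall>N. submodule N R M \<and> S \<subseteq> N \<longrightarrow> N = carrier M))"

definition linear_maps ::
  "('a, 'r) ring_scheme \<Rightarrow> ('a, 'm) module \<Rightarrow> ('a, 'k) module \<Rightarrow> ('m \<Rightarrow> 'k) set" where
  "linear_maps R M N = {f \<in> carrier M \<rightarrow> carrier N.
     (\<forall>x \<in> carrier M. \<forall>y \<in> carrier M. f (x \<oplus>\<^bsub>M\<^esub> y) = f x \<oplus>\<^bsub>N\<^esub> f y) \<and>
     (\<forall>a \<in> carrier R. \<forall>x \<in> carrier M. f (a \<odot>\<^bsub>M\<^esub> x) = a \<odot>\<^bsub>N\<^esub> f x)}"

text \<open>Modules are ring records; their fields \<open>mult\<close> and \<open>one\<close> are irrelevant.\<close>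

definition module_sum :: "('a, 'm) module \<Rightarrow> ('a, 'k) module \<Rightarrow> ('a, 'm \<times> 'k) module" where
  "module_sum M N = \<lparr>carrier = carrier M \<times> carrier N,
     monoid.mult = (\<lambda>_ _. undefined), one = undefined,
     ring.zero = (\<zero>\<^bsub>M\<^esub>, \<zero>\<^bsub>N\<^esub>),
     ring.add = (\<lambda>(x, y) (x', y'). (x \<oplus>\<^bsub>M\<^esub> x', y \<oplus>\<^bsub>N\<^esub> y')),
     smult = (\<lambda>a (x, y). (a \<odot>\<^bsub>M\<^esub> x, a \<odot>\<^bsub>N\<^esub> y))\<rparr>"

text \<open>Cochain complexes, with \<open>diff X n : obj X n \<rightarrow> obj X (n + 1)\<close>.  Here and for chain maps and
  homotopies, only the values on the carriers of the modules matter.\<close>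

record ('a, 'm) cochain =
  obj :: "int \<Rightarrow> ('a, 'm) module"
  diff :: "int \<Rightarrow> 'm \<Rightarrow> 'm"

definition bounded_complex :: "('a, 'r) ring_scheme \<Rightarrow> ('a, 'm) cochain \<Rightarrow> bool" where
  "bounded_complex R X \<longleftrightarrow>
     (\<forall>n. fin_gen_module R (obj X n) \<and>
          diff X n \<in> linear_maps R (obj X n) (obj X (n + 1)) \<and>
          (\<forall>x \<in> carrier (obj X n). diff X (n + 1) (diff X n x) = \<zero>\<^bsub>obj X (n + 1 + 1)\<^esub>)) \<and>
     finite {n. carrier (obj X n) \<noteq> {\<zero>\<^bsub>obj X n\<^esub>}}"

definition chain_map :: "('a, 'r) ring_scheme \<Rightarrow> ('a, 'm) cochain \<Rightarrow> ('a, 'k) cochain \<Rightarrow>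
    (int \<Rightarrow> 'm \<Rightarrow> 'k) \<Rightarrow> bool" where
  "chain_map R X Y f \<longleftrightarrow> (\<forall>n. f n \<in> linear_maps R (obj X n) (obj Y n) \<and>
     (\<forall>x \<in> carrier (obj X n). diff Y n (f n x) = f (n + 1) (diff X n x)))"

definition homotopic :: "('a, 'r) ring_scheme \<Rightarrow> ('a, 'm) cochain \<Rightarrow> ('a, 'k) cochain \<Rightarrow>
    (int \<Rightarrow> 'm \<Rightarrow> 'k) \<Rightarrow> (int \<Rightarrow> 'm \<Rightarrow> 'k) \<Rightarrow> bool" where
  "homotopic R X Y f g \<longleftrightarrow>
     (\<exists>h. \<forall>n. h n \<in> linear_maps R (obj X n) (obj Y (n - 1)) \<and>
        (\<forall>x \<in> carrier (obj X n). f n x \<ominus>\<^bsub>obj Y n\<^esub> g n x =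
           diff Y (n - 1) (h n x) \<oplus>\<^bsub>obj Y n\<^esub> h (n + 1) (diff X n x)))"

definition cocycles :: "('a, 'm) cochain \<Rightarrow> int \<Rightarrow> 'm set" where
  "cocycles X n = {x \<in> carrier (obj X n). diff X n x = \<zero>\<^bsub>obj X (n + 1)\<^esub>}"

definition coboundaries :: "('a, 'm) cochain \<Rightarrow> int \<Rightarrow> 'm set" where
  "coboundaries X n = diff X (n - 1) ` carrier (obj X (n - 1))"

definition cohomology :: "('a, 'm) cochain \<Rightarrow> int \<Rightarrow> 'm set monoid" where
  "cohomology X n = (obj X n)\<lparr>carrier := cocycles X n\<rparr> A_Mod coboundaries X n"

text \<open>The induced map sends the coset of a cocycle \<open>x\<close> to the coset of \<open>f n x\<close>.\<close>

definition cohomology_map ::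
  "('a, 'k) cochain \<Rightarrow> (int \<Rightarrow> 'm \<Rightarrow> 'k) \<Rightarrow> int \<Rightarrow> 'm set \<Rightarrow> 'k set" where
  "cohomology_map Y f n c = coboundaries Y n <+>\<^bsub>obj Y n\<^esub> (f n ` c)"

definition quasi_iso :: "('a, 'r) ring_scheme \<Rightarrow> ('a, 'm) cochain \<Rightarrow> ('a, 'k) cochain \<Rightarrow>
    (int \<Rightarrow> 'm \<Rightarrow> 'k) \<Rightarrow> bool" where
  "quasi_iso R X Y f \<longleftrightarrow> chain_map R X Y f \<and>
     (\<forall>n. cohomology_map Y f n \<in> iso (cohomology X n) (cohomology Y n))"

definition shift_complex :: "('a, 'm) cochain \<Rightarrow> ('a, 'm) cochain" where
  "shift_complex X = \<lparr>obj = (\<lambda>n. obj X (n + 1)),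
     diff = (\<lambda>n x. \<ominus>\<^bsub>obj X (n + 1 + 1)\<^esub> diff X (n + 1) x)\<rparr>"

definition shift_map :: "(int \<Rightarrow> 'm \<Rightarrow> 'k) \<Rightarrow> int \<Rightarrow> 'm \<Rightarrow> 'k" where
  "shift_map f = (\<lambda>n. f (n + 1))"

definition cone :: "('a, 'm) cochain \<Rightarrow> ('a, 'k) cochain \<Rightarrow> (int \<Rightarrow> 'm \<Rightarrow> 'k) \<Rightarrow>
    ('a, 'm \<times> 'k) cochain" where
  "cone X Y f = \<lparr>obj = (\<lambda>n. module_sum (obj X (n + 1)) (obj Y n)),
     diff = (\<lambda>n (x, y). (\<ominus>\<^bsub>obj X (n + 1 + 1)\<^esub> diff X (n + 1) x,
                         f (n + 1) x \<oplus>\<^bsub>obj Y (n + 1)\<^esub> diff Y n y))\<rparr>"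

definition cone_in :: "('a, 'm) cochain \<Rightarrow> int \<Rightarrow> 'k \<Rightarrow> 'm \<times> 'k" where
  "cone_in X = (\<lambda>n y. (\<zero>\<^bsub>obj X (n + 1)\<^esub>, y))"

definition cone_out :: "int \<Rightarrow> 'm \<times> 'k \<Rightarrow> 'm" where
  "cone_out = (\<lambda>n z. fst z)"


section \<open>The bounded derived category\<close>

text \<open>
  Morphisms \<open>X \<rightarrow> Y\<close> in the derived category are equivalence classes of roofs
  \<open>X \<leftarrow> W \<rightarrow> Y\<close> whose left leg is a quasi-isomorphism, in the homotopy category of bounded
  complexes.  A morphism carries its source and target.
\<close>

type_synonym ('a, 'm) roof =
  "('a, 'm) cochain \<times> (int \<Rightarrow> 'm \<Rightarrow> 'm) \<times> (int \<Rightarrow> 'm \<Rightarrow> 'm)"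

type_synonym ('a, 'm) dmor = "('a, 'm) cochain \<times> ('a, 'm) cochain \<times> ('a, 'm) roof set"

abbreviation chain_comp ::
  "(int \<Rightarrow> 'k \<Rightarrow> 'l) \<Rightarrow> (int \<Rightarrow> 'm \<Rightarrow> 'k) \<Rightarrow> int \<Rightarrow> 'm \<Rightarrow> 'l" (infixr \<open>\<circ>\<circ>\<circ>\<close> 55) where
  "g \<circ>\<circ>\<circ> f \<equiv> \<lambda>n. g n \<circ> f n"

definition roofs :: "('a, 'r) ring_scheme \<Rightarrow> ('a, 'm) cochain \<Rightarrow> ('a, 'm) cochain \<Rightarrow>
    ('a, 'm) roof set" where
  "roofs R X Y = {(W, s, f). bounded_complex R W \<and> quasi_iso R W X s \<and> chain_map R W Y f}"

definition roof_equiv :: "('a, 'r) ring_scheme \<Rightarrow> ('a, 'm) cochain \<Rightarrow> ('a, 'm) cochain \<Rightarrow>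
    ('a, 'm) roof \<Rightarrow> ('a, 'm) roof \<Rightarrow> bool" where
  "roof_equiv R X Y = (\<lambda>(W, s, f) (W', s', f').
     \<exists>(V :: ('a, 'm) cochain) u u'. bounded_complex R V \<and> chain_map R V W u \<and> chain_map R V W' u' \<and>
       quasi_iso R V X (s \<circ>\<circ>\<circ> u) \<and>
       homotopic R V X (s \<circ>\<circ>\<circ> u) (s' \<circ>\<circ>\<circ> u') \<and>
       homotopic R V Y (f \<circ>\<circ>\<circ> u) (f' \<circ>\<circ>\<circ> u'))"

definition roof_class :: "('a, 'r) ring_scheme \<Rightarrow> ('a, 'm) cochain \<Rightarrow> ('a, 'm) cochain \<Rightarrow>
    ('a, 'm) roof \<Rightarrow> ('a, 'm) roof set" where
  "roof_class R X Y r = {r' \<in> roofs R X Y. roof_equiv R X Y r r'}"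

definition D_hom :: "('a, 'r) ring_scheme \<Rightarrow> ('a, 'm) cochain \<Rightarrow> ('a, 'm) cochain \<Rightarrow>
    ('a, 'm) dmor set" where
  "D_hom R X Y = {(X, Y, roof_class R X Y r) |r. r \<in> roofs R X Y}"

text \<open>The image of a chain map in the derived category.\<close>

definition D_of :: "('a, 'r) ring_scheme \<Rightarrow> ('a, 'm) cochain \<Rightarrow> ('a, 'm) cochain \<Rightarrow>
    (int \<Rightarrow> 'm \<Rightarrow> 'm) \<Rightarrow> ('a, 'm) dmor" where
  "D_of R X Y f = (X, Y, roof_class R X Y (X, \<lambda>n x. x, f))"

text \<open>The composite of \<open>X \<leftarrow> W \<rightarrow> Y\<close> and \<open>Y \<leftarrow> W' \<rightarrow> Z\<close> is the class of any roof
  \<open>X \<leftarrow> W \<leftarrow> V \<rightarrow> W' \<rightarrow> Z\<close> for which the square \<open>V, W, W', Y\<close> commutes up to homotopy.\<close>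

definition D_comp :: "('a, 'r) ring_scheme \<Rightarrow> ('a, 'm) dmor \<Rightarrow> ('a, 'm) dmor \<Rightarrow> ('a, 'm) dmor" where
  "D_comp R = (\<lambda>(Y, Z, \<beta>) (X, Y', \<alpha>). (X, Z,
     \<Union>{roof_class R X Z (V, s \<circ>\<circ>\<circ> t, g \<circ>\<circ>\<circ> h) |W s f W' s' g V t h.
        (W, s, f) \<in> \<alpha> \<and> (W', s', g) \<in> \<beta> \<and> bounded_complex R V \<and>
        quasi_iso R V W t \<and> chain_map R V W' h \<and> homotopic R V Y (f \<circ>\<circ>\<circ> t) (s' \<circ>\<circ>\<circ> h)}))"

text \<open>Two morphisms are added after being brought to a common denominator.\<close>

definition D_add :: "('a, 'r) ring_scheme \<Rightarrow> ('a, 'm) dmor \<Rightarrow> ('a, 'm) dmor \<Rightarrow> ('a, 'm) dmor" where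
  "D_add R = (\<lambda>(X, Y, \<alpha>) (X', Y', \<beta>). (X, Y,
     \<Union>{roof_class R X Y (W, s, \<lambda>n x. f n x \<oplus>\<^bsub>obj Y n\<^esub> g n x) |W s f g.
        (W, s, f) \<in> \<alpha> \<and> (W, s, g) \<in> \<beta>}))"

definition D_zero :: "('a, 'r) ring_scheme \<Rightarrow> ('a, 'm) cochain \<Rightarrow> ('a, 'm) cochain \<Rightarrow>
    ('a, 'm) dmor" where
  "D_zero R X Y = D_of R X Y (\<lambda>n x. \<zero>\<^bsub>obj Y n\<^esub>)"

definition D_shift :: "('a, 'r) ring_scheme \<Rightarrow> ('a, 'm) dmor \<Rightarrow> ('a, 'm) dmor" where
  "D_shift R = (\<lambda>(X, Y, \<alpha>). (shift_complex X, shift_complex Y,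
     \<Union>{roof_class R (shift_complex X) (shift_complex Y)
           (shift_complex W, shift_map s, shift_map f) |W s f. (W, s, f) \<in> \<alpha>}))"

text \<open>
  The modules live on subsets of the type \<open>'a list set\<close>, where \<open>'a\<close> is the type of the elements of
  \<open>R\<close>; up to isomorphism these are all finitely generated modules (lemma
  \<open>fin_gen_module_small\<close> below).  The distinguished triangles are those isomorphic to
  \<open>X \<rightarrow> Y \<rightarrow> cone u \<rightarrow> X[1]\<close> for a chain map \<open>u\<close>.  As the cone itself lives on a product type, it is
  replaced by an isomorphic complex \<open>C\<close>, with mutually inverse chain maps
  \<open>e : cone u \<rightarrow> C\<close> and \<open>e' : C \<rightarrow> cone u\<close>.
\<close>

definition D_cone_triangles ::
  "('a, 'r) ring_scheme \<Rightarrow> (('a, 'm) dmor \<times> ('a, 'm) dmor \<times> ('a, 'm) dmor) set" where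
  "D_cone_triangles R =
     {(D_of R X Y u, D_of R Y C (e \<circ>\<circ>\<circ> cone_in X), D_of R C (shift_complex X) (cone_out \<circ>\<circ>\<circ> e'))
      |X Y u C e e'.
        bounded_complex R X \<and> bounded_complex R Y \<and> bounded_complex R C \<and> chain_map R X Y u \<and>
        chain_map R (cone X Y u) C e \<and> chain_map R C (cone X Y u) e' \<and>
        (\<forall>n. (\<forall>z \<in> carrier (obj (cone X Y u) n). e' n (e n z) = z) \<and>
             (\<forall>c \<in> carrier (obj C n). e n (e' n c) = c))}"

definition D_iso :: "('a, 'r) ring_scheme \<Rightarrow> ('a, 'm) cochain \<Rightarrow> ('a, 'm) cochain \<Rightarrow>
    ('a, 'm) dmor \<Rightarrow> bool" where
  "D_iso R X Y f \<longleftrightarrow> f \<in> D_hom R X Y \<and>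
     (\<exists>g \<in> D_hom R Y X. D_comp R g f = D_of R X X (\<lambda>n x. x) \<and> D_comp R f g = D_of R Y Y (\<lambda>n x. x))"

definition D_triangles ::
  "('a, 'r) ring_scheme \<Rightarrow> (('a, 'm) dmor \<times> ('a, 'm) dmor \<times> ('a, 'm) dmor) set" where
  "D_triangles R = {(f, g, h). \<exists>A B C A' B' C' f' g' h' a b c.
     bounded_complex R A \<and> bounded_complex R B \<and> bounded_complex R C \<and>
     f \<in> D_hom R A B \<and> g \<in> D_hom R B C \<and> h \<in> D_hom R C (shift_complex A) \<and>
     f' \<in> D_hom R A' B' \<and> g' \<in> D_hom R B' C' \<and> h' \<in> D_hom R C' (shift_complex A') \<and>
     (f', g', h') \<in> D_cone_triangles R \<and>
     D_iso R A A' a \<and> D_iso R B B' b \<and>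
     D_iso R C C' c \<and>
     D_comp R b f = D_comp R f' a \<and> D_comp R c g = D_comp R g' b \<and>
     D_comp R (D_shift R a) h = D_comp R h' c}"

definition Db_mod ::
  "('a, 'r) ring_scheme \<Rightarrow> (('a, 'a list set) cochain, ('a, 'a list set) dmor) tricat" where
  "Db_mod R = \<lparr>
     Obj = {X. bounded_complex R X},
     Hom = D_hom R,
     Idn = (\<lambda>X. D_of R X X (\<lambda>n x. x)),
     Cmp = D_comp R,
     Zer = D_zero R,
     Add = D_add R,
     Shift = shift_complex,
     Shift_mor = D_shift R,
     Triangles = D_triangles R\<rparr>"

text \<open>Every finitely generated module, on whatever type, is isomorphic to one on \<open>'a list set\<close>: send
  an element to the set of its coordinate lists with respect to a finite list of generators.\<close>

fun lin_comb :: "('a, 'm, 'z) module_scheme \<Rightarrow> 'a list \<Rightarrow> 'm list \<Rightarrow> 'm" where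
  "lin_comb M (a # as) (x # xs) = (a \<odot>\<^bsub>M\<^esub> x) \<oplus>\<^bsub>M\<^esub> lin_comb M as xs"
| "lin_comb M _ _ = \<zero>\<^bsub>M\<^esub>"

context module
begin

lemma lin_comb_closed:
  "set as \<subseteq> carrier R \<Longrightarrow> set xs \<subseteq> carrier M \<Longrightarrow> lin_comb M as xs \<in> carrier M"
proof (induction as arbitrary: xs)
  case (Cons a as)
  then show ?case by (cases xs) auto
qed simp

lemma lin_comb_add:
  assumes "length as = length xs" "length bs = length xs"
    "set as \<subseteq> carrier R" "set bs \<subseteq> carrier R" "set xs \<subseteq> carrier M"
  shows "lin_comb M as xs \<oplus>\<^bsub>M\<^esub> lin_comb M bs xs = lin_comb M (map2 (\<oplus>) as bs) xs"
  using assms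
proof (induction xs arbitrary: as bs)
  case (Cons x xs)
  then obtain a as' b bs' where [simp]: "as = a # as'" "bs = b # bs'"
    by (metis length_Suc_conv)
  have c: "lin_comb M as' xs \<in> carrier M" "lin_comb M bs' xs \<in> carrier M"
    using Cons.prems by (auto intro!: lin_comb_closed)
  have IH: "lin_comb M as' xs \<oplus>\<^bsub>M\<^esub> lin_comb M bs' xs = lin_comb M (map2 (\<oplus>) as' bs') xs"
    using Cons by auto
  have ab: "a \<in> carrier R" "b \<in> carrier R" "x \<in> carrier M" using Cons.prems by auto
  show ?case
    using c ab by (simp flip: IH add: smult_l_distr M.a_ac)
qed simp

lemma lin_comb_smult:
  assumes "length as = length xs" "set as \<subseteq> carrier R" "set xs \<subseteq> carrier M" "b \<in> carrier R"
  shows "b \<odot>\<^bsub>M\<^esub> lin_comb M as xs = lin_comb M (map ((\<otimes>) b) as) xs"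
  using assms
proof (induction xs arbitrary: as)
  case (Cons x xs)
  then obtain a as' where [simp]: "as = a # as'" by (metis length_Suc_conv)
  have c: "lin_comb M as' xs \<in> carrier M"
    using Cons.prems by (auto intro!: lin_comb_closed)
  have IH: "b \<odot>\<^bsub>M\<^esub> lin_comb M as' xs = lin_comb M (map ((\<otimes>) b) as') xs"
    using Cons by auto
  have ab: "a \<in> carrier R" "x \<in> carrier M" using Cons.prems by auto
  show ?case
    using c ab \<open>b \<in> carrier R\<close> by (simp flip: IH add: smult_r_distr smult_assoc1)
qed simp

lemma lin_comb_zero:
  "set xs \<subseteq> carrier M \<Longrightarrow> lin_comb M (map (\<lambda>_. \<zero>) xs) xs = \<zero>\<^bsub>M\<^esub>"
  by (induction xs) auto

lemma lin_comb_mem: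
  assumes "set xs \<subseteq> carrier M" "x \<in> set xs"
  shows "\<exists>as. length as = length xs \<and> set as \<subseteq> carrier R \<and> lin_comb M as xs = x"
  using assms
proof (induction xs)
  case (Cons y xs)
  have y: "y \<in> carrier M" "set xs \<subseteq> carrier M" using Cons.prems by auto
  show ?case
  proof (cases "x = y")
    case True
    show ?thesis using y True
      by (intro exI[of _ "\<one> # map (\<lambda>_. \<zero>) xs"]) (auto simp: lin_comb_zero)
  next
    case False
    then obtain as where as: "length as = length xs" "set as \<subseteq> carrier R" "lin_comb M as xs = x"
      using Cons by auto
    have "x \<in> carrier M" using lin_comb_closed[OF as(2) y(2)] as(3) by simp
    then show ?thesis using as y by (intro exI[of _ "\<zero> # as"]) auto
  qed
qed simp

lemma lin_comb_submodule:
  assumes xs: "set xs \<subseteq> carrier M"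
  shows "submodule {lin_comb M as xs |as. length as = length xs \<and> set as \<subseteq> carrier R} R M"
    (is "submodule ?H R M")
proof (rule submoduleI)
  show "?H \<subseteq> carrier M" using xs lin_comb_closed by auto
  show "\<zero>\<^bsub>M\<^esub> \<in> ?H"
    using lin_comb_zero[OF xs] by (auto intro!: exI[of _ "map (\<lambda>_. \<zero>) xs"])
  show smult: "b \<odot>\<^bsub>M\<^esub> h \<in> ?H" if "b \<in> carrier R" "h \<in> ?H" for b h
  proof -
    obtain as where as: "h = lin_comb M as xs" "length as = length xs" "set as \<subseteq> carrier R"
      using \<open>h \<in> ?H\<close> by auto
    have "set (map ((\<otimes>) b) as) \<subseteq> carrier R" using as(3) \<open>b \<in> carrier R\<close> by auto
    moreover have "b \<odot>\<^bsub>M\<^esub> h = lin_comb M (map ((\<otimes>) b) as) xs"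
      using lin_comb_smult[OF as(2,3) xs \<open>b \<in> carrier R\<close>] as(1) by simp
    moreover have "length (map ((\<otimes>) b) as) = length xs" using as(2) by simp
    ultimately show ?thesis by blast
  qed
  show "\<ominus>\<^bsub>M\<^esub> h \<in> ?H" if "h \<in> ?H" for h
  proof -
    have "h \<in> carrier M" using \<open>h \<in> ?H\<close> xs lin_comb_closed by auto
    then have "(\<ominus> \<one>) \<odot>\<^bsub>M\<^esub> h = \<ominus>\<^bsub>M\<^esub> h" by (simp add: smult_l_minus)
    then show ?thesis using smult[OF _ that, of "\<ominus> \<one>"] by (metis R.one_closed R.a_inv_closed)
  qed
  show "h \<oplus>\<^bsub>M\<^esub> k \<in> ?H" if hk: "h \<in> ?H" "k \<in> ?H" for h k
  proof -
    obtain as bs where *: "h = lin_comb M as xs" "length as = length xs" "set as \<subseteq> carrier R"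
      "k = lin_comb M bs xs" "length bs = length xs" "set bs \<subseteq> carrier R"
      using hk by auto
    have "set (map2 (\<oplus>) as bs) \<subseteq> carrier R"
    proof
      fix z assume "z \<in> set (map2 (\<oplus>) as bs)"
      then obtain a b where "(a, b) \<in> set (zip as bs)" "z = a \<oplus> b" by auto
      then have "a \<in> carrier R" "b \<in> carrier R" "z = a \<oplus> b"
        using * by (meson set_zip_leftD set_zip_rightD subsetD)+
      then show "z \<in> carrier R" by simp
    qed
    moreover have "h \<oplus>\<^bsub>M\<^esub> k = lin_comb M (map2 (\<oplus>) as bs) xs"
      using lin_comb_add[OF *(2,5,3,6) xs] *(1,4) by simp
    moreover have "length (map2 (\<oplus>) as bs) = length xs" using *(2,5) by simp
    ultimately show ?thesis by blast
  qed
qed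

end

lemma fin_gen_module_small:
  fixes R :: "('a, 'r) ring_scheme" and M :: "('a, 'm) module"
  assumes "fin_gen_module R M"
  shows "\<exists>(N :: ('a, 'a list set) module) f.
    fin_gen_module R N \<and> f \<in> linear_maps R M N \<and> bij_betw f (carrier M) (carrier N)"
proof -
  from assms obtain S where M: "module R M" and S: "finite S" "S \<subseteq> carrier M"
    and gen: "\<And>N. submodule N R M \<Longrightarrow> S \<subseteq> N \<Longrightarrow> N = carrier M"
    unfolding fin_gen_module_def by auto
  interpret module R M by (fact M)
  obtain xs where xs: "set xs = S" using finite_list[OF S(1)] by auto
  define c where "c m = {as. length as = length xs \<and> set as \<subseteq> carrier R \<and> lin_comb M as xs = m}" for m
  have "S \<subseteq> {lin_comb M as xs |as. length as = length xs \<and> set as \<subseteq> carrier R}"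
    using lin_comb_mem[of xs] S(2) xs by blast
  with gen[OF lin_comb_submodule] have span:
    "{lin_comb M as xs |as. length as = length xs \<and> set as \<subseteq> carrier R} = carrier M"
    using S(2) xs by blast
  have c_ne: "c m \<noteq> {}" if "m \<in> carrier M" for m
    using that unfolding c_def span[symmetric] by auto
  have inj: "inj_on c (carrier M)"
  proof (rule inj_onI)
    fix m m' assume "m \<in> carrier M" "c m = c m'"
    then show "m = m'" using c_ne[of m] unfolding c_def by auto
  qed
  define g where "g = inv_into (carrier M) c"
  have g [simp]: "g (c m) = m" if "m \<in> carrier M" for m
    using inj that by (simp add: g_def)
  define N :: "('a, 'a list set) module" where
    "N = \<lparr>carrier = c ` carrier M, monoid.mult = (\<lambda>_ _. undefined), one = undefined,
      ring.zero = c \<zero>\<^bsub>M\<^esub>, ring.add = (\<lambda>A B. c (g A \<oplus>\<^bsub>M\<^esub> g B)), smult = (\<lambda>a A. c (a \<odot>\<^bsub>M\<^esub> g A))\<rparr>"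
  have N [simp]: "carrier N = c ` carrier M" "\<zero>\<^bsub>N\<^esub> = c \<zero>\<^bsub>M\<^esub>"
    "\<And>A B. A \<oplus>\<^bsub>N\<^esub> B = c (g A \<oplus>\<^bsub>M\<^esub> g B)" "\<And>a A. a \<odot>\<^bsub>N\<^esub> A = c (a \<odot>\<^bsub>M\<^esub> g A)"
    by (simp_all add: N_def)
  have "abelian_group N"
  proof (rule abelian_groupI)
    fix A assume "A \<in> carrier N"
    then obtain m where "A = c m" "m \<in> carrier M" by auto
    then show "\<exists>B \<in> carrier N. B \<oplus>\<^bsub>N\<^esub> A = \<zero>\<^bsub>N\<^esub>"
      by (auto intro!: bexI[of _ "\<ominus>\<^bsub>M\<^esub> m"] simp: M.l_neg)
  qed (auto simp: M.a_ac)
  then have modN: "module R N"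
    by (intro moduleI R.is_cring) (auto simp: smult_l_distr smult_r_distr smult_assoc1)
  interpret N: module R N by (fact modN)
  have "H = carrier N" if H: "submodule H R N" "c ` S \<subseteq> H" for H
  proof -
    note E = N.submoduleE[OF H(1)]
    have HN: "H \<subseteq> c ` carrier M" using E(1) by simp
    have "submodule (g ` H) R M"
    proof (rule submoduleI)
      show "g ` H \<subseteq> carrier M" using HN by auto
      have "\<zero>\<^bsub>N\<^esub> \<in> H" using H(1) subgroup.one_closed[of H "add_monoid N"]
        by (simp add: submodule_def)
      then show "\<zero>\<^bsub>M\<^esub> \<in> g ` H" by (intro image_eqI[of _ _ "c \<zero>\<^bsub>M\<^esub>"]) auto
      show smult: "a \<odot>\<^bsub>M\<^esub> x \<in> g ` H" if "a \<in> carrier R" "x \<in> g ` H" for a x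
      proof -
        obtain A where A: "A \<in> H" "x = g A" using \<open>x \<in> g ` H\<close> by auto
        have "x \<in> carrier M" using A HN by auto
        moreover have "c (a \<odot>\<^bsub>M\<^esub> x) \<in> H" using E(4)[OF that(1) A(1)] A by simp
        ultimately show ?thesis using that(1) by (intro image_eqI[of _ _ "c (a \<odot>\<^bsub>M\<^esub> x)"]) auto
      qed
      show "\<ominus>\<^bsub>M\<^esub> x \<in> g ` H" if "x \<in> g ` H" for x
      proof -
        have "x \<in> carrier M" using that HN by auto
        then have "(\<ominus>\<^bsub>R\<^esub> \<one>\<^bsub>R\<^esub>) \<odot>\<^bsub>M\<^esub> x = \<ominus>\<^bsub>M\<^esub> x" by (simp add: smult_l_minus)
        then show ?thesis using smult[OF _ that, of "\<ominus>\<^bsub>R\<^esub> \<one>\<^bsub>R\<^esub>"] by (metis R.one_closed R.a_inv_closed)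
      qed
      show "x \<oplus>\<^bsub>M\<^esub> y \<in> g ` H" if xy: "x \<in> g ` H" "y \<in> g ` H" for x y
      proof -
        obtain A B where A: "A \<in> H" "x = g A" "B \<in> H" "y = g B" using xy by auto
        have "x \<in> carrier M" "y \<in> carrier M" using A HN by auto
        moreover have "c (x \<oplus>\<^bsub>M\<^esub> y) \<in> H" using E(5)[OF A(1) A(3)] A by simp
        ultimately show ?thesis by (intro image_eqI[of _ _ "c (x \<oplus>\<^bsub>M\<^esub> y)"]) auto
      qed
    qed
    moreover have "S \<subseteq> g ` H"
    proof
      fix x assume "x \<in> S"
      then show "x \<in> g ` H" using H(2) S(2) by (intro image_eqI[of _ _ "c x"]) auto
    qed
    ultimately have "g ` H = carrier M" by (rule gen)
    then have "c ` g ` H = carrier N" by simp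
    moreover have "c ` g ` H = H"
      using HN by (force simp: image_image g_def f_inv_into_f subset_iff)
    ultimately show ?thesis by simp
  qed
  then have "fin_gen_module R N"
    unfolding fin_gen_module_def using modN S by (auto intro!: exI[of _ "c ` S"])
  moreover have "c \<in> linear_maps R M N"
    unfolding linear_maps_def by auto
  moreover have "bij_betw c (carrier M) (carrier N)"
    using inj by (simp add: bij_betw_def)
  ultimately show ?thesis by blast
qed

end

theory Submission
  imports Defs
begin

text \<open>
  Let \<open>p\<close> be a nonzero nonunit and let \<open>X\<close> be the cone of \<open>p\<close> on \<open>R\<close>, a nonzero object on which \<open>p\<close>
  acts as zero.  Let \<open>T\<close> be the first nonzero term of a Harder--Narasimhan filtration of \<open>X\<close>; it is
  semistable.  Since \<open>Hom(T[1], A) = 0\<close> for every cone \<open>A\<close> of the filtration, the map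
  \<open>Hom(T, T) \<rightarrow> Hom(T, X)\<close> is injective, so \<open>p\<close> acts as zero on \<open>T\<close> and the cohomology of \<open>T\<close> is
  torsion.  The triangles \<open>R \<rightarrow> R \<rightarrow> R/d\<close> then make the class of \<open>T\<close> in the Grothendieck group
  disappear under the central charge, which contradicts semistability.
\<close>

section \<open>Complexes of modules\<close>

text \<open>The vanishing of the charge on torsion suggests the structure theorem and quotient
  modules; both are avoided. A finitely generated module is built by adjoining one generator
  \<open>x\<close> at a time to a submodule \<open>L\<close>. The scalars that carry
  \<open>x\<close> into \<open>L\<close> form a principal ideal with generator \<open>d\<close>, and
  the inclusion of \<open>L\<close> into \<open>L + Rx\<close>, read as a two-term complex, is
  quasi-isomorphic to \<open>d : R -> R\<close> if \<open>d\<close> is nonzero and to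
  \<open>0 -> R\<close> otherwise. So an additive function only counts the steps at which
  \<open>x\<close> is not torsion modulo \<open>L\<close>, and for a complex with torsion cohomology
  the contributions of the coboundaries telescope.

  The other obstacle is the concrete category: morphisms are classes of roofs, and objects live on
  the single type \<open>'a list set\<close>. Composition and the vanishing of a morphism are
  extracted from the calculus of fractions, and complexes built on product types, such as cones and
  homotopy pullbacks, have to be copied back. Exactness of Hom sequences comes down to one
  observation: a null homotopy of \<open>f a\<close> is the same as a lift of \<open>a[1]\<close> to
  the cone of \<open>f\<close>.\<close>

lemma abelian_group_cancel:
  fixes G (structure)
  assumes G: "abelian_group G"
  shows "x \<in> carrier G \<Longrightarrow> y \<in> carrier G \<Longrightarrow> x \<oplus> y \<in> carrier G"
    and "x \<in> carrier G \<Longrightarrow> \<ominus> x \<in> carrier G"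
    and "\<zero> \<in> carrier G"
    and "x \<in> carrier G \<Longrightarrow> y \<in> carrier G \<Longrightarrow> z \<in> carrier G \<Longrightarrow> (x \<oplus> y) \<oplus> z = x \<oplus> (y \<oplus> z)"
    and "x \<in> carrier G \<Longrightarrow> y \<in> carrier G \<Longrightarrow> x \<oplus> y = y \<oplus> x"
    and "x \<in> carrier G \<Longrightarrow> y \<in> carrier G \<Longrightarrow> z \<in> carrier G \<Longrightarrow> x \<oplus> (y \<oplus> z) = y \<oplus> (x \<oplus> z)"
    and "x \<in> carrier G \<Longrightarrow> \<zero> \<oplus> x = x"
    and "x \<in> carrier G \<Longrightarrow> x \<oplus> \<zero> = x"
    and "x \<in> carrier G \<Longrightarrow> y \<in> carrier G \<Longrightarrow> \<ominus> (x \<oplus> y) = \<ominus> x \<oplus> \<ominus> y"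
    and "x \<in> carrier G \<Longrightarrow> \<ominus> (\<ominus> x) = x"
    and "\<ominus> \<zero> = \<zero>"
    and "x \<ominus> y = x \<oplus> \<ominus> y"
    and "x \<in> carrier G \<Longrightarrow> x \<oplus> \<ominus> x = \<zero>"
    and "x \<in> carrier G \<Longrightarrow> \<ominus> x \<oplus> x = \<zero>"
    and "x \<in> carrier G \<Longrightarrow> y \<in> carrier G \<Longrightarrow> x \<oplus> (\<ominus> x \<oplus> y) = y"
    and "x \<in> carrier G \<Longrightarrow> y \<in> carrier G \<Longrightarrow> x \<oplus> (y \<oplus> \<ominus> x) = y"
    and "x \<in> carrier G \<Longrightarrow> y \<in> carrier G \<Longrightarrow> z \<in> carrier G \<Longrightarrow> x \<oplus> (y \<oplus> (\<ominus> x \<oplus> z)) = y \<oplus> z"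
    and "x \<in> carrier G \<Longrightarrow> y \<in> carrier G \<Longrightarrow> z \<in> carrier G \<Longrightarrow> x \<oplus> (y \<oplus> (z \<oplus> \<ominus> x)) = y \<oplus> z"
    and "x \<in> carrier G \<Longrightarrow> y \<in> carrier G \<Longrightarrow> z \<in> carrier G \<Longrightarrow> w \<in> carrier G \<Longrightarrow>
      x \<oplus> (y \<oplus> (z \<oplus> (\<ominus> x \<oplus> w))) = y \<oplus> (z \<oplus> w)"
    and "x \<in> carrier G \<Longrightarrow> y \<in> carrier G \<Longrightarrow> z \<in> carrier G \<Longrightarrow> w \<in> carrier G \<Longrightarrow>
      x \<oplus> (y \<oplus> (z \<oplus> (w \<oplus> \<ominus> x))) = y \<oplus> (z \<oplus> w)"
    and "x \<in> carrier G \<Longrightarrow> y \<in> carrier G \<Longrightarrow> z \<in> carrier G \<Longrightarrow> w \<in> carrier G \<Longrightarrow> v \<in> carrier G \<Longrightarrow>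
      x \<oplus> (y \<oplus> (z \<oplus> (w \<oplus> (\<ominus> x \<oplus> v)))) = y \<oplus> (z \<oplus> (w \<oplus> v))"
    and "x \<in> carrier G \<Longrightarrow> y \<in> carrier G \<Longrightarrow> z \<in> carrier G \<Longrightarrow> w \<in> carrier G \<Longrightarrow> v \<in> carrier G \<Longrightarrow>
      x \<oplus> (y \<oplus> (z \<oplus> (w \<oplus> (v \<oplus> \<ominus> x)))) = y \<oplus> (z \<oplus> (w \<oplus> v))"
proof -
  interpret abelian_group G by (fact G)
  \<comment> \<open>A sum sorted by \<open>a_ac\<close> may separate \<open>x\<close> from
    \<open>\<ominus> x\<close> by several summands, so each distance up to four gets a rewrite rule
    of its own; the longer rules are this one applied to a sum.\<close>
  have lc: "x \<oplus> (\<ominus> x \<oplus> y) = y" if "x \<in> carrier G" "y \<in> carrier G" for x y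
    using that by (simp add: r_neg1 r_neg2)
  show "x \<in> carrier G \<Longrightarrow> y \<in> carrier G \<Longrightarrow> x \<oplus> y \<in> carrier G"
    "x \<in> carrier G \<Longrightarrow> \<ominus> x \<in> carrier G" "\<zero> \<in> carrier G"
    "x \<in> carrier G \<Longrightarrow> y \<in> carrier G \<Longrightarrow> z \<in> carrier G \<Longrightarrow> (x \<oplus> y) \<oplus> z = x \<oplus> (y \<oplus> z)"
    "x \<in> carrier G \<Longrightarrow> y \<in> carrier G \<Longrightarrow> x \<oplus> y = y \<oplus> x"
    "x \<in> carrier G \<Longrightarrow> y \<in> carrier G \<Longrightarrow> z \<in> carrier G \<Longrightarrow> x \<oplus> (y \<oplus> z) = y \<oplus> (x \<oplus> z)"
    "x \<in> carrier G \<Longrightarrow> \<zero> \<oplus> x = x" "x \<in> carrier G \<Longrightarrow> x \<oplus> \<zero> = x"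
    "x \<in> carrier G \<Longrightarrow> y \<in> carrier G \<Longrightarrow> \<ominus> (x \<oplus> y) = \<ominus> x \<oplus> \<ominus> y"
    "x \<in> carrier G \<Longrightarrow> \<ominus> (\<ominus> x) = x" "\<ominus> \<zero> = \<zero>" "x \<ominus> y = x \<oplus> \<ominus> y"
    "x \<in> carrier G \<Longrightarrow> x \<oplus> \<ominus> x = \<zero>" "x \<in> carrier G \<Longrightarrow> \<ominus> x \<oplus> x = \<zero>"
    by (auto simp: a_assoc a_comm a_lcomm minus_add a_minus_def r_neg l_neg)
  show "x \<in> carrier G \<Longrightarrow> y \<in> carrier G \<Longrightarrow> x \<oplus> (\<ominus> x \<oplus> y) = y" by (rule lc)
  show "x \<in> carrier G \<Longrightarrow> y \<in> carrier G \<Longrightarrow> x \<oplus> (y \<oplus> \<ominus> x) = y"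
    "x \<in> carrier G \<Longrightarrow> y \<in> carrier G \<Longrightarrow> z \<in> carrier G \<Longrightarrow> x \<oplus> (y \<oplus> (\<ominus> x \<oplus> z)) = y \<oplus> z"
    "x \<in> carrier G \<Longrightarrow> y \<in> carrier G \<Longrightarrow> z \<in> carrier G \<Longrightarrow> x \<oplus> (y \<oplus> (z \<oplus> \<ominus> x)) = y \<oplus> z"
    using lc[of x y] lc[of x "y \<oplus> z"] by (simp_all add: a_ac)
  show "x \<in> carrier G \<Longrightarrow> y \<in> carrier G \<Longrightarrow> z \<in> carrier G \<Longrightarrow> w \<in> carrier G \<Longrightarrow>
      x \<oplus> (y \<oplus> (z \<oplus> (\<ominus> x \<oplus> w))) = y \<oplus> (z \<oplus> w)"
    "x \<in> carrier G \<Longrightarrow> y \<in> carrier G \<Longrightarrow> z \<in> carrier G \<Longrightarrow> w \<in> carrier G \<Longrightarrow>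
      x \<oplus> (y \<oplus> (z \<oplus> (w \<oplus> \<ominus> x))) = y \<oplus> (z \<oplus> w)"
    using lc[of x "y \<oplus> (z \<oplus> w)"] by (simp_all add: a_ac)
  show "x \<in> carrier G \<Longrightarrow> y \<in> carrier G \<Longrightarrow> z \<in> carrier G \<Longrightarrow> w \<in> carrier G \<Longrightarrow> v \<in> carrier G \<Longrightarrow>
      x \<oplus> (y \<oplus> (z \<oplus> (w \<oplus> (\<ominus> x \<oplus> v)))) = y \<oplus> (z \<oplus> (w \<oplus> v))"
    "x \<in> carrier G \<Longrightarrow> y \<in> carrier G \<Longrightarrow> z \<in> carrier G \<Longrightarrow> w \<in> carrier G \<Longrightarrow> v \<in> carrier G \<Longrightarrow>
      x \<oplus> (y \<oplus> (z \<oplus> (w \<oplus> (v \<oplus> \<ominus> x)))) = y \<oplus> (z \<oplus> (w \<oplus> v))"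
    using lc[of x "y \<oplus> (z \<oplus> (w \<oplus> v))"] by (simp_all add: a_ac)
qed

section \<open>Linear maps, bounded complexes and chain maps\<close>

lemma linear_map_props:
  assumes M: "module R M" and N: "module R N" and f: "f \<in> linear_maps R M N"
  shows "x \<in> carrier M \<Longrightarrow> f x \<in> carrier N"
    and "x \<in> carrier M \<Longrightarrow> y \<in> carrier M \<Longrightarrow> f (x \<oplus>\<^bsub>M\<^esub> y) = f x \<oplus>\<^bsub>N\<^esub> f y"
    and "a \<in> carrier R \<Longrightarrow> x \<in> carrier M \<Longrightarrow> f (a \<odot>\<^bsub>M\<^esub> x) = a \<odot>\<^bsub>N\<^esub> f x"
    and "f \<zero>\<^bsub>M\<^esub> = \<zero>\<^bsub>N\<^esub>"
    and "x \<in> carrier M \<Longrightarrow> f (\<ominus>\<^bsub>M\<^esub> x) = \<ominus>\<^bsub>N\<^esub> f x"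
proof -
  interpret M: module R M by (fact M)
  interpret N: module R N by (fact N)
  show c: "x \<in> carrier M \<Longrightarrow> f x \<in> carrier N" for x
    using f by (auto simp: linear_maps_def)
  show "x \<in> carrier M \<Longrightarrow> y \<in> carrier M \<Longrightarrow> f (x \<oplus>\<^bsub>M\<^esub> y) = f x \<oplus>\<^bsub>N\<^esub> f y"
    using f by (auto simp: linear_maps_def)
  show s: "a \<in> carrier R \<Longrightarrow> x \<in> carrier M \<Longrightarrow> f (a \<odot>\<^bsub>M\<^esub> x) = a \<odot>\<^bsub>N\<^esub> f x" for a x
    using f by (auto simp: linear_maps_def)
  show "f \<zero>\<^bsub>M\<^esub> = \<zero>\<^bsub>N\<^esub>"
    using s[of "\<zero>\<^bsub>R\<^esub>" "\<zero>\<^bsub>M\<^esub>"] c[of "\<zero>\<^bsub>M\<^esub>"] by simp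
  show "x \<in> carrier M \<Longrightarrow> f (\<ominus>\<^bsub>M\<^esub> x) = \<ominus>\<^bsub>N\<^esub> f x"
    using s[of "\<ominus>\<^bsub>R\<^esub> \<one>\<^bsub>R\<^esub>" x] c[of x] by (simp add: M.smult_l_minus N.smult_l_minus)
qed

lemma linear_mapsI:
  assumes "\<And>x. x \<in> carrier M \<Longrightarrow> f x \<in> carrier N"
    and "\<And>x y. x \<in> carrier M \<Longrightarrow> y \<in> carrier M \<Longrightarrow> f (x \<oplus>\<^bsub>M\<^esub> y) = f x \<oplus>\<^bsub>N\<^esub> f y"
    and "\<And>a x. a \<in> carrier R \<Longrightarrow> x \<in> carrier M \<Longrightarrow> f (a \<odot>\<^bsub>M\<^esub> x) = a \<odot>\<^bsub>N\<^esub> f x"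
  shows "f \<in> linear_maps R M N"
  using assms by (auto simp: linear_maps_def)

lemma fin_gen_module_module: "fin_gen_module R M \<Longrightarrow> module R M"
  by (simp add: fin_gen_module_def)

lemma bounded_complexI:
  assumes "\<And>n. fin_gen_module R (obj X n)"
    and "\<And>n. diff X n \<in> linear_maps R (obj X n) (obj X (n + 1))"
    and "\<And>n x. x \<in> carrier (obj X n) \<Longrightarrow> diff X (n + 1) (diff X n x) = \<zero>\<^bsub>obj X (n + 1 + 1)\<^esub>"
    and "finite {n. carrier (obj X n) \<noteq> {\<zero>\<^bsub>obj X n\<^esub>}}"
  shows "bounded_complex R X"
  using assms by (simp add: bounded_complex_def)

lemma bounded_complex_module: "bounded_complex R X \<Longrightarrow> module R (obj X n)"
  by (auto simp: bounded_complex_def intro: fin_gen_module_module)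

lemma diff_linear: "bounded_complex R X \<Longrightarrow> diff X n \<in> linear_maps R (obj X n) (obj X (n + 1))"
  by (simp add: bounded_complex_def)

text \<open>The side conditions of the form \<open>m = n + 1\<close> in the rewrite rules below let them apply however
  an index is written.\<close>

lemma bounded_complex_props:
  assumes X: "bounded_complex R X"
  shows "abelian_group (obj X n)"
    and "x \<in> carrier (obj X n) \<Longrightarrow> m = n + 1 \<Longrightarrow> diff X n x \<in> carrier (obj X m)"
    and "x \<in> carrier (obj X n) \<Longrightarrow> y \<in> carrier (obj X n) \<Longrightarrow>
      diff X n (x \<oplus>\<^bsub>obj X n\<^esub> y) = diff X n x \<oplus>\<^bsub>obj X (n + 1)\<^esub> diff X n y"
    and "a \<in> carrier R \<Longrightarrow> x \<in> carrier (obj X n) \<Longrightarrow>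
      diff X n (a \<odot>\<^bsub>obj X n\<^esub> x) = a \<odot>\<^bsub>obj X (n + 1)\<^esub> diff X n x"
    and "diff X n \<zero>\<^bsub>obj X n\<^esub> = \<zero>\<^bsub>obj X (n + 1)\<^esub>"
    and "x \<in> carrier (obj X n) \<Longrightarrow> diff X n (\<ominus>\<^bsub>obj X n\<^esub> x) = \<ominus>\<^bsub>obj X (n + 1)\<^esub> diff X n x"
    and "x \<in> carrier (obj X n) \<Longrightarrow> m = n + 1 \<Longrightarrow> diff X m (diff X n x) = \<zero>\<^bsub>obj X (m + 1)\<^esub>"
    and "a \<in> carrier R \<Longrightarrow> x \<in> carrier (obj X n) \<Longrightarrow> a \<odot>\<^bsub>obj X n\<^esub> x \<in> carrier (obj X n)"
    and "a \<in> carrier R \<Longrightarrow> x \<in> carrier (obj X n) \<Longrightarrow> y \<in> carrier (obj X n) \<Longrightarrow>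
      a \<odot>\<^bsub>obj X n\<^esub> (x \<oplus>\<^bsub>obj X n\<^esub> y) = a \<odot>\<^bsub>obj X n\<^esub> x \<oplus>\<^bsub>obj X n\<^esub> a \<odot>\<^bsub>obj X n\<^esub> y"
    and "a \<in> carrier R \<Longrightarrow> a \<odot>\<^bsub>obj X n\<^esub> \<zero>\<^bsub>obj X n\<^esub> = \<zero>\<^bsub>obj X n\<^esub>"
    and "a \<in> carrier R \<Longrightarrow> x \<in> carrier (obj X n) \<Longrightarrow>
      a \<odot>\<^bsub>obj X n\<^esub> (\<ominus>\<^bsub>obj X n\<^esub> x) = \<ominus>\<^bsub>obj X n\<^esub> (a \<odot>\<^bsub>obj X n\<^esub> x)"
proof -
  interpret module R "obj X n" by (rule bounded_complex_module[OF X])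
  note p = linear_map_props[OF bounded_complex_module[OF X] bounded_complex_module[OF X]
      diff_linear[OF X]]
  show "abelian_group (obj X n)" ..
  show "x \<in> carrier (obj X n) \<Longrightarrow> m = n + 1 \<Longrightarrow> diff X n x \<in> carrier (obj X m)"
    "x \<in> carrier (obj X n) \<Longrightarrow> y \<in> carrier (obj X n) \<Longrightarrow>
      diff X n (x \<oplus>\<^bsub>obj X n\<^esub> y) = diff X n x \<oplus>\<^bsub>obj X (n + 1)\<^esub> diff X n y"
    "a \<in> carrier R \<Longrightarrow> x \<in> carrier (obj X n) \<Longrightarrow>
      diff X n (a \<odot>\<^bsub>obj X n\<^esub> x) = a \<odot>\<^bsub>obj X (n + 1)\<^esub> diff X n x"
    "diff X n \<zero>\<^bsub>obj X n\<^esub> = \<zero>\<^bsub>obj X (n + 1)\<^esub>"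
    "x \<in> carrier (obj X n) \<Longrightarrow> diff X n (\<ominus>\<^bsub>obj X n\<^esub> x) = \<ominus>\<^bsub>obj X (n + 1)\<^esub> diff X n x"
    using p by simp_all
  show "x \<in> carrier (obj X n) \<Longrightarrow> m = n + 1 \<Longrightarrow> diff X m (diff X n x) = \<zero>\<^bsub>obj X (m + 1)\<^esub>"
    using X by (simp add: bounded_complex_def)
  show "a \<in> carrier R \<Longrightarrow> x \<in> carrier (obj X n) \<Longrightarrow> a \<odot>\<^bsub>obj X n\<^esub> x \<in> carrier (obj X n)"
    "a \<in> carrier R \<Longrightarrow> x \<in> carrier (obj X n) \<Longrightarrow> y \<in> carrier (obj X n) \<Longrightarrow>
      a \<odot>\<^bsub>obj X n\<^esub> (x \<oplus>\<^bsub>obj X n\<^esub> y) = a \<odot>\<^bsub>obj X n\<^esub> x \<oplus>\<^bsub>obj X n\<^esub> a \<odot>\<^bsub>obj X n\<^esub> y"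
    "a \<in> carrier R \<Longrightarrow> a \<odot>\<^bsub>obj X n\<^esub> \<zero>\<^bsub>obj X n\<^esub> = \<zero>\<^bsub>obj X n\<^esub>"
    "a \<in> carrier R \<Longrightarrow> x \<in> carrier (obj X n) \<Longrightarrow>
      a \<odot>\<^bsub>obj X n\<^esub> (\<ominus>\<^bsub>obj X n\<^esub> x) = \<ominus>\<^bsub>obj X n\<^esub> (a \<odot>\<^bsub>obj X n\<^esub> x)"
    by (simp_all add: smult_r_distr smult_r_minus)
qed

lemma chain_map_props:
  assumes X: "bounded_complex R X" and Y: "bounded_complex R Y" and f: "chain_map R X Y f"
  shows "x \<in> carrier (obj X n) \<Longrightarrow> f n x \<in> carrier (obj Y n)"
    and "x \<in> carrier (obj X n) \<Longrightarrow> y \<in> carrier (obj X n) \<Longrightarrow>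
      f n (x \<oplus>\<^bsub>obj X n\<^esub> y) = f n x \<oplus>\<^bsub>obj Y n\<^esub> f n y"
    and "a \<in> carrier R \<Longrightarrow> x \<in> carrier (obj X n) \<Longrightarrow>
      f n (a \<odot>\<^bsub>obj X n\<^esub> x) = a \<odot>\<^bsub>obj Y n\<^esub> f n x"
    and "f n \<zero>\<^bsub>obj X n\<^esub> = \<zero>\<^bsub>obj Y n\<^esub>"
    and "x \<in> carrier (obj X n) \<Longrightarrow> f n (\<ominus>\<^bsub>obj X n\<^esub> x) = \<ominus>\<^bsub>obj Y n\<^esub> f n x"
    and "x \<in> carrier (obj X n) \<Longrightarrow> m = n + 1 \<Longrightarrow> f m (diff X n x) = diff Y n (f n x)"
proof -
  have l: "f n \<in> linear_maps R (obj X n) (obj Y n)" for n using f by (simp add: chain_map_def)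
  note p = linear_map_props[OF bounded_complex_module[OF X] bounded_complex_module[OF Y] l]
  show "x \<in> carrier (obj X n) \<Longrightarrow> f n x \<in> carrier (obj Y n)"
    "x \<in> carrier (obj X n) \<Longrightarrow> y \<in> carrier (obj X n) \<Longrightarrow>
      f n (x \<oplus>\<^bsub>obj X n\<^esub> y) = f n x \<oplus>\<^bsub>obj Y n\<^esub> f n y"
    "a \<in> carrier R \<Longrightarrow> x \<in> carrier (obj X n) \<Longrightarrow>
      f n (a \<odot>\<^bsub>obj X n\<^esub> x) = a \<odot>\<^bsub>obj Y n\<^esub> f n x"
    "f n \<zero>\<^bsub>obj X n\<^esub> = \<zero>\<^bsub>obj Y n\<^esub>"
    "x \<in> carrier (obj X n) \<Longrightarrow> f n (\<ominus>\<^bsub>obj X n\<^esub> x) = \<ominus>\<^bsub>obj Y n\<^esub> f n x"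
    "x \<in> carrier (obj X n) \<Longrightarrow> m = n + 1 \<Longrightarrow> f m (diff X n x) = diff Y n (f n x)"
    using p f by (auto simp: chain_map_def)
qed

lemma chain_mapI:
  assumes "\<And>n x. x \<in> carrier (obj X n) \<Longrightarrow> f n x \<in> carrier (obj Y n)"
    and "\<And>n x y. x \<in> carrier (obj X n) \<Longrightarrow> y \<in> carrier (obj X n) \<Longrightarrow>
      f n (x \<oplus>\<^bsub>obj X n\<^esub> y) = f n x \<oplus>\<^bsub>obj Y n\<^esub> f n y"
    and "\<And>n a x. a \<in> carrier R \<Longrightarrow> x \<in> carrier (obj X n) \<Longrightarrow>
      f n (a \<odot>\<^bsub>obj X n\<^esub> x) = a \<odot>\<^bsub>obj Y n\<^esub> f n x"
    and "\<And>n x. x \<in> carrier (obj X n) \<Longrightarrow> diff Y n (f n x) = f (n + 1) (diff X n x)"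
  shows "chain_map R X Y f"
  using assms by (auto simp: chain_map_def linear_maps_def)

lemma chain_map_id: "bounded_complex R X \<Longrightarrow> chain_map R X X (\<lambda>n x. x)"
  by (rule chain_mapI) auto

lemma chain_map_comp:
  assumes "chain_map R X Y f" "chain_map R Y Z g"
  shows "chain_map R X Z (g \<circ>\<circ>\<circ> f)"
  using assms by (auto simp: chain_map_def linear_maps_def Pi_def)

lemma chain_map_zero:
  assumes X: "bounded_complex R X" and Y: "bounded_complex R Y"
  shows "chain_map R X Y (\<lambda>n x. \<zero>\<^bsub>obj Y n\<^esub>)"
  by (rule chain_mapI) (simp_all add: bounded_complex_props[OF X] bounded_complex_props[OF Y] abelian_group_cancel)

lemma chain_map_minus:
  assumes X: "bounded_complex R X" and Y: "bounded_complex R Y"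
    and f: "chain_map R X Y f" and g: "chain_map R X Y g"
  shows "chain_map R X Y (\<lambda>n x. f n x \<ominus>\<^bsub>obj Y n\<^esub> g n x)"
  by (rule chain_mapI) (simp_all add: bounded_complex_props[OF X] bounded_complex_props[OF Y]
    chain_map_props[OF X Y f] chain_map_props[OF X Y g] abelian_group_cancel)

lemma chain_map_smult:
  assumes X: "bounded_complex R X" and a: "a \<in> carrier R"
  shows "chain_map R X X (\<lambda>n x. a \<odot>\<^bsub>obj X n\<^esub> x)"
proof (rule chain_mapI)
  fix n b x assume "b \<in> carrier R" and x: "x \<in> carrier (obj X n)"
  interpret module R "obj X n" by (rule bounded_complex_module[OF X])
  show "a \<odot>\<^bsub>obj X n\<^esub> (b \<odot>\<^bsub>obj X n\<^esub> x) = b \<odot>\<^bsub>obj X n\<^esub> (a \<odot>\<^bsub>obj X n\<^esub> x)"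
    using \<open>b \<in> carrier R\<close> a x by (simp flip: smult_assoc1 add: m_comm)
qed (simp_all add: bounded_complex_props[OF X] a)

subsection \<open>Homotopies\<close>

lemma homotopicI:
  assumes "\<And>n x. x \<in> carrier (obj X n) \<Longrightarrow> h n x \<in> carrier (obj Y (n - 1))"
    and "\<And>n x y. x \<in> carrier (obj X n) \<Longrightarrow> y \<in> carrier (obj X n) \<Longrightarrow>
      h n (x \<oplus>\<^bsub>obj X n\<^esub> y) = h n x \<oplus>\<^bsub>obj Y (n - 1)\<^esub> h n y"
    and "\<And>n a x. a \<in> carrier R \<Longrightarrow> x \<in> carrier (obj X n) \<Longrightarrow>
      h n (a \<odot>\<^bsub>obj X n\<^esub> x) = a \<odot>\<^bsub>obj Y (n - 1)\<^esub> h n x"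
    and "\<And>n x. x \<in> carrier (obj X n) \<Longrightarrow> f n x \<ominus>\<^bsub>obj Y n\<^esub> g n x =
           diff Y (n - 1) (h n x) \<oplus>\<^bsub>obj Y n\<^esub> h (n + 1) (diff X n x)"
  shows "homotopic R X Y f g"
  unfolding homotopic_def using assms by (intro exI[of _ h]) (auto simp: linear_maps_def)

text \<open>\<open>homotopic\<close> with its witness exposed, so that the linearity of the homotopy
  can be handed to the simplifier.\<close>

definition homotopy :: "('a, 'r) ring_scheme \<Rightarrow> ('a, 'm) cochain \<Rightarrow> ('a, 'k) cochain \<Rightarrow>
    (int \<Rightarrow> 'm \<Rightarrow> 'k) \<Rightarrow> (int \<Rightarrow> 'm \<Rightarrow> 'k) \<Rightarrow> (int \<Rightarrow> 'm \<Rightarrow> 'k) \<Rightarrow> bool" where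
  "homotopy R X Y f g h \<longleftrightarrow> (\<forall>n. h n \<in> linear_maps R (obj X n) (obj Y (n - 1)) \<and>
        (\<forall>x \<in> carrier (obj X n). f n x \<ominus>\<^bsub>obj Y n\<^esub> g n x =
           diff Y (n - 1) (h n x) \<oplus>\<^bsub>obj Y n\<^esub> h (n + 1) (diff X n x)))"

lemma homotopicE:
  assumes "homotopic R X Y f g"
  obtains h where "homotopy R X Y f g h"
  using assms by (auto simp: homotopic_def homotopy_def)

lemma homotopy_props:
  assumes X: "bounded_complex R X" and Y: "bounded_complex R Y" and h: "homotopy R X Y f g h"
  shows "x \<in> carrier (obj X n) \<Longrightarrow> m = n - 1 \<Longrightarrow> h n x \<in> carrier (obj Y m)"
    and "x \<in> carrier (obj X n) \<Longrightarrow> y \<in> carrier (obj X n) \<Longrightarrow>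
      h n (x \<oplus>\<^bsub>obj X n\<^esub> y) = h n x \<oplus>\<^bsub>obj Y (n - 1)\<^esub> h n y"
    and "a \<in> carrier R \<Longrightarrow> x \<in> carrier (obj X n) \<Longrightarrow>
      h n (a \<odot>\<^bsub>obj X n\<^esub> x) = a \<odot>\<^bsub>obj Y (n - 1)\<^esub> h n x"
    and "h n \<zero>\<^bsub>obj X n\<^esub> = \<zero>\<^bsub>obj Y (n - 1)\<^esub>"
    and "x \<in> carrier (obj X n) \<Longrightarrow> h n (\<ominus>\<^bsub>obj X n\<^esub> x) = \<ominus>\<^bsub>obj Y (n - 1)\<^esub> h n x"
proof -
  have l: "h n \<in> linear_maps R (obj X n) (obj Y (n - 1))" for n using h by (simp add: homotopy_def)
  note p = linear_map_props[OF bounded_complex_module[OF X] bounded_complex_module[OF Y] l]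
  show "x \<in> carrier (obj X n) \<Longrightarrow> m = n - 1 \<Longrightarrow> h n x \<in> carrier (obj Y m)"
    "x \<in> carrier (obj X n) \<Longrightarrow> y \<in> carrier (obj X n) \<Longrightarrow>
      h n (x \<oplus>\<^bsub>obj X n\<^esub> y) = h n x \<oplus>\<^bsub>obj Y (n - 1)\<^esub> h n y"
    "a \<in> carrier R \<Longrightarrow> x \<in> carrier (obj X n) \<Longrightarrow>
      h n (a \<odot>\<^bsub>obj X n\<^esub> x) = a \<odot>\<^bsub>obj Y (n - 1)\<^esub> h n x"
    "h n \<zero>\<^bsub>obj X n\<^esub> = \<zero>\<^bsub>obj Y (n - 1)\<^esub>"
    "x \<in> carrier (obj X n) \<Longrightarrow> h n (\<ominus>\<^bsub>obj X n\<^esub> x) = \<ominus>\<^bsub>obj Y (n - 1)\<^esub> h n x"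
    using p by auto
qed

lemma homotopy_eq:
  "homotopy R X Y f g h \<Longrightarrow> x \<in> carrier (obj X n) \<Longrightarrow> f n x \<oplus>\<^bsub>obj Y n\<^esub> \<ominus>\<^bsub>obj Y n\<^esub> g n x =
     diff Y (n - 1) (h n x) \<oplus>\<^bsub>obj Y n\<^esub> h (n + 1) (diff X n x)"
  by (simp add: homotopy_def a_minus_def)

text \<open>The zero homotopy works. Values of maps off the carriers are arbitrary, so this takes
  the place of equality for chain maps that agree where it matters.\<close>

lemma homotopic_cong:
  assumes X: "bounded_complex R X" and Y: "bounded_complex R Y" and g: "chain_map R X Y g"
    and eq: "\<And>n x. x \<in> carrier (obj X n) \<Longrightarrow> f n x = g n x"
  shows "homotopic R X Y f g"
  by (rule homotopicI[where h = "\<lambda>n x. \<zero>\<^bsub>obj Y (n - 1)\<^esub>"])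
    (simp_all add: bounded_complex_props[OF X] bounded_complex_props[OF Y] eq
      chain_map_props[OF X Y g] abelian_group_cancel)

lemma homotopic_refl:
  "bounded_complex R X \<Longrightarrow> bounded_complex R Y \<Longrightarrow> chain_map R X Y f \<Longrightarrow> homotopic R X Y f f"
  by (rule homotopic_cong) auto

text \<open>A homotopy only sees the difference of two maps. Cones deal with null homotopic maps,
  and this is the translation.\<close>

lemma homotopic_minus:
  assumes X: "bounded_complex R X" and Y: "bounded_complex R Y"
    and f: "chain_map R X Y f" and g: "chain_map R X Y g"
  shows "homotopic R X Y f g \<longleftrightarrow>
    homotopic R X Y (\<lambda>n x. f n x \<ominus>\<^bsub>obj Y n\<^esub> g n x) (\<lambda>n x. \<zero>\<^bsub>obj Y n\<^esub>)"
proof -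
  have "(f n x \<ominus>\<^bsub>obj Y n\<^esub> g n x) \<ominus>\<^bsub>obj Y n\<^esub> \<zero>\<^bsub>obj Y n\<^esub> = f n x \<ominus>\<^bsub>obj Y n\<^esub> g n x"
    if "x \<in> carrier (obj X n)" for n x
    using that by (simp add: bounded_complex_props[OF Y]
      chain_map_props[OF X Y f] chain_map_props[OF X Y g] abelian_group_cancel)
  then show ?thesis by (simp add: homotopic_def)
qed

lemma homotopic_sym:
  assumes X: "bounded_complex R X" and Y: "bounded_complex R Y"
    and f: "chain_map R X Y f" and g: "chain_map R X Y g" and fg: "homotopic R X Y f g"
  shows "homotopic R X Y g f"
proof -
  from fg obtain h where H: "homotopy R X Y f g h" by (rule homotopicE)
  note h = homotopy_props[OF X Y H] and e = homotopy_eq[OF H]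
  note simps = bounded_complex_props[OF X] bounded_complex_props[OF Y] chain_map_props[OF X Y f]
    chain_map_props[OF X Y g] abelian_group_cancel h
  show ?thesis
  proof (rule homotopicI[where h = "\<lambda>n x. \<ominus>\<^bsub>obj Y (n - 1)\<^esub> h n x"])
    fix n x assume x: "x \<in> carrier (obj X n)"
    have "\<ominus>\<^bsub>obj Y n\<^esub> (f n x \<oplus>\<^bsub>obj Y n\<^esub> \<ominus>\<^bsub>obj Y n\<^esub> g n x) =
      \<ominus>\<^bsub>obj Y n\<^esub> (diff Y (n - 1) (h n x) \<oplus>\<^bsub>obj Y n\<^esub> h (n + 1) (diff X n x))"
      using e[OF x] by simp
    then show "g n x \<ominus>\<^bsub>obj Y n\<^esub> f n x = diff Y (n - 1) (\<ominus>\<^bsub>obj Y (n - 1)\<^esub> h n x) \<oplus>\<^bsub>obj Y n\<^esub>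
      \<ominus>\<^bsub>obj Y (n + 1 - 1)\<^esub> h (n + 1) (diff X n x)"
      using x by (simp add: simps)
  qed (simp_all add: simps)
qed

lemma homotopic_trans:
  assumes X: "bounded_complex R X" and Y: "bounded_complex R Y"
    and f: "chain_map R X Y f" and g: "chain_map R X Y g" and k: "chain_map R X Y k"
    and fg: "homotopic R X Y f g" and gk: "homotopic R X Y g k"
  shows "homotopic R X Y f k"
proof -
  from fg obtain h where H: "homotopy R X Y f g h" by (rule homotopicE)
  note h = homotopy_props[OF X Y H] and e = homotopy_eq[OF H]
  from gk obtain h' where H': "homotopy R X Y g k h'" by (rule homotopicE)
  note h' = homotopy_props[OF X Y H'] and e' = homotopy_eq[OF H']
  note simps = bounded_complex_props[OF X] bounded_complex_props[OF Y] chain_map_props[OF X Y f]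
    chain_map_props[OF X Y g] chain_map_props[OF X Y k] abelian_group_cancel h h'
  show ?thesis
  proof (rule homotopicI[where h = "\<lambda>n x. h n x \<oplus>\<^bsub>obj Y (n - 1)\<^esub> h' n x"])
    fix n x assume x: "x \<in> carrier (obj X n)"
    have "f n x \<ominus>\<^bsub>obj Y n\<^esub> k n x = (f n x \<oplus>\<^bsub>obj Y n\<^esub> \<ominus>\<^bsub>obj Y n\<^esub> g n x) \<oplus>\<^bsub>obj Y n\<^esub>
      (g n x \<oplus>\<^bsub>obj Y n\<^esub> \<ominus>\<^bsub>obj Y n\<^esub> k n x)"
      using x by (simp add: simps)
    also have "\<dots> = diff Y (n - 1) (h n x \<oplus>\<^bsub>obj Y (n - 1)\<^esub> h' n x) \<oplus>\<^bsub>obj Y n\<^esub>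
      (h (n + 1) (diff X n x) \<oplus>\<^bsub>obj Y (n + 1 - 1)\<^esub> h' (n + 1) (diff X n x))"
      unfolding e[OF x] e'[OF x] using x by (simp add: simps)
    finally show "f n x \<ominus>\<^bsub>obj Y n\<^esub> k n x = diff Y (n - 1) (h n x \<oplus>\<^bsub>obj Y (n - 1)\<^esub> h' n x) \<oplus>\<^bsub>obj Y n\<^esub>
      (h (n + 1) (diff X n x) \<oplus>\<^bsub>obj Y (n + 1 - 1)\<^esub> h' (n + 1) (diff X n x))" .
  qed (simp_all add: simps)
qed

lemma homotopic_comp_left:
  assumes X: "bounded_complex R X" and Y: "bounded_complex R Y" and Z: "bounded_complex R Z"
    and f: "chain_map R X Y f" and g: "chain_map R X Y g" and k: "chain_map R Y Z k"
    and fg: "homotopic R X Y f g"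
  shows "homotopic R X Z (k \<circ>\<circ>\<circ> f) (k \<circ>\<circ>\<circ> g)"
proof -
  from fg obtain h where H: "homotopy R X Y f g h" by (rule homotopicE)
  note h = homotopy_props[OF X Y H] and e = homotopy_eq[OF H]
  note simps = bounded_complex_props[OF X] bounded_complex_props[OF Y] bounded_complex_props[OF Z]
    chain_map_props[OF X Y f] chain_map_props[OF X Y g] chain_map_props[OF Y Z k] abelian_group_cancel h
  show ?thesis
  proof (rule homotopicI[where h = "\<lambda>n x. k (n - 1) (h n x)"])
    fix n x assume x: "x \<in> carrier (obj X n)"
    have "k n (f n x \<oplus>\<^bsub>obj Y n\<^esub> \<ominus>\<^bsub>obj Y n\<^esub> g n x) =
      k n (diff Y (n - 1) (h n x) \<oplus>\<^bsub>obj Y n\<^esub> h (n + 1) (diff X n x))"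
      using e[OF x] by simp
    then show "(k n \<circ> f n) x \<ominus>\<^bsub>obj Z n\<^esub> (k n \<circ> g n) x = diff Z (n - 1) (k (n - 1) (h n x)) \<oplus>\<^bsub>obj Z n\<^esub>
      k (n + 1 - 1) (h (n + 1) (diff X n x))"
      using x by (simp add: simps)
  qed (simp_all add: simps)
qed

lemma homotopic_comp_right:
  assumes X: "bounded_complex R X" and Y: "bounded_complex R Y" and Z: "bounded_complex R Z"
    and f: "chain_map R Y Z f" and g: "chain_map R Y Z g" and k: "chain_map R X Y k"
    and fg: "homotopic R Y Z f g"
  shows "homotopic R X Z (f \<circ>\<circ>\<circ> k) (g \<circ>\<circ>\<circ> k)"
proof -
  from fg obtain h where H: "homotopy R Y Z f g h" by (rule homotopicE)
  note h = homotopy_props[OF Y Z H] and e = homotopy_eq[OF H]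
  note simps = bounded_complex_props[OF X] bounded_complex_props[OF Y] bounded_complex_props[OF Z]
    chain_map_props[OF Y Z f] chain_map_props[OF Y Z g] chain_map_props[OF X Y k] h
  show ?thesis
  proof (rule homotopicI[where h = "\<lambda>n x. h n (k n x)"])
    fix n x assume x: "x \<in> carrier (obj X n)"
    then show "(f n \<circ> k n) x \<ominus>\<^bsub>obj Z n\<^esub> (g n \<circ> k n) x = diff Z (n - 1) (h n (k n x)) \<oplus>\<^bsub>obj Z n\<^esub>
      h (n + 1) (k (n + 1) (diff X n x))"
      using e[of "k n x" n] by (simp add: simps a_minus_def)
  qed (simp_all add: simps)
qed

subsection \<open>Cohomology\<close>

text \<open>Equality of cohomology classes as a relation on cocycles, with the boundary on the left
  as in the cosets that make up \<open>cohomology\<close>. Arguments about quasi-isomorphisms run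
  through it without touching cosets.\<close>

definition cohomologous :: "('a, 'm) cochain \<Rightarrow> int \<Rightarrow> 'm \<Rightarrow> 'm \<Rightarrow> bool" where
  "cohomologous X n x y \<longleftrightarrow> x \<in> cocycles X n \<and> y \<in> cocycles X n \<and>
     (\<exists>b \<in> carrier (obj X (n - 1)). x = diff X (n - 1) b \<oplus>\<^bsub>obj X n\<^esub> y)"

lemma cocyclesD:
  assumes "x \<in> cocycles X n"
  shows "x \<in> carrier (obj X n)" and "diff X n x = \<zero>\<^bsub>obj X (n + 1)\<^esub>"
  using assms by (auto simp: cocycles_def)

lemma cohomologous_refl:
  assumes X: "bounded_complex R X" and "x \<in> cocycles X n"
  shows "cohomologous X n x x"
  unfolding cohomologous_def using assms(2)
  by (auto intro!: bexI[of _ "\<zero>\<^bsub>obj X (n - 1)\<^esub>"]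
      simp: bounded_complex_props[OF X] abelian_group_cancel cocycles_def)

lemma cohomologous_sym:
  assumes X: "bounded_complex R X" and xy: "cohomologous X n x y"
  shows "cohomologous X n y x"
proof -
  note simps = bounded_complex_props[OF X] abelian_group_cancel
  obtain b where b: "b \<in> carrier (obj X (n - 1))" and e: "x = diff X (n - 1) b \<oplus>\<^bsub>obj X n\<^esub> y"
    and c: "x \<in> cocycles X n" "y \<in> cocycles X n"
    using xy by (auto simp: cohomologous_def)
  have "y = diff X (n - 1) (\<ominus>\<^bsub>obj X (n - 1)\<^esub> b) \<oplus>\<^bsub>obj X n\<^esub> x"
    unfolding e using b cocyclesD[OF c(2)] by (simp add: simps)
  moreover have "\<ominus>\<^bsub>obj X (n - 1)\<^esub> b \<in> carrier (obj X (n - 1))" using b by (simp add: simps)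
  ultimately show ?thesis using c unfolding cohomologous_def by blast
qed

lemma cohomologous_trans:
  assumes X: "bounded_complex R X" and xy: "cohomologous X n x y" and yz: "cohomologous X n y z"
  shows "cohomologous X n x z"
proof -
  note simps = bounded_complex_props[OF X] abelian_group_cancel
  obtain b where b: "b \<in> carrier (obj X (n - 1))" and e: "x = diff X (n - 1) b \<oplus>\<^bsub>obj X n\<^esub> y"
    and c: "x \<in> cocycles X n"
    using xy by (auto simp: cohomologous_def)
  obtain b' where b': "b' \<in> carrier (obj X (n - 1))" and e': "y = diff X (n - 1) b' \<oplus>\<^bsub>obj X n\<^esub> z"
    and c': "z \<in> cocycles X n"
    using yz by (auto simp: cohomologous_def)
  have "x = diff X (n - 1) (b \<oplus>\<^bsub>obj X (n - 1)\<^esub> b') \<oplus>\<^bsub>obj X n\<^esub> z"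
    unfolding e e' using b b' cocyclesD[OF c'] by (simp add: simps)
  moreover have "b \<oplus>\<^bsub>obj X (n - 1)\<^esub> b' \<in> carrier (obj X (n - 1))" using b b' by (simp add: simps)
  ultimately show ?thesis using c c' unfolding cohomologous_def by blast
qed

lemma chain_map_cocycle:
  assumes X: "bounded_complex R X" and Y: "bounded_complex R Y" and f: "chain_map R X Y f"
    and x: "x \<in> cocycles X n"
  shows "f n x \<in> cocycles Y n"
  using cocyclesD[OF x] chain_map_props(6)[OF X Y f, of x n "n + 1"]
  by (simp add: cocycles_def chain_map_props[OF X Y f])

lemma chain_map_cohomologous:
  assumes X: "bounded_complex R X" and Y: "bounded_complex R Y" and f: "chain_map R X Y f"
    and xy: "cohomologous X n x y"
  shows "cohomologous Y n (f n x) (f n y)"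
proof -
  note simps = bounded_complex_props[OF X] chain_map_props[OF X Y f]
  obtain b where b: "b \<in> carrier (obj X (n - 1))" and e: "x = diff X (n - 1) b \<oplus>\<^bsub>obj X n\<^esub> y"
    and c: "x \<in> cocycles X n" "y \<in> cocycles X n"
    using xy by (auto simp: cohomologous_def)
  have "f n x = diff Y (n - 1) (f (n - 1) b) \<oplus>\<^bsub>obj Y n\<^esub> f n y"
    unfolding e using b cocyclesD[OF c(2)] by (simp add: simps)
  moreover have "f (n - 1) b \<in> carrier (obj Y (n - 1))" using b by (simp add: simps)
  ultimately show ?thesis using c unfolding cohomologous_def
    by (blast intro: chain_map_cocycle[OF X Y f])
qed

text \<open>On a cocycle the term \<open>h (d x)\<close> drops out, so the two images differ by the
  boundary of \<open>h x\<close>.\<close>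

lemma homotopic_cohomologous:
  assumes X: "bounded_complex R X" and Y: "bounded_complex R Y" and f: "chain_map R X Y f"
    and g: "chain_map R X Y g" and fg: "homotopic R X Y f g" and x: "x \<in> cocycles X n"
  shows "cohomologous Y n (f n x) (g n x)"
proof -
  from fg obtain h where H: "homotopy R X Y f g h" by (rule homotopicE)
  note simps = bounded_complex_props[OF X] bounded_complex_props[OF Y] chain_map_props[OF X Y f]
    chain_map_props[OF X Y g] homotopy_props[OF X Y H] abelian_group_cancel
  note x' = cocyclesD[OF x]
  have "h (n + 1) \<zero>\<^bsub>obj X (n + 1)\<^esub> = \<zero>\<^bsub>obj Y n\<^esub>"
    using homotopy_props(4)[OF X Y H, of "n + 1"] by simp
  then have "f n x \<oplus>\<^bsub>obj Y n\<^esub> \<ominus>\<^bsub>obj Y n\<^esub> g n x = diff Y (n - 1) (h n x)"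
    using homotopy_eq[OF H x'(1)] x' by (simp add: simps)
  then have "diff Y (n - 1) (h n x) \<oplus>\<^bsub>obj Y n\<^esub> g n x =
    (f n x \<oplus>\<^bsub>obj Y n\<^esub> \<ominus>\<^bsub>obj Y n\<^esub> g n x) \<oplus>\<^bsub>obj Y n\<^esub> g n x" by simp
  also have "\<dots> = f n x" using x' by (simp add: simps)
  finally have "f n x = diff Y (n - 1) (h n x) \<oplus>\<^bsub>obj Y n\<^esub> g n x" by simp
  moreover have "h n x \<in> carrier (obj Y (n - 1))" using x' by (simp add: simps)
  ultimately show ?thesis unfolding cohomologous_def
    using chain_map_cocycle[OF X Y f x] chain_map_cocycle[OF X Y g x] by blast
qed

subsection \<open>Quasi-isomorphisms\<close>

abbreviation cohomology_class :: "('a, 'm) cochain \<Rightarrow> int \<Rightarrow> 'm \<Rightarrow> 'm set" where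
  "cohomology_class X n x \<equiv> coboundaries X n +>\<^bsub>obj X n\<^esub> x"

lemma cohomology_class_eq:
  assumes X: "bounded_complex R X" and x: "x \<in> cocycles X n"
  shows "cohomology_class X n x = {y. cohomologous X n y x}"
proof -
  note simps = bounded_complex_props[OF X] abelian_group_cancel
  have "diff X (n - 1) b \<oplus>\<^bsub>obj X n\<^esub> x \<in> cocycles X n" if "b \<in> carrier (obj X (n - 1))" for b
    using that cocyclesD[OF x] by (simp add: cocycles_def simps)
  then show ?thesis
    using x by (auto simp: a_r_coset_def' coboundaries_def cohomologous_def)
qed

lemma carrier_cohomology: "carrier (cohomology X n) = cohomology_class X n ` cocycles X n"
  by (auto simp: cohomology_def A_FactGroup_def FactGroup_def RCOSETS_def a_r_coset_def r_coset_def)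

lemma cohomology_class_add:
  assumes X: "bounded_complex R X" and x: "x \<in> cocycles X n" and y: "y \<in> cocycles X n"
  shows "cohomology_class X n x \<otimes>\<^bsub>cohomology X n\<^esub> cohomology_class X n y =
    cohomology_class X n (x \<oplus>\<^bsub>obj X n\<^esub> y)"
proof -
  note simps = bounded_complex_props[OF X] abelian_group_cancel
  note xy = cocyclesD[OF x] cocyclesD[OF y]
  show ?thesis
  proof (intro equalityI subsetI)
    fix z assume "z \<in> cohomology_class X n x \<otimes>\<^bsub>cohomology X n\<^esub> cohomology_class X n y"
    then obtain b b' where b: "b \<in> carrier (obj X (n - 1))" "b' \<in> carrier (obj X (n - 1))"
      and z: "z = (diff X (n - 1) b \<oplus>\<^bsub>obj X n\<^esub> x) \<oplus>\<^bsub>obj X n\<^esub> (diff X (n - 1) b' \<oplus>\<^bsub>obj X n\<^esub> y)"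
      by (auto simp: cohomology_def A_FactGroup_def FactGroup_def set_mult_def a_r_coset_def'
          coboundaries_def)
    have "z = diff X (n - 1) (b \<oplus>\<^bsub>obj X (n - 1)\<^esub> b') \<oplus>\<^bsub>obj X n\<^esub> (x \<oplus>\<^bsub>obj X n\<^esub> y)"
      unfolding z using b xy by (simp add: simps)
    moreover have "b \<oplus>\<^bsub>obj X (n - 1)\<^esub> b' \<in> carrier (obj X (n - 1))" using b by (simp add: simps)
    ultimately show "z \<in> cohomology_class X n (x \<oplus>\<^bsub>obj X n\<^esub> y)"
      by (auto simp: a_r_coset_def' coboundaries_def)
  next
    fix z assume "z \<in> cohomology_class X n (x \<oplus>\<^bsub>obj X n\<^esub> y)"
    then obtain b where b: "b \<in> carrier (obj X (n - 1))"
      and z: "z = diff X (n - 1) b \<oplus>\<^bsub>obj X n\<^esub> (x \<oplus>\<^bsub>obj X n\<^esub> y)"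
      by (auto simp: a_r_coset_def' coboundaries_def)
    have "z = (diff X (n - 1) b \<oplus>\<^bsub>obj X n\<^esub> x) \<oplus>\<^bsub>obj X n\<^esub> 
      (diff X (n - 1) \<zero>\<^bsub>obj X (n - 1)\<^esub> \<oplus>\<^bsub>obj X n\<^esub> y)"
      unfolding z using b xy by (simp add: simps)
    moreover have "\<zero>\<^bsub>obj X (n - 1)\<^esub> \<in> carrier (obj X (n - 1))" by (simp add: simps)
    ultimately show "z \<in> cohomology_class X n x \<otimes>\<^bsub>cohomology X n\<^esub> cohomology_class X n y"
      using b unfolding cohomology_def A_FactGroup_def FactGroup_def set_mult_def a_r_coset_def'
        coboundaries_def by simp blast
  qed
qed

lemma cohomology_map_class:
  assumes X: "bounded_complex R X" and Y: "bounded_complex R Y" and f: "chain_map R X Y f"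
    and x: "x \<in> cocycles X n"
  shows "cohomology_map Y f n (cohomology_class X n x) = cohomology_class Y n (f n x)"
proof -
  note simps = bounded_complex_props[OF X] bounded_complex_props[OF Y] chain_map_props[OF X Y f]
    abelian_group_cancel
  note x' = cocyclesD[OF x]
  have "diff Y (n - 1) b \<oplus>\<^bsub>obj Y n\<^esub> f n (diff X (n - 1) b' \<oplus>\<^bsub>obj X n\<^esub> x) =
    diff Y (n - 1) (b \<oplus>\<^bsub>obj Y (n - 1)\<^esub> f (n - 1) b') \<oplus>\<^bsub>obj Y n\<^esub> f n x"
    if "b \<in> carrier (obj Y (n - 1))" "b' \<in> carrier (obj X (n - 1))" for b b'
    using that x' by (simp add: simps)
  moreover have "diff Y (n - 1) b \<oplus>\<^bsub>obj Y n\<^esub> f n x =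
    diff Y (n - 1) b \<oplus>\<^bsub>obj Y n\<^esub> f n (diff X (n - 1) \<zero>\<^bsub>obj X (n - 1)\<^esub> \<oplus>\<^bsub>obj X n\<^esub> x)"
    if "b \<in> carrier (obj Y (n - 1))" for b
    using that x' by (simp add: simps)
  moreover have "b \<oplus>\<^bsub>obj Y (n - 1)\<^esub> f (n - 1) b' \<in> carrier (obj Y (n - 1))"
    if "b \<in> carrier (obj Y (n - 1))" "b' \<in> carrier (obj X (n - 1))" for b b'
    using that by (simp add: simps)
  moreover have "\<zero>\<^bsub>obj X (n - 1)\<^esub> \<in> carrier (obj X (n - 1))" by (simp add: simps)
  ultimately show ?thesis
    unfolding cohomology_map_def set_add_def' a_r_coset_def' coboundaries_def
    by (fastforce simp: image_iff)
qed

text \<open>In the form below, composition, two out of three and homotopy invariance of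
  quasi-isomorphisms become statements about equivalence relations.\<close>

lemma quasi_iso_iff:
  fixes X :: "('a, 'm) cochain" and Y :: "('a, 'k) cochain"
  assumes X: "bounded_complex R X" and Y: "bounded_complex R Y"
  shows "quasi_iso R X Y f \<longleftrightarrow> chain_map R X Y f \<and>
    (\<forall>n. \<forall>x \<in> cocycles X n. \<forall>x' \<in> cocycles X n.
       cohomologous Y n (f n x) (f n x') \<longrightarrow> cohomologous X n x x') \<and>
    (\<forall>n. \<forall>y \<in> cocycles Y n. \<exists>x \<in> cocycles X n. cohomologous Y n (f n x) y)"
proof (cases "chain_map R X Y f")
  case f: True
  have cl: "cohomology_class Z n x = cohomology_class Z n y \<longleftrightarrow> cohomologous Z n x y"
    if Z: "bounded_complex R Z" and xy: "x \<in> cocycles Z n" "y \<in> cocycles Z n"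
    for Z :: "('a, 'z) cochain" and n x y
    unfolding cohomology_class_eq[OF Z xy(1)] cohomology_class_eq[OF Z xy(2)]
    using cohomologous_refl[OF Z] cohomologous_sym[OF Z] cohomologous_trans[OF Z] xy by blast
  have eq_iff_surj: "A = C \<longleftrightarrow> Q" if "A = B" "B \<subseteq> C" "C \<subseteq> B \<longleftrightarrow> Q" for A B C :: "'k set set" and Q
    using that by blast
  have add: "x \<oplus>\<^bsub>obj X n\<^esub> y \<in> cocycles X n" if "x \<in> cocycles X n" "y \<in> cocycles X n" for n x y
    using cocyclesD[OF that(1)] cocyclesD[OF that(2)]
    by (simp add: cocycles_def bounded_complex_props[OF X] abelian_group_cancel)
  have hom: "cohomology_map Y f n \<in> hom (cohomology X n) (cohomology Y n)" for n
    by (rule homI)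
      (use chain_map_cocycle[OF X Y f] in \<open>auto simp: carrier_cohomology cohomology_map_class[OF X Y f]
        cohomology_class_add[OF X] cohomology_class_add[OF Y] add chain_map_props[OF X Y f] cocyclesD\<close>)
  have "inj_on (cohomology_map Y f n) (carrier (cohomology X n)) \<longleftrightarrow>
    (\<forall>x \<in> cocycles X n. \<forall>x' \<in> cocycles X n.
       cohomologous Y n (f n x) (f n x') \<longrightarrow> cohomologous X n x x')" for n
    by (simp add: carrier_cohomology inj_on_def cohomology_map_class[OF X Y f] cl[OF X] cl[OF Y]
        chain_map_cocycle[OF X Y f])
  moreover have "cohomology_map Y f n ` carrier (cohomology X n) = carrier (cohomology Y n) \<longleftrightarrow>
    (\<forall>y \<in> cocycles Y n. \<exists>x \<in> cocycles X n. cohomologous Y n (f n x) y)" for n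
  proof -
    have "cohomology_map Y f n ` carrier (cohomology X n) =
      (\<lambda>x. cohomology_class Y n (f n x)) ` cocycles X n"
      unfolding carrier_cohomology image_image
      by (rule image_cong) (simp_all add: cohomology_map_class[OF X Y f])
    moreover have "(\<lambda>x. cohomology_class Y n (f n x)) ` cocycles X n \<subseteq> carrier (cohomology Y n)"
      using chain_map_cocycle[OF X Y f] by (auto simp only: carrier_cohomology)
    moreover have "carrier (cohomology Y n) \<subseteq> (\<lambda>x. cohomology_class Y n (f n x)) ` cocycles X n \<longleftrightarrow>
      (\<forall>y \<in> cocycles Y n. \<exists>x \<in> cocycles X n. cohomology_class Y n (f n x) = cohomology_class Y n y)"
      unfolding carrier_cohomology image_subset_iff image_iff by (simp only: eq_commute[of "cohomology_class Y n (f n _)"])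
    ultimately have "cohomology_map Y f n ` carrier (cohomology X n) = carrier (cohomology Y n) \<longleftrightarrow>
      (\<forall>y \<in> cocycles Y n. \<exists>x \<in> cocycles X n. cohomology_class Y n (f n x) = cohomology_class Y n y)"
      by (rule eq_iff_surj)
    also have "\<dots> \<longleftrightarrow> (\<forall>y \<in> cocycles Y n. \<exists>x \<in> cocycles X n. cohomologous Y n (f n x) y)"
      using cl[OF Y] chain_map_cocycle[OF X Y f] by (intro ball_cong bex_cong) auto
    finally show ?thesis .
  qed
  ultimately show ?thesis
    using f hom unfolding quasi_iso_def iso_def bij_betw_def by (simp add: all_conj_distrib)
qed (simp add: quasi_iso_def)

text \<open>Additivity of \<open>f\<close> reduces injectivity on cohomology to its kernel: the
  difference of two cocycles with cohomologous images is a cocycle whose image is a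
  coboundary.\<close>

lemma quasi_isoI:
  assumes X: "bounded_complex R X" and Y: "bounded_complex R Y" and f: "chain_map R X Y f"
    and inj: "\<And>n x b. x \<in> carrier (obj X n) \<Longrightarrow> diff X n x = \<zero>\<^bsub>obj X (n + 1)\<^esub> \<Longrightarrow>
      b \<in> carrier (obj Y (n - 1)) \<Longrightarrow> f n x = diff Y (n - 1) b \<Longrightarrow>
      \<exists>a \<in> carrier (obj X (n - 1)). x = diff X (n - 1) a"
    and surj: "\<And>n y. y \<in> carrier (obj Y n) \<Longrightarrow> diff Y n y = \<zero>\<^bsub>obj Y (n + 1)\<^esub> \<Longrightarrow>
      \<exists>x \<in> carrier (obj X n). \<exists>b \<in> carrier (obj Y (n - 1)). diff X n x = \<zero>\<^bsub>obj X (n + 1)\<^esub> \<and>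
        f n x = diff Y (n - 1) b \<oplus>\<^bsub>obj Y n\<^esub> y"
  shows "quasi_iso R X Y f"
proof -
  note simps = bounded_complex_props[OF X] bounded_complex_props[OF Y] chain_map_props[OF X Y f]
    abelian_group_cancel
  have "cohomologous X n x x'" if x: "x \<in> cocycles X n" "x' \<in> cocycles X n"
    and h: "cohomologous Y n (f n x) (f n x')" for n x x'
  proof -
    note x1 = cocyclesD[OF x(1)] and x2 = cocyclesD[OF x(2)]
    obtain b where b: "b \<in> carrier (obj Y (n - 1))"
      and e: "f n x = diff Y (n - 1) b \<oplus>\<^bsub>obj Y n\<^esub> f n x'"
      using h by (auto simp: cohomologous_def)
    have "f n (x \<oplus>\<^bsub>obj X n\<^esub> \<ominus>\<^bsub>obj X n\<^esub> x') = f n x \<oplus>\<^bsub>obj Y n\<^esub> \<ominus>\<^bsub>obj Y n\<^esub> f n x'"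
      using x1 x2 by (simp add: simps)
    also have "\<dots> = diff Y (n - 1) b" unfolding e using x1 x2 b by (simp add: simps)
    finally have "f n (x \<oplus>\<^bsub>obj X n\<^esub> \<ominus>\<^bsub>obj X n\<^esub> x') = diff Y (n - 1) b" .
    then obtain a where a: "a \<in> carrier (obj X (n - 1))" "x \<oplus>\<^bsub>obj X n\<^esub> \<ominus>\<^bsub>obj X n\<^esub> x' = diff X (n - 1) a"
      using inj[of "x \<oplus>\<^bsub>obj X n\<^esub> \<ominus>\<^bsub>obj X n\<^esub> x'" n b] x1 x2 b by (auto simp: simps)
    have "x = (x \<oplus>\<^bsub>obj X n\<^esub> \<ominus>\<^bsub>obj X n\<^esub> x') \<oplus>\<^bsub>obj X n\<^esub> x'" using x1 x2 by (simp add: simps)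
    then show ?thesis using a x unfolding cohomologous_def by auto
  qed
  moreover have "\<exists>x \<in> cocycles X n. cohomologous Y n (f n x) y" if y: "y \<in> cocycles Y n" for n y
  proof -
    obtain x b where x: "x \<in> carrier (obj X n)" "diff X n x = \<zero>\<^bsub>obj X (n + 1)\<^esub>"
      and b: "b \<in> carrier (obj Y (n - 1))" "f n x = diff Y (n - 1) b \<oplus>\<^bsub>obj Y n\<^esub> y"
      using surj[OF cocyclesD[OF y]] by blast
    have xc: "x \<in> cocycles X n" using x by (simp add: cocycles_def)
    have "cohomologous Y n (f n x) y"
      unfolding cohomologous_def using y b chain_map_cocycle[OF X Y f xc] by blast
    with xc show ?thesis by blast
  qed
  ultimately show ?thesis unfolding quasi_iso_iff[OF X Y] using f by blast
qed

lemma quasi_iso_chain_map: "quasi_iso R X Y f \<Longrightarrow> chain_map R X Y f"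
  by (simp add: quasi_iso_def)

lemma quasi_iso_comp:
  assumes X: "bounded_complex R X" and Y: "bounded_complex R Y" and Z: "bounded_complex R Z"
    and f: "quasi_iso R X Y f" and g: "quasi_iso R Y Z g"
  shows "quasi_iso R X Z (g \<circ>\<circ>\<circ> f)"
proof -
  note fc = quasi_iso_chain_map[OF f] and gc = quasi_iso_chain_map[OF g]
  note fq = f[unfolded quasi_iso_iff[OF X Y]] and gq = g[unfolded quasi_iso_iff[OF Y Z]]
  have "\<exists>x \<in> cocycles X n. cohomologous Z n (g n (f n x)) z" if z: "z \<in> cocycles Z n" for n z
  proof -
    obtain y where y: "y \<in> cocycles Y n" "cohomologous Z n (g n y) z" using gq z by blast
    obtain x where x: "x \<in> cocycles X n" "cohomologous Y n (f n x) y" using fq y by blast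
    show ?thesis
      using x y chain_map_cohomologous[OF Y Z gc x(2)] cohomologous_trans[OF Z] by blast
  qed
  then show ?thesis unfolding quasi_iso_iff[OF X Z]
    using fq gq chain_map_comp[OF fc gc] chain_map_cocycle[OF X Y fc] by simp
qed

lemma quasi_iso_cancel_left:
  assumes X: "bounded_complex R X" and Y: "bounded_complex R Y" and Z: "bounded_complex R Z"
    and f: "chain_map R X Y f" and g: "quasi_iso R Y Z g" and gf: "quasi_iso R X Z (g \<circ>\<circ>\<circ> f)"
  shows "quasi_iso R X Y f"
proof -
  note gc = quasi_iso_chain_map[OF g]
  note gq = g[unfolded quasi_iso_iff[OF Y Z]] and gfq = gf[unfolded quasi_iso_iff[OF X Z], simplified]
  show ?thesis unfolding quasi_iso_iff[OF X Y]
  proof (intro conjI allI ballI impI)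
    fix n x x' assume "x \<in> cocycles X n" "x' \<in> cocycles X n" "cohomologous Y n (f n x) (f n x')"
    then show "cohomologous X n x x'"
      using gfq chain_map_cohomologous[OF Y Z gc] by blast
  next
    fix n y assume y: "y \<in> cocycles Y n"
    then obtain x where x: "x \<in> cocycles X n" "cohomologous Z n (g n (f n x)) (g n y)"
      using gfq chain_map_cocycle[OF Y Z gc y] by blast
    then show "\<exists>x \<in> cocycles X n. cohomologous Y n (f n x) y"
      using gq y chain_map_cocycle[OF X Y f] by blast
  qed (rule f)
qed

lemma quasi_iso_cancel_right:
  assumes X: "bounded_complex R X" and Y: "bounded_complex R Y" and Z: "bounded_complex R Z"
    and f: "quasi_iso R X Y f" and g: "chain_map R Y Z g" and gf: "quasi_iso R X Z (g \<circ>\<circ>\<circ> f)"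
  shows "quasi_iso R Y Z g"
proof -
  note fc = quasi_iso_chain_map[OF f]
  note fq = f[unfolded quasi_iso_iff[OF X Y]] and gfq = gf[unfolded quasi_iso_iff[OF X Z], simplified]
  show ?thesis unfolding quasi_iso_iff[OF Y Z]
  proof (intro conjI allI ballI impI)
    fix n y y' assume y: "y \<in> cocycles Y n" "y' \<in> cocycles Y n" "cohomologous Z n (g n y) (g n y')"
    obtain x x' where x: "x \<in> cocycles X n" "cohomologous Y n (f n x) y"
      "x' \<in> cocycles X n" "cohomologous Y n (f n x') y'" using fq y by blast
    have "cohomologous Z n (g n (f n x)) (g n (f n x'))"
      using x y chain_map_cohomologous[OF Y Z g] cohomologous_trans[OF Z] cohomologous_sym[OF Z] by meson
    then have "cohomologous X n x x'" using gfq x by blast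
    then show "cohomologous Y n y y'"
      using x chain_map_cohomologous[OF X Y fc] cohomologous_trans[OF Y] cohomologous_sym[OF Y] by meson
  next
    fix n z assume "z \<in> cocycles Z n"
    then show "\<exists>y \<in> cocycles Y n. cohomologous Z n (g n y) z"
      using gfq chain_map_cocycle[OF X Y fc] by blast
  qed (rule g)
qed

lemma quasi_iso_homotopic:
  assumes X: "bounded_complex R X" and Y: "bounded_complex R Y"
    and f: "quasi_iso R X Y f" and g: "chain_map R X Y g" and fg: "homotopic R X Y f g"
  shows "quasi_iso R X Y g"
proof -
  note fc = quasi_iso_chain_map[OF f]
  note fq = f[unfolded quasi_iso_iff[OF X Y]]
  note h = homotopic_cohomologous[OF X Y fc g fg]
  show ?thesis unfolding quasi_iso_iff[OF X Y]
  proof (intro conjI allI ballI impI)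
    fix n x x' assume x: "x \<in> cocycles X n" "x' \<in> cocycles X n" "cohomologous Y n (g n x) (g n x')"
    have "cohomologous Y n (f n x) (f n x')"
      by (rule cohomologous_trans[OF Y h[OF x(1)] cohomologous_trans[OF Y x(3) cohomologous_sym[OF Y h[OF x(2)]]]])
    then show "cohomologous X n x x'" using fq x by blast
  next
    fix n y assume "y \<in> cocycles Y n"
    then obtain x where x: "x \<in> cocycles X n" "cohomologous Y n (f n x) y" using fq by blast
    show "\<exists>x \<in> cocycles X n. cohomologous Y n (g n x) y"
      using x(1) cohomologous_trans[OF Y cohomologous_sym[OF Y h[OF x(1)]] x(2)] by blast
  qed (rule g)
qed

lemma quasi_iso_id: "bounded_complex R X \<Longrightarrow> quasi_iso R X X (\<lambda>n x. x)"
  unfolding quasi_iso_iff using cohomologous_refl chain_map_id by fastforce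

section \<open>Acyclic complexes\<close>

definition acyclic_complex :: "('a, 'm) cochain \<Rightarrow> bool" where
  "acyclic_complex X \<longleftrightarrow> (\<forall>n. \<forall>x \<in> carrier (obj X n). diff X n x = \<zero>\<^bsub>obj X (n + 1)\<^esub> \<longrightarrow>
     (\<exists>b \<in> carrier (obj X (n - 1)). x = diff X (n - 1) b))"

lemma acyclic_complex_cohomologous:
  assumes X: "bounded_complex R X"
  shows "acyclic_complex X \<longleftrightarrow> (\<forall>n. \<forall>x \<in> cocycles X n. cohomologous X n x \<zero>\<^bsub>obj X n\<^esub>)"
proof -
  note simps = bounded_complex_props[OF X] abelian_group_cancel
  have "cohomologous X n x \<zero>\<^bsub>obj X n\<^esub> \<longleftrightarrow> x \<in> cocycles X n \<and> (\<exists>b \<in> carrier (obj X (n - 1)). x = diff X (n - 1) b)"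
    for n x by (auto simp: cohomologous_def cocycles_def simps)
  then show ?thesis unfolding acyclic_complex_def by (auto simp: cocycles_def)
qed

text \<open>All cocycles on both sides are cohomologous to zero, so any chain map will do. With the
  zero map this lets the zero complex stand in for every acyclic one.\<close>

lemma chain_map_acyclic_quasi_iso:
  assumes X: "bounded_complex R X" and Y: "bounded_complex R Y" and f: "chain_map R X Y f"
    and aX: "acyclic_complex X" and aY: "acyclic_complex Y"
  shows "quasi_iso R X Y f"
proof -
  have z: "\<zero>\<^bsub>obj X n\<^esub> \<in> cocycles X n" for n
    by (simp add: cocycles_def bounded_complex_props[OF X] abelian_group_cancel)
  have z': "f n \<zero>\<^bsub>obj X n\<^esub> = \<zero>\<^bsub>obj Y n\<^esub>" for n by (rule chain_map_props[OF X Y f])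
  note aX' = aX[unfolded acyclic_complex_cohomologous[OF X], rule_format]
    and aY' = aY[unfolded acyclic_complex_cohomologous[OF Y], rule_format]
  show ?thesis unfolding quasi_iso_iff[OF X Y]
  proof (intro conjI allI ballI impI)
    fix n x x' assume x: "x \<in> cocycles X n" "x' \<in> cocycles X n"
    show "cohomologous X n x x'"
      by (rule cohomologous_trans[OF X aX'[OF x(1)] cohomologous_sym[OF X aX'[OF x(2)]]])
  next
    fix n y assume y: "y \<in> cocycles Y n"
    show "\<exists>x \<in> cocycles X n. cohomologous Y n (f n x) y"
      using z[of n] cohomologous_sym[OF Y aY'[OF y]] z' by (intro bexI[of _ "\<zero>\<^bsub>obj X n\<^esub>"]) simp_all
  qed (rule f)
qed

subsection \<open>Constructions with modules\<close>

lemma fin_gen_moduleI: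
  assumes "module R M" "finite S" "S \<subseteq> carrier M"
    and "\<And>H. submodule H R M \<Longrightarrow> S \<subseteq> H \<Longrightarrow> H = carrier M"
  shows "fin_gen_module R M"
  unfolding fin_gen_module_def by (intro conjI exI[of _ S] allI impI; (elim conjE)?; rule assms)

lemma submodule_zero: "submodule H R M \<Longrightarrow> \<zero>\<^bsub>M\<^esub> \<in> H"
  using subgroup.one_closed[of H "add_monoid M"] by (simp add: submodule_def)

lemma module_sum_simps [simp]:
  "carrier (module_sum M N) = carrier M \<times> carrier N"
  "\<zero>\<^bsub>module_sum M N\<^esub> = (\<zero>\<^bsub>M\<^esub>, \<zero>\<^bsub>N\<^esub>)"
  "(x, y) \<oplus>\<^bsub>module_sum M N\<^esub> (x', y') = (x \<oplus>\<^bsub>M\<^esub> x', y \<oplus>\<^bsub>N\<^esub> y')"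
  "a \<odot>\<^bsub>module_sum M N\<^esub> (x, y) = (a \<odot>\<^bsub>M\<^esub> x, a \<odot>\<^bsub>N\<^esub> y)"
  by (simp_all add: module_sum_def)

lemma module_sum_module:
  assumes M: "module R M" and N: "module R N"
  shows "module R (module_sum M N)"
proof -
  interpret M: module R M by (fact M)
  interpret N: module R N by (fact N)
  have "abelian_group (module_sum M N)"
  proof (rule abelian_groupI)
    fix z assume "z \<in> carrier (module_sum M N)"
    then show "\<exists>w \<in> carrier (module_sum M N). w \<oplus>\<^bsub>module_sum M N\<^esub> z = \<zero>\<^bsub>module_sum M N\<^esub>"
      by (intro bexI[of _ "(\<ominus>\<^bsub>M\<^esub> fst z, \<ominus>\<^bsub>N\<^esub> snd z)"]) (auto simp: M.l_neg N.l_neg)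
  qed (auto simp: M.a_ac N.a_ac)
  then show ?thesis
    by (intro moduleI M.is_cring)
      (auto simp: M.smult_l_distr M.smult_r_distr M.smult_assoc1
        N.smult_l_distr N.smult_r_distr N.smult_assoc1)
qed

lemma module_sum_minus:
  assumes "abelian_group M" "abelian_group N" "abelian_group (module_sum M N)"
    and "x \<in> carrier M" "y \<in> carrier N"
  shows "\<ominus>\<^bsub>module_sum M N\<^esub> (x, y) = (\<ominus>\<^bsub>M\<^esub> x, \<ominus>\<^bsub>N\<^esub> y)"
proof (rule abelian_group.minus_equality[OF assms(3)])
  show "(\<ominus>\<^bsub>M\<^esub> x, \<ominus>\<^bsub>N\<^esub> y) \<oplus>\<^bsub>module_sum M N\<^esub> (x, y) = \<zero>\<^bsub>module_sum M N\<^esub>"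
    using assms by (simp add: abelian_group_cancel)
qed (use assms in \<open>simp_all add: abelian_group_cancel\<close>)

lemma fin_gen_module_sum:
  assumes "fin_gen_module R M" "fin_gen_module R N"
  shows "fin_gen_module R (module_sum M N)"
proof -
  obtain S where M: "module R M" and S: "finite S" "S \<subseteq> carrier M"
    and genS: "\<And>H. submodule H R M \<Longrightarrow> S \<subseteq> H \<Longrightarrow> H = carrier M"
    using assms(1) by (auto simp: fin_gen_module_def)
  obtain T where N: "module R N" and T: "finite T" "T \<subseteq> carrier N"
    and genT: "\<And>H. submodule H R N \<Longrightarrow> T \<subseteq> H \<Longrightarrow> H = carrier N"
    using assms(2) by (auto simp: fin_gen_module_def)
  interpret M: module R M by (fact M)
  interpret N: module R N by (fact N)
  interpret MN: module R "module_sum M N" by (rule module_sum_module[OF M N])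
  have gen: "H = carrier (module_sum M N)"
    if H: "submodule H R (module_sum M N)" and sub: "(\<lambda>x. (x, \<zero>\<^bsub>N\<^esub>)) ` S \<union> Pair \<zero>\<^bsub>M\<^esub> ` T \<subseteq> H" for H
  proof -
    note E = MN.submoduleE[OF H] and z = submodule_zero[OF H]
    \<comment> \<open>The section of \<open>H\<close> along each axis is a submodule that contains
      the generators of its factor, hence is the whole factor; sums of axis elements then fill
      \<open>H\<close>.\<close>
    have "submodule {x \<in> carrier M. (x, \<zero>\<^bsub>N\<^esub>) \<in> H} R M"
    proof (rule M.submoduleI)
      fix x assume "x \<in> {x \<in> carrier M. (x, \<zero>\<^bsub>N\<^esub>) \<in> H}"
      then show "\<ominus>\<^bsub>M\<^esub> x \<in> {x \<in> carrier M. (x, \<zero>\<^bsub>N\<^esub>) \<in> H}"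
        using E(3)[of "(x, \<zero>\<^bsub>N\<^esub>)"] module_sum_minus[of M N x "\<zero>\<^bsub>N\<^esub>"]
        by (simp add: M.abelian_group_axioms N.abelian_group_axioms MN.abelian_group_axioms
            abelian_group_cancel)
    next
      fix x x' assume "x \<in> {x \<in> carrier M. (x, \<zero>\<^bsub>N\<^esub>) \<in> H}" "x' \<in> {x \<in> carrier M. (x, \<zero>\<^bsub>N\<^esub>) \<in> H}"
      then show "x \<oplus>\<^bsub>M\<^esub> x' \<in> {x \<in> carrier M. (x, \<zero>\<^bsub>N\<^esub>) \<in> H}"
        using E(5)[of "(x, \<zero>\<^bsub>N\<^esub>)" "(x', \<zero>\<^bsub>N\<^esub>)"] by simp
    next
      fix a x assume "a \<in> carrier R" "x \<in> {x \<in> carrier M. (x, \<zero>\<^bsub>N\<^esub>) \<in> H}"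
      then show "a \<odot>\<^bsub>M\<^esub> x \<in> {x \<in> carrier M. (x, \<zero>\<^bsub>N\<^esub>) \<in> H}"
        using E(4)[of a "(x, \<zero>\<^bsub>N\<^esub>)"] by simp
    qed (use z in auto)
    then have 1: "{x \<in> carrier M. (x, \<zero>\<^bsub>N\<^esub>) \<in> H} = carrier M"
      by (rule genS) (use sub S in auto)
    have "submodule {y \<in> carrier N. (\<zero>\<^bsub>M\<^esub>, y) \<in> H} R N"
    proof (rule N.submoduleI)
      fix x assume "x \<in> {y \<in> carrier N. (\<zero>\<^bsub>M\<^esub>, y) \<in> H}"
      then show "\<ominus>\<^bsub>N\<^esub> x \<in> {y \<in> carrier N. (\<zero>\<^bsub>M\<^esub>, y) \<in> H}"
        using E(3)[of "(\<zero>\<^bsub>M\<^esub>, x)"] module_sum_minus[of M N "\<zero>\<^bsub>M\<^esub>" x]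
        by (simp add: M.abelian_group_axioms N.abelian_group_axioms MN.abelian_group_axioms
            abelian_group_cancel)
    next
      fix x x' assume "x \<in> {y \<in> carrier N. (\<zero>\<^bsub>M\<^esub>, y) \<in> H}" "x' \<in> {y \<in> carrier N. (\<zero>\<^bsub>M\<^esub>, y) \<in> H}"
      then show "x \<oplus>\<^bsub>N\<^esub> x' \<in> {y \<in> carrier N. (\<zero>\<^bsub>M\<^esub>, y) \<in> H}"
        using E(5)[of "(\<zero>\<^bsub>M\<^esub>, x)" "(\<zero>\<^bsub>M\<^esub>, x')"] by simp
    next
      fix a x assume "a \<in> carrier R" "x \<in> {y \<in> carrier N. (\<zero>\<^bsub>M\<^esub>, y) \<in> H}"
      then show "a \<odot>\<^bsub>N\<^esub> x \<in> {y \<in> carrier N. (\<zero>\<^bsub>M\<^esub>, y) \<in> H}"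
        using E(4)[of a "(\<zero>\<^bsub>M\<^esub>, x)"] by simp
    qed (use z in auto)
    then have 2: "{y \<in> carrier N. (\<zero>\<^bsub>M\<^esub>, y) \<in> H} = carrier N"
      by (rule genT) (use sub T in auto)
    have "(x, y) \<in> H" if xy: "x \<in> carrier M" "y \<in> carrier N" for x y
      using E(5)[of "(x, \<zero>\<^bsub>N\<^esub>)" "(\<zero>\<^bsub>M\<^esub>, y)"] xy 1 2 by auto
    then show ?thesis using E(1) by auto
  qed
  show ?thesis
    by (rule fin_gen_moduleI[OF MN.module_axioms, of "(\<lambda>x. (x, \<zero>\<^bsub>N\<^esub>)) ` S \<union> Pair \<zero>\<^bsub>M\<^esub> ` T"])
      (use S T gen in auto)
qed

text \<open>On an arbitrary type the only element that can be named is
  \<open>undefined\<close>.\<close>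

definition zero_module :: "('a, 'm) module" where
  "zero_module = \<lparr>carrier = {undefined}, monoid.mult = (\<lambda>_ _. undefined), one = undefined,
     ring.zero = undefined, ring.add = (\<lambda>_ _. undefined), smult = (\<lambda>_ _. undefined)\<rparr>"

lemma fin_gen_zero_module:
  fixes R :: "('a, 'r) ring_scheme"
  assumes "cring R"
  shows "fin_gen_module R (zero_module :: ('a, 'm) module)"
proof -
  have "abelian_group (zero_module :: ('a, 'm) module)"
    by (rule abelian_groupI) (auto simp: zero_module_def)
  then have m: "module R (zero_module :: ('a, 'm) module)"
    by (intro moduleI assms) (auto simp: zero_module_def)
  interpret module R "zero_module :: ('a, 'm) module" by (fact m)
  show ?thesis
  proof (rule fin_gen_moduleI[OF m, of "{}"])
    fix H assume "submodule H R (zero_module :: ('a, 'm) module)"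
    then show "H = carrier (zero_module :: ('a, 'm) module)"
      using submoduleE(1,2)[of H] by (auto simp: zero_module_def)
  qed simp_all
qed

subsection \<open>Constructions with complexes\<close>

definition zero_complex :: "('a, 'm) cochain" where
  "zero_complex = \<lparr>obj = (\<lambda>n. zero_module), diff = (\<lambda>n x. undefined)\<rparr>"

lemma bounded_zero_complex: "cring R \<Longrightarrow> bounded_complex R zero_complex"
  by (rule bounded_complexI)
    (auto simp: zero_complex_def fin_gen_zero_module linear_maps_def, auto simp: zero_module_def)

lemma acyclic_zero_complex: "acyclic_complex zero_complex"
  by (simp add: acyclic_complex_def zero_complex_def zero_module_def)

lemma bounded_complex_fin_gen: "bounded_complex R X \<Longrightarrow> fin_gen_module R (obj X n)"
  by (simp add: bounded_complex_def)

text \<open>The support of a translate is a preimage under an injective map. Shifts and cones need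
  \<open>k = 1\<close>, inverse shifts and homotopy pullbacks \<open>k = - 1\<close>.\<close>

lemma bounded_complex_finite:
  assumes "bounded_complex R X"
  shows "finite {n. carrier (obj X (n + k)) \<noteq> {\<zero>\<^bsub>obj X (n + k)\<^esub>}}"
proof -
  have "finite ((\<lambda>n. n + k) -` {n. carrier (obj X n) \<noteq> {\<zero>\<^bsub>obj X n\<^esub>}})"
    using assms by (intro finite_vimageI) (auto simp: bounded_complex_def inj_on_def)
  then show ?thesis by (simp add: vimage_def)
qed

lemma bounded_complex_cring: "bounded_complex R X \<Longrightarrow> cring R"
  using bounded_complex_module[of R X 0] by (simp add: module_def)

lemma bounded_cone:
  assumes X: "bounded_complex R X" and Y: "bounded_complex R Y" and f: "chain_map R X Y f"
  shows "bounded_complex R (cone X Y f)"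
proof (rule bounded_complexI)
  note simps = bounded_complex_props[OF X] bounded_complex_props[OF Y] chain_map_props[OF X Y f]
    abelian_group_cancel
  show "fin_gen_module R (obj (cone X Y f) n)" for n
    by (simp add: cone_def fin_gen_module_sum bounded_complex_fin_gen[OF X] bounded_complex_fin_gen[OF Y])
  show "diff (cone X Y f) n \<in> linear_maps R (obj (cone X Y f) n) (obj (cone X Y f) (n + 1))" for n
    by (rule linear_mapsI) (auto simp: cone_def simps)
  show "diff (cone X Y f) (n + 1) (diff (cone X Y f) n x) = \<zero>\<^bsub>obj (cone X Y f) (n + 1 + 1)\<^esub>"
    if "x \<in> carrier (obj (cone X Y f) n)" for n x
    using that by (auto simp: cone_def simps)
  have "{n. carrier (obj (cone X Y f) n) \<noteq> {\<zero>\<^bsub>obj (cone X Y f) n\<^esub>}} \<subseteq>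
    {n. carrier (obj X (n + 1)) \<noteq> {\<zero>\<^bsub>obj X (n + 1)\<^esub>}} \<union> {n. carrier (obj Y (n + 0)) \<noteq> {\<zero>\<^bsub>obj Y (n + 0)\<^esub>}}"
    by (auto simp: cone_def)
  then show "finite {n. carrier (obj (cone X Y f) n) \<noteq> {\<zero>\<^bsub>obj (cone X Y f) n\<^esub>}}"
    by (rule finite_subset) (intro finite_UnI bounded_complex_finite[OF X] bounded_complex_finite[OF Y])
qed

text \<open>Up to signs this is the cone of \<open>f - s\<close> on the sum of \<open>W\<close> and
  \<open>Z\<close>, shifted by \<open>-1\<close>. The third coordinate records a homotopy in
  \<open>Y\<close> between the images of the other two, so the square over \<open>Y\<close> commutes
  up to homotopy by construction.\<close>

definition homotopy_pullback :: "('a, 'm) cochain \<Rightarrow> ('a, 'k) cochain \<Rightarrow> ('a, 'l) cochain \<Rightarrow>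
    (int \<Rightarrow> 'm \<Rightarrow> 'l) \<Rightarrow> (int \<Rightarrow> 'k \<Rightarrow> 'l) \<Rightarrow> ('a, 'm \<times> 'k \<times> 'l) cochain" where
  "homotopy_pullback W Z Y f s = \<lparr>
     obj = (\<lambda>n. module_sum (obj W n) (module_sum (obj Z n) (obj Y (n - 1)))),
     diff = (\<lambda>n (w, z, y). (diff W n w, diff Z n z,
       (f n w \<ominus>\<^bsub>obj Y n\<^esub> s n z) \<ominus>\<^bsub>obj Y n\<^esub> diff Y (n - 1) y))\<rparr>"

lemma bounded_homotopy_pullback:
  assumes W: "bounded_complex R W" and Z: "bounded_complex R Z" and Y: "bounded_complex R Y"
    and f: "chain_map R W Y f" and s: "chain_map R Z Y s"
  shows "bounded_complex R (homotopy_pullback W Z Y f s)" (is "bounded_complex R ?V")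
proof (rule bounded_complexI)
  note simps = bounded_complex_props[OF W] bounded_complex_props[OF Z] bounded_complex_props[OF Y]
    chain_map_props[OF W Y f] chain_map_props[OF Z Y s] abelian_group_cancel
  show "fin_gen_module R (obj ?V n)" for n
    by (simp add: homotopy_pullback_def fin_gen_module_sum bounded_complex_fin_gen[OF W]
        bounded_complex_fin_gen[OF Z] bounded_complex_fin_gen[OF Y])
  show "diff ?V n \<in> linear_maps R (obj ?V n) (obj ?V (n + 1))" for n
    by (rule linear_mapsI) (auto simp: homotopy_pullback_def simps)
  show "diff ?V (n + 1) (diff ?V n x) = \<zero>\<^bsub>obj ?V (n + 1 + 1)\<^esub>"
    if "x \<in> carrier (obj ?V n)" for n x
    using that by (auto simp: homotopy_pullback_def simps add.commute)
  have "{n. carrier (obj ?V n) \<noteq> {\<zero>\<^bsub>obj ?V n\<^esub>}} \<subseteq>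
    {n. carrier (obj W (n + 0)) \<noteq> {\<zero>\<^bsub>obj W (n + 0)\<^esub>}} \<union>
    {n. carrier (obj Z (n + 0)) \<noteq> {\<zero>\<^bsub>obj Z (n + 0)\<^esub>}} \<union>
    {n. carrier (obj Y (n + - 1)) \<noteq> {\<zero>\<^bsub>obj Y (n + - 1)\<^esub>}}"
    by (auto simp: homotopy_pullback_def)
  then show "finite {n. carrier (obj ?V n) \<noteq> {\<zero>\<^bsub>obj ?V n\<^esub>}}"
    by (rule finite_subset) (intro finite_UnI bounded_complex_finite[OF W]
        bounded_complex_finite[OF Y] bounded_complex_finite[OF Z])
qed

lemma homotopy_pullback_quasi_iso:
  assumes W: "bounded_complex R W" and Z: "bounded_complex R Z" and Y: "bounded_complex R Y"
    and f: "chain_map R W Y f" and s: "quasi_iso R Z Y s"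
  shows "quasi_iso R (homotopy_pullback W Z Y f s) W (\<lambda>n. fst)" (is "quasi_iso R ?V W _")
proof (rule quasi_isoI)
  note sc = quasi_iso_chain_map[OF s] and sq = s[unfolded quasi_iso_iff[OF Z Y]]
  show V: "bounded_complex R ?V" by (rule bounded_homotopy_pullback[OF W Z Y f sc])
  note simps = bounded_complex_props[OF W] bounded_complex_props[OF Z] bounded_complex_props[OF Y]
    chain_map_props[OF W Y f] chain_map_props[OF Z Y sc] abelian_group_cancel
  show "bounded_complex R W" by (fact W)
  show "chain_map R ?V W (\<lambda>n. fst)"
    by (rule chain_mapI) (auto simp: homotopy_pullback_def simps)
next
  note sc = quasi_iso_chain_map[OF s] and sq = s[unfolded quasi_iso_iff[OF Z Y]]
  note simps = bounded_complex_props[OF W] bounded_complex_props[OF Z] bounded_complex_props[OF Y]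
    chain_map_props[OF W Y f] chain_map_props[OF Z Y sc] abelian_group_cancel
  fix n x b assume x: "x \<in> carrier (obj ?V n)" "diff ?V n x = \<zero>\<^bsub>obj ?V (n + 1)\<^esub>"
    and b: "b \<in> carrier (obj W (n - 1))" "fst x = diff W (n - 1) b"
  obtain w z y where xe: "x = (w, z, y)" by (cases x)
  have c: "w \<in> carrier (obj W n)" "z \<in> carrier (obj Z n)" "y \<in> carrier (obj Y (n - 1))"
    and dz: "diff Z n z = \<zero>\<^bsub>obj Z (n + 1)\<^esub>" and w: "w = diff W (n - 1) b"
    and e: "(f n w \<oplus>\<^bsub>obj Y n\<^esub> \<ominus>\<^bsub>obj Y n\<^esub> s n z) \<oplus>\<^bsub>obj Y n\<^esub> \<ominus>\<^bsub>obj Y n\<^esub> diff Y (n - 1) y = \<zero>\<^bsub>obj Y n\<^esub>"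
    using x b by (auto simp: xe homotopy_pullback_def a_minus_def)
  \<comment> \<open>The third coordinate of the cocycle condition reads
    \<open>s z = f w - d y\<close>, and \<open>w = d b\<close> turns the right side into the
    boundary of \<open>y1\<close>. Injectivity of \<open>s\<close> on cohomology then makes
    \<open>z\<close> a coboundary \<open>d z'\<close>.\<close>
  define y1 where "y1 = f (n - 1) b \<oplus>\<^bsub>obj Y (n - 1)\<^esub> \<ominus>\<^bsub>obj Y (n - 1)\<^esub> y"
  have y1: "y1 \<in> carrier (obj Y (n - 1))" using b c by (simp add: y1_def simps)
  have "s n z = ((f n w \<oplus>\<^bsub>obj Y n\<^esub> \<ominus>\<^bsub>obj Y n\<^esub> s n z) \<oplus>\<^bsub>obj Y n\<^esub> \<ominus>\<^bsub>obj Y n\<^esub> diff Y (n - 1) y) \<oplus>\<^bsub>obj Y n\<^esub> s n z"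
    unfolding e using c by (simp add: simps)
  also have "\<dots> = diff Y (n - 1) y1 \<oplus>\<^bsub>obj Y n\<^esub> s n \<zero>\<^bsub>obj Z n\<^esub>"
    unfolding w y1_def using b c by (simp add: simps)
  finally have sz: "s n z = diff Y (n - 1) y1 \<oplus>\<^bsub>obj Y n\<^esub> s n \<zero>\<^bsub>obj Z n\<^esub>" .
  have zc: "z \<in> cocycles Z n" "\<zero>\<^bsub>obj Z n\<^esub> \<in> cocycles Z n"
    using c dz by (simp_all add: cocycles_def simps)
  have "cohomologous Y n (s n z) (s n \<zero>\<^bsub>obj Z n\<^esub>)"
    unfolding cohomologous_def using sz y1 zc chain_map_cocycle[OF Z Y sc] by blast
  then have "cohomologous Z n z \<zero>\<^bsub>obj Z n\<^esub>" using sq zc by blast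
  then obtain z' where z': "z' \<in> carrier (obj Z (n - 1))" "z = diff Z (n - 1) z'"
    by (auto simp: cohomologous_def simps)
  \<comment> \<open>The candidate primitive \<open>(b, z', 0)\<close> is correct except in the third
    coordinate, where \<open>u\<close> is its error. This error is a cocycle, so surjectivity of
    \<open>s\<close> on cohomology writes it as \<open>s z2 - d y2\<close>, and \<open>z2\<close>,
    \<open>y2\<close> correct the candidate.\<close>
  define u where "u = (f (n - 1) b \<oplus>\<^bsub>obj Y (n - 1)\<^esub> \<ominus>\<^bsub>obj Y (n - 1)\<^esub> s (n - 1) z') \<oplus>\<^bsub>obj Y (n - 1)\<^esub> \<ominus>\<^bsub>obj Y (n - 1)\<^esub> y"
  have u: "u \<in> carrier (obj Y (n - 1))" using b c z' by (simp add: u_def simps)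
  have "diff Y (n - 1) u = (f n w \<oplus>\<^bsub>obj Y n\<^esub> \<ominus>\<^bsub>obj Y n\<^esub> s n z) \<oplus>\<^bsub>obj Y n\<^esub> \<ominus>\<^bsub>obj Y n\<^esub> diff Y (n - 1) y"
    unfolding u_def w z'(2) using b c z' by (simp add: simps)
  then have "u \<in> cocycles Y (n - 1)" using u e by (simp add: cocycles_def)
  then obtain z2 y2 where z2: "z2 \<in> cocycles Z (n - 1)" and y2: "y2 \<in> carrier (obj Y (n - 1 - 1))"
    and e2: "s (n - 1) z2 = diff Y (n - 1 - 1) y2 \<oplus>\<^bsub>obj Y (n - 1)\<^esub> u"
    using sq unfolding cohomologous_def by blast
  have z2': "z2 \<in> carrier (obj Z (n - 1))" "diff Z (n - 1) z2 = \<zero>\<^bsub>obj Z n\<^esub>"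
    using cocyclesD[OF z2] by simp_all
  have y2': "y2 \<in> carrier (obj Y (n - 2))" using y2 by simp
  have "f (n - 1) b \<oplus>\<^bsub>obj Y (n - 1)\<^esub> \<ominus>\<^bsub>obj Y (n - 1)\<^esub> s (n - 1) z' \<oplus>\<^bsub>obj Y (n - 1)\<^esub>
    \<ominus>\<^bsub>obj Y (n - 1)\<^esub> s (n - 1) z2 \<oplus>\<^bsub>obj Y (n - 1)\<^esub> diff Y (n - 2) y2 = y"
    unfolding e2 u_def using b c z' y2' by (simp add: simps)
  then have "diff ?V (n - 1) (b, z' \<oplus>\<^bsub>obj Z (n - 1)\<^esub> z2, \<ominus>\<^bsub>obj Y (n - 2)\<^esub> y2) = x"
    unfolding xe w z'(2) using b c z' z2' y2' by (simp add: homotopy_pullback_def simps)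
  moreover have "(b, z' \<oplus>\<^bsub>obj Z (n - 1)\<^esub> z2, \<ominus>\<^bsub>obj Y (n - 2)\<^esub> y2) \<in> carrier (obj ?V (n - 1))"
    using b c z' z2' y2' by (simp add: homotopy_pullback_def simps)
  ultimately show "\<exists>a \<in> carrier (obj ?V (n - 1)). x = diff ?V (n - 1) a" by blast
next
  note sc = quasi_iso_chain_map[OF s] and sq = s[unfolded quasi_iso_iff[OF Z Y]]
  note simps = bounded_complex_props[OF W] bounded_complex_props[OF Z] bounded_complex_props[OF Y]
    chain_map_props[OF W Y f] chain_map_props[OF Z Y sc] abelian_group_cancel
  fix n w assume w: "w \<in> carrier (obj W n)" "diff W n w = \<zero>\<^bsub>obj W (n + 1)\<^esub>"
  have "f n w \<in> cocycles Y n"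
    by (rule chain_map_cocycle[OF W Y f]) (simp add: cocycles_def w)
  then obtain z y where z: "z \<in> cocycles Z n" and y: "y \<in> carrier (obj Y (n - 1))"
    and e: "s n z = diff Y (n - 1) y \<oplus>\<^bsub>obj Y n\<^esub> f n w"
    using sq unfolding cohomologous_def by blast
  have z': "z \<in> carrier (obj Z n)" "diff Z n z = \<zero>\<^bsub>obj Z (n + 1)\<^esub>"
    using cocyclesD[OF z] by simp_all
  \<comment> \<open>Since \<open>s z = d y + f w\<close>, the sign of \<open>y\<close> cancels the
    third coordinate of the differential.\<close>
  have "(w, z, \<ominus>\<^bsub>obj Y (n - 1)\<^esub> y) \<in> carrier (obj ?V n)"
    using w z' y by (simp add: homotopy_pullback_def simps)
  moreover have "diff ?V n (w, z, \<ominus>\<^bsub>obj Y (n - 1)\<^esub> y) = \<zero>\<^bsub>obj ?V (n + 1)\<^esub>"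
    using w z' y by (simp add: homotopy_pullback_def simps e)
  moreover have "w = diff W (n - 1) \<zero>\<^bsub>obj W (n - 1)\<^esub> \<oplus>\<^bsub>obj W n\<^esub> w" using w by (simp add: simps)
  moreover have "\<zero>\<^bsub>obj W (n - 1)\<^esub> \<in> carrier (obj W (n - 1))" by (simp add: simps)
  ultimately show "\<exists>x \<in> carrier (obj ?V n). \<exists>b \<in> carrier (obj W (n - 1)).
      diff ?V n x = \<zero>\<^bsub>obj ?V (n + 1)\<^esub> \<and> fst x = diff W (n - 1) b \<oplus>\<^bsub>obj W n\<^esub> w"
    by (metis fst_conv)
qed

lemma homotopy_pullback_homotopic:
  assumes W: "bounded_complex R W" and Z: "bounded_complex R Z" and Y: "bounded_complex R Y"
    and f: "chain_map R W Y f" and s: "chain_map R Z Y s"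
  shows "chain_map R (homotopy_pullback W Z Y f s) Z (\<lambda>n x. fst (snd x))"
    and "homotopic R (homotopy_pullback W Z Y f s) Y (f \<circ>\<circ>\<circ> (\<lambda>n. fst)) (s \<circ>\<circ>\<circ> (\<lambda>n x. fst (snd x)))"
proof -
  note simps = bounded_complex_props[OF W] bounded_complex_props[OF Z] bounded_complex_props[OF Y]
    chain_map_props[OF W Y f] chain_map_props[OF Z Y s] abelian_group_cancel
  show "chain_map R (homotopy_pullback W Z Y f s) Z (\<lambda>n x. fst (snd x))"
    by (rule chain_mapI) (auto simp: homotopy_pullback_def simps)
  show "homotopic R (homotopy_pullback W Z Y f s) Y (f \<circ>\<circ>\<circ> (\<lambda>n. fst)) (s \<circ>\<circ>\<circ> (\<lambda>n x. fst (snd x)))"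
    \<comment> \<open>The third coordinate of the differential is \<open>f w - s z - d y\<close>, so
      the third projection is the required homotopy.\<close>
    by (rule homotopicI[where h = "\<lambda>n x. snd (snd x)"]) (auto simp: homotopy_pullback_def simps)
qed

section \<open>Copies of complexes on the type of the derived category, and the Ore
  condition\<close>

lemma inverse_chain_maps_quasi_iso:
  assumes X: "bounded_complex R X" and Y: "bounded_complex R Y" and f: "chain_map R X Y f"
    and g: "chain_map R Y X g"
    and gf: "\<And>n x. x \<in> carrier (obj X n) \<Longrightarrow> g n (f n x) = x"
    and fg: "\<And>n y. y \<in> carrier (obj Y n) \<Longrightarrow> f n (g n y) = y"
  shows "quasi_iso R X Y f"
proof (rule quasi_isoI[OF X Y f])
  note simps = bounded_complex_props[OF X] bounded_complex_props[OF Y] chain_map_props[OF X Y f]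
    chain_map_props[OF Y X g] abelian_group_cancel
  fix n x b assume x: "x \<in> carrier (obj X n)" and b: "b \<in> carrier (obj Y (n - 1))"
    and e: "f n x = diff Y (n - 1) b"
  have "x = diff X (n - 1) (g (n - 1) b)"
    using gf[OF x] b unfolding e by (simp add: simps)
  then show "\<exists>a \<in> carrier (obj X (n - 1)). x = diff X (n - 1) a"
    using b by (auto simp: simps intro!: bexI[of _ "g (n - 1) b"])
next
  note simps = bounded_complex_props[OF X] bounded_complex_props[OF Y] chain_map_props[OF X Y f]
    chain_map_props[OF Y X g] abelian_group_cancel
  fix n y assume y: "y \<in> carrier (obj Y n)" "diff Y n y = \<zero>\<^bsub>obj Y (n + 1)\<^esub>"
  have "g (n + 1) (diff Y n y) = \<zero>\<^bsub>obj X (n + 1)\<^esub>" unfolding y(2) by (rule chain_map_props[OF Y X g])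
  then have "diff X n (g n y) = \<zero>\<^bsub>obj X (n + 1)\<^esub>"
    using chain_map_props(6)[OF Y X g y(1), of "n + 1"] by simp
  then show "\<exists>x \<in> carrier (obj X n). \<exists>b \<in> carrier (obj Y (n - 1)). diff X n x = \<zero>\<^bsub>obj X (n + 1)\<^esub> \<and>
        f n x = diff Y (n - 1) b \<oplus>\<^bsub>obj Y n\<^esub> y"
    using y by (intro bexI[of _ "g n y"] bexI[of _ "\<zero>\<^bsub>obj Y (n - 1)\<^esub>"]) (simp_all add: simps fg)
qed

lemma linear_map_inverse:
  assumes M: "module R M" and N: "module R N" and f: "f \<in> linear_maps R M N"
    and bij: "bij_betw f (carrier M) (carrier N)"
  shows "inv_into (carrier M) f \<in> linear_maps R N M"
proof -
  note p = linear_map_props[OF M N f]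
  interpret M: module R M by (fact M)
  interpret N: module R N by (fact N)
  have inv: "inv_into (carrier M) f y \<in> carrier M" "f (inv_into (carrier M) f y) = y" if "y \<in> carrier N" for y
    using bij_betw_inv_into_right[OF bij that] bij_betw_apply[OF bij_betw_inv_into[OF bij] that] by auto
  have eq: "inv_into (carrier M) f y = x" if "x \<in> carrier M" "f x = y" for x y
    using bij_betw_inv_into_left[OF bij that(1)] that(2) by simp
  show ?thesis
    by (rule linear_mapsI) (auto intro!: eq simp: inv p)
qed

text \<open>Cones and homotopy pullbacks live on product types, whereas the objects of
  \<open>Db_mod R\<close> live on \<open>'a list set\<close>. Each term is transported along the
  bijection of \<open>fin_gen_module_small\<close> and the differential is conjugated.\<close>

lemma bounded_complex_small:
  fixes X :: "('a, 'm) cochain"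
  assumes X: "bounded_complex R X"
  obtains C :: "('a, 'a list set) cochain" and e e' where "bounded_complex R C"
    and "chain_map R X C e" and "chain_map R C X e'"
    and "\<forall>n. \<forall>x \<in> carrier (obj X n). e' n (e n x) = x"
    and "\<forall>n. \<forall>c \<in> carrier (obj C n). e n (e' n c) = c"
proof -
  have "\<forall>n. \<exists>(N :: ('a, 'a list set) module) f. fin_gen_module R N \<and>
    f \<in> linear_maps R (obj X n) N \<and> bij_betw f (carrier (obj X n)) (carrier N)"
    using fin_gen_module_small[OF bounded_complex_fin_gen[OF X]] by blast
  then obtain N :: "int \<Rightarrow> ('a, 'a list set) module" and f where N: "\<And>n. fin_gen_module R (N n)"
    and f: "\<And>n. f n \<in> linear_maps R (obj X n) (N n)"
    and bij: "\<And>n. bij_betw (f n) (carrier (obj X n)) (carrier (N n))"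
    by metis
  define g where "g n = inv_into (carrier (obj X n)) (f n)" for n
  note modX = bounded_complex_module[OF X] and modN = fin_gen_module_module[OF N]
  have g: "g n \<in> linear_maps R (N n) (obj X n)" for n
    unfolding g_def by (rule linear_map_inverse[OF modX modN f bij])
  note fp = linear_map_props[OF modX modN f] and gp = linear_map_props[OF modN modX g]
  have fg: "f n (g n y) = y" if "y \<in> carrier (N n)" for n y
    using bij_betw_inv_into_right[OF bij that] by (simp add: g_def)
  have gf: "g n (f n x) = x" if "x \<in> carrier (obj X n)" for n x
    using bij_betw_inv_into_left[OF bij that] by (simp add: g_def)
  define C where "C = \<lparr>obj = N, diff = (\<lambda>n c. f (n + 1) (diff X n (g n c)))\<rparr>"
  note simps = bounded_complex_props[OF X] fp gp fg gf
  have "carrier (N n) = {\<zero>\<^bsub>N n\<^esub>}" if "carrier (obj X n) = {\<zero>\<^bsub>obj X n\<^esub>}" for n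
    using bij_betw_imp_surj_on[OF bij[of n]] fp(4)[of n] that by simp
  then have "{n. carrier (N n) \<noteq> {\<zero>\<^bsub>N n\<^esub>}} \<subseteq> {n. carrier (obj X (n + 0)) \<noteq> {\<zero>\<^bsub>obj X (n + 0)\<^esub>}}"
    by auto
  from finite_subset[OF this bounded_complex_finite[OF X]]
  have fin: "finite {n. carrier (N n) \<noteq> {\<zero>\<^bsub>N n\<^esub>}}" .
  have C: "obj C = N" "\<And>n c. diff C n c = f (n + 1) (diff X n (g n c))" by (simp_all add: C_def)
  have "bounded_complex R C"
  proof (rule bounded_complexI)
    show "diff C n \<in> linear_maps R (obj C n) (obj C (n + 1))" for n
      by (rule linear_mapsI) (simp_all add: C simps)
    show "finite {n. carrier (obj C n) \<noteq> {\<zero>\<^bsub>obj C n\<^esub>}}" using fin by (simp add: C)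
  qed (simp_all add: C N simps)
  moreover have "chain_map R X C f" by (rule chain_mapI) (simp_all add: C simps)
  moreover have "chain_map R C X g" by (rule chain_mapI) (simp_all add: C simps)
  moreover have "\<forall>n. \<forall>c \<in> carrier (obj C n). f n (g n c) = c" using fg by (simp add: C)
  moreover have "\<forall>n. \<forall>x \<in> carrier (obj X n). g n (f n x) = x" using gf by simp
  ultimately show ?thesis by (intro that)
qed

text \<open>The square is completed by the homotopy pullback, copied to \<open>'a list set\<close>.
  The three given complexes may live on different types because the lemma is also applied over a
  cone, against a zero complex on \<open>unit\<close>.\<close>

lemma quasi_iso_ore:
  fixes W :: "('a, 'm) cochain" and Z :: "('a, 'k) cochain" and Y :: "('a, 'l) cochain"
  assumes W: "bounded_complex R W" and Z: "bounded_complex R Z" and Y: "bounded_complex R Y"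
    and f: "chain_map R W Y f" and s: "quasi_iso R Z Y s"
  obtains V :: "('a, 'a list set) cochain" and t h where "bounded_complex R V" and "quasi_iso R V W t"
    and "chain_map R V Z h" and "homotopic R V Y (f \<circ>\<circ>\<circ> t) (s \<circ>\<circ>\<circ> h)"
proof -
  note sc = quasi_iso_chain_map[OF s]
  let ?P = "homotopy_pullback W Z Y f s"
  note P = bounded_homotopy_pullback[OF W Z Y f sc] and q = homotopy_pullback_quasi_iso[OF W Z Y f s]
    and h = homotopy_pullback_homotopic[OF W Z Y f sc]
  obtain V :: "('a, 'a list set) cochain" and e e' where V: "bounded_complex R V"
    and e: "chain_map R ?P V e" "chain_map R V ?P e'"
    and inv: "\<forall>n. \<forall>x \<in> carrier (obj ?P n). e' n (e n x) = x"
      "\<forall>n. \<forall>c \<in> carrier (obj V n). e n (e' n c) = c"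
    by (rule bounded_complex_small[OF P])
  have "quasi_iso R V ?P e'" by (rule inverse_chain_maps_quasi_iso[OF V P e(2) e(1) inv(2,1)[rule_format]])
  then have "quasi_iso R V W ((\<lambda>n. fst) \<circ>\<circ>\<circ> e')" by (rule quasi_iso_comp[OF V P W _ q])
  moreover have "chain_map R V Z ((\<lambda>n x. fst (snd x)) \<circ>\<circ>\<circ> e')" by (rule chain_map_comp[OF e(2) h(1)])
  moreover have "homotopic R V Y (f \<circ>\<circ>\<circ> ((\<lambda>n. fst) \<circ>\<circ>\<circ> e')) (s \<circ>\<circ>\<circ> ((\<lambda>n x. fst (snd x)) \<circ>\<circ>\<circ> e'))"
    using homotopic_comp_right[OF V P Y chain_map_comp[OF quasi_iso_chain_map[OF q] f]
        chain_map_comp[OF h(1) sc] e(2) h(2)]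
    by (simp add: comp_def)
  ultimately show ?thesis using V by (intro that)
qed

subsection \<open>Shifts and cones\<close>

lemma shift_complex_simps [simp]:
  "obj (shift_complex X) n = obj X (n + 1)"
  "diff (shift_complex X) n x = \<ominus>\<^bsub>obj X (n + 1 + 1)\<^esub> diff X (n + 1) x"
  by (simp_all add: shift_complex_def)

text \<open>The inverse shift: it carries a refinement of \<open>shift_complex V\<close> back to a
  refinement of \<open>V\<close>.\<close>

definition unshift_complex :: "('a, 'm) cochain \<Rightarrow> ('a, 'm) cochain" where
  "unshift_complex X = \<lparr>obj = (\<lambda>n. obj X (n - 1)), diff = (\<lambda>n x. \<ominus>\<^bsub>obj X n\<^esub> diff X (n - 1) x)\<rparr>"

lemma unshift_complex_simps [simp]:
  "obj (unshift_complex X) n = obj X (n - 1)"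
  "diff (unshift_complex X) n x = \<ominus>\<^bsub>obj X n\<^esub> diff X (n - 1) x"
  by (simp_all add: unshift_complex_def)

lemma abelian_group_minus_eq_zero:
  assumes G: "abelian_group G" and x: "x \<in> carrier G"
  shows "\<ominus>\<^bsub>G\<^esub> x = \<zero>\<^bsub>G\<^esub> \<longleftrightarrow> x = \<zero>\<^bsub>G\<^esub>"
  using abelian_group_cancel(10)[OF G x] abelian_group_cancel(11)[OF G] by metis

lemma bounded_shift:
  assumes X: "bounded_complex R X"
  shows "bounded_complex R (shift_complex X)"
proof (rule bounded_complexI)
  note simps = bounded_complex_props[OF X] abelian_group_cancel
  show "diff (shift_complex X) n \<in> linear_maps R (obj (shift_complex X) n) (obj (shift_complex X) (n + 1))" for n
    by (rule linear_mapsI) (auto simp: simps)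
  show "finite {n. carrier (obj (shift_complex X) n) \<noteq> {\<zero>\<^bsub>obj (shift_complex X) n\<^esub>}}"
    using bounded_complex_finite[OF X, of 1] by simp
qed (simp_all add: bounded_complex_fin_gen[OF X] bounded_complex_props[OF X] abelian_group_cancel add.commute)

lemma bounded_unshift:
  assumes X: "bounded_complex R X"
  shows "bounded_complex R (unshift_complex X)"
proof (rule bounded_complexI)
  note simps = bounded_complex_props[OF X] abelian_group_cancel
  show "diff (unshift_complex X) n \<in> linear_maps R (obj (unshift_complex X) n) (obj (unshift_complex X) (n + 1))" for n
    by (rule linear_mapsI) (auto simp: simps)
  show "finite {n. carrier (obj (unshift_complex X) n) \<noteq> {\<zero>\<^bsub>obj (unshift_complex X) n\<^esub>}}"
    using bounded_complex_finite[OF X, of "- 1"] by simp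
qed (simp_all add: bounded_complex_fin_gen[OF X] bounded_complex_props[OF X] abelian_group_cancel add.commute)

lemma chain_map_shift:
  assumes X: "bounded_complex R X" and Y: "bounded_complex R Y" and f: "chain_map R X Y f"
  shows "chain_map R (shift_complex X) (shift_complex Y) (shift_map f)"
  by (rule chain_mapI) (simp_all add: shift_map_def bounded_complex_props[OF X]
      bounded_complex_props[OF Y] chain_map_props[OF X Y f] abelian_group_cancel)

lemma homotopic_shift:
  assumes X: "bounded_complex R X" and Y: "bounded_complex R Y" and f: "chain_map R X Y f"
    and g: "chain_map R X Y g" and fg: "homotopic R X Y f g"
  shows "homotopic R (shift_complex X) (shift_complex Y) (shift_map f) (shift_map g)"
proof -
  from fg obtain h where H: "homotopy R X Y f g h" by (rule homotopicE)
  note simps = bounded_complex_props[OF X] bounded_complex_props[OF Y] chain_map_props[OF X Y f]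
    chain_map_props[OF X Y g] homotopy_props[OF X Y H] abelian_group_cancel
  show ?thesis
  \<comment> \<open>The differential of the shift carries a sign, which the homotopy has to
    absorb.\<close>
  proof (rule homotopicI[where h = "\<lambda>n x. \<ominus>\<^bsub>obj Y n\<^esub> h (n + 1) x"])
    fix n x assume x: "x \<in> carrier (obj (shift_complex X) n)"
    then show "shift_map f n x \<ominus>\<^bsub>obj (shift_complex Y) n\<^esub> shift_map g n x =
      diff (shift_complex Y) (n - 1) (\<ominus>\<^bsub>obj Y n\<^esub> h (n + 1) x) \<oplus>\<^bsub>obj (shift_complex Y) n\<^esub>
      \<ominus>\<^bsub>obj Y (n + 1)\<^esub> h (n + 1 + 1) (diff (shift_complex X) n x)"
      using homotopy_eq[OF H, of x "n + 1"] by (simp add: simps shift_map_def add.commute)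
  qed (simp_all add: simps)
qed

lemma chain_map_unshift:
  assumes V: "bounded_complex R V" and X: "bounded_complex R X" and f: "chain_map R V (shift_complex X) f"
  shows "chain_map R (unshift_complex V) X (\<lambda>n. f (n - 1))"
proof -
  note simps = bounded_complex_props[OF V] bounded_complex_props[OF X]
    chain_map_props[OF V bounded_shift[OF X] f, simplified] abelian_group_cancel
  have c: "f (n - 1) x \<in> carrier (obj X n)" if "x \<in> carrier (obj V (n - 1))" for n x
    using chain_map_props(1)[OF V bounded_shift[OF X] f that] by simp
  have a: "f (n - 1) (x \<oplus>\<^bsub>obj V (n - 1)\<^esub> y) = f (n - 1) x \<oplus>\<^bsub>obj X n\<^esub> f (n - 1) y"
    if "x \<in> carrier (obj V (n - 1))" "y \<in> carrier (obj V (n - 1))" for n x y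
    using chain_map_props(2)[OF V bounded_shift[OF X] f that] by simp
  have s: "f (n - 1) (a \<odot>\<^bsub>obj V (n - 1)\<^esub> x) = a \<odot>\<^bsub>obj X n\<^esub> f (n - 1) x"
    if "a \<in> carrier R" "x \<in> carrier (obj V (n - 1))" for n x a
    using chain_map_props(3)[OF V bounded_shift[OF X] f that] by simp
  have d: "f n (diff V (n - 1) x) = \<ominus>\<^bsub>obj X (n + 1)\<^esub> diff X n (f (n - 1) x)"
    if "x \<in> carrier (obj V (n - 1))" for n x
    using chain_map_props(6)[OF V bounded_shift[OF X] f that, of n] by simp
  show ?thesis
    by (rule chain_mapI) (simp_all add: c a s d bounded_complex_props[OF V] bounded_complex_props[OF X]
      abelian_group_cancel chain_map_props(5)[OF V bounded_shift[OF X] f, simplified])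
qed

lemma homotopic_unshift:
  assumes V: "bounded_complex R V" and X: "bounded_complex R X"
    and f: "chain_map R V (shift_complex X) f" and g: "chain_map R V (shift_complex X) g"
    and fg: "homotopic R V (shift_complex X) f g"
  shows "homotopic R (unshift_complex V) X (\<lambda>n. f (n - 1)) (\<lambda>n. g (n - 1))"
proof -
  note sX = bounded_shift[OF X]
  from fg obtain h where H: "homotopy R V (shift_complex X) f g h" by (rule homotopicE)
  note hp = homotopy_props[OF V sX H, simplified]
  have hc: "h (n - 1) x \<in> carrier (obj X (n - 1))" if "x \<in> carrier (obj V (n - 1))" for n x
    using hp(1)[OF that, of "n - 2"] by simp
  note simps = bounded_complex_props[OF V] bounded_complex_props[OF X] hp hc abelian_group_cancel
  show ?thesis
  proof (rule homotopicI[where h = "\<lambda>n x. \<ominus>\<^bsub>obj X (n - 1)\<^esub> h (n - 1) x"])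
    fix n x assume x: "x \<in> carrier (obj (unshift_complex V) n)"
    then show "f (n - 1) x \<ominus>\<^bsub>obj X n\<^esub> g (n - 1) x =
      diff X (n - 1) (\<ominus>\<^bsub>obj X (n - 1)\<^esub> h (n - 1) x) \<oplus>\<^bsub>obj X n\<^esub>
      \<ominus>\<^bsub>obj X (n + 1 - 1)\<^esub> h (n + 1 - 1) (diff (unshift_complex V) n x)"
      using homotopy_eq[OF H, of x "n - 1"] hp(1)[of x "n - 1" "n - 2"] hp(1)[of "diff V (n - 1) x" n "n - 1"]
        hp(5)[of "diff V (n - 1) x" n]
      by (simp add: simps)
  qed (simp_all add: simps)
qed

text \<open>The inverse shift changes differentials only by a sign, so cocycles and coboundaries
  stay the same while primitives are negated.\<close>

lemma quasi_iso_unshift: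
  assumes V: "bounded_complex R V" and X: "bounded_complex R X" and f: "quasi_iso R V (shift_complex X) f"
  shows "quasi_iso R (unshift_complex V) X (\<lambda>n. f (n - 1))"
proof (rule quasi_isoI[OF bounded_unshift[OF V] X])
  note sX = bounded_shift[OF X] and fc = quasi_iso_chain_map[OF f]
  note fq = f[unfolded quasi_iso_iff[OF V sX]]
  show "chain_map R (unshift_complex V) X (\<lambda>n. f (n - 1))" by (rule chain_map_unshift[OF V X fc])
  note u = chain_map_props[OF bounded_unshift[OF V] X this, simplified]
  note simps = bounded_complex_props[OF V] bounded_complex_props[OF X] abelian_group_cancel
  {
    fix n x b assume x: "x \<in> carrier (obj (unshift_complex V) n)"
      and dx: "diff (unshift_complex V) n x = \<zero>\<^bsub>obj (unshift_complex V) (n + 1)\<^esub>"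
      and b: "b \<in> carrier (obj X (n - 1))" and e: "f (n - 1) x = diff X (n - 1) b"
    have "diff V (n - 1) x = \<ominus>\<^bsub>obj V n\<^esub> (\<ominus>\<^bsub>obj V n\<^esub> diff V (n - 1) x)" using x by (simp add: simps)
    also have "\<dots> = \<zero>\<^bsub>obj V n\<^esub>" using dx by (simp add: simps)
    finally have xc: "x \<in> cocycles V (n - 1)" using x by (simp add: cocycles_def)
    have zc: "\<zero>\<^bsub>obj V (n - 1)\<^esub> \<in> cocycles V (n - 1)" by (simp add: cocycles_def simps)
    have f0: "f (n - 1) \<zero>\<^bsub>obj V (n - 1)\<^esub> = \<zero>\<^bsub>obj X n\<^esub>" by (rule u)
    have "cohomologous (shift_complex X) (n - 1) (f (n - 1) x) (f (n - 1) \<zero>\<^bsub>obj V (n - 1)\<^esub>)"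
      unfolding cohomologous_def using chain_map_cocycle[OF V sX fc xc] chain_map_cocycle[OF V sX fc zc] b e f0
      by (auto intro!: bexI[of _ "\<ominus>\<^bsub>obj X (n - 1)\<^esub> b"] simp: simps)
    then have "cohomologous V (n - 1) x \<zero>\<^bsub>obj V (n - 1)\<^esub>" using fq xc zc by blast
    then obtain a where "a \<in> carrier (obj V (n - 1 - 1))" "x = diff V (n - 1 - 1) a"
      by (auto simp: cohomologous_def simps)
    then show "\<exists>a \<in> carrier (obj (unshift_complex V) (n - 1)). x = diff (unshift_complex V) (n - 1) a"
      by (auto intro!: bexI[of _ "\<ominus>\<^bsub>obj V (n - 1 - 1)\<^esub> a"] simp: simps)
  next
    fix n y assume y: "y \<in> carrier (obj X n)" "diff X n y = \<zero>\<^bsub>obj X (n + 1)\<^esub>"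
    then have "y \<in> cocycles (shift_complex X) (n - 1)" by (simp add: cocycles_def simps)
    then obtain x b where x: "x \<in> cocycles V (n - 1)" and b: "b \<in> carrier (obj X (n - 1))"
      and e: "f (n - 1) x = \<ominus>\<^bsub>obj X n\<^esub> diff X (n - 1) b \<oplus>\<^bsub>obj X n\<^esub> y"
      using fq unfolding cohomologous_def by fastforce
    note x' = cocyclesD[OF x]
    show "\<exists>x \<in> carrier (obj (unshift_complex V) n). \<exists>b \<in> carrier (obj X (n - 1)).
        diff (unshift_complex V) n x = \<zero>\<^bsub>obj (unshift_complex V) (n + 1)\<^esub> \<and>
        f (n - 1) x = diff X (n - 1) b \<oplus>\<^bsub>obj X n\<^esub> y"
      using x' b by (intro bexI[of _ x] bexI[of _ "\<ominus>\<^bsub>obj X (n - 1)\<^esub> b"]) (simp_all add: simps e)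
  }
qed

lemma quasi_iso_shift:
  assumes V: "bounded_complex R V" and X: "bounded_complex R X" and f: "quasi_iso R V X f"
  shows "quasi_iso R (shift_complex V) (shift_complex X) (shift_map f)"
proof (rule quasi_isoI[OF bounded_shift[OF V] bounded_shift[OF X]])
  note fc = quasi_iso_chain_map[OF f] and fq = f[unfolded quasi_iso_iff[OF V X]]
  note simps = bounded_complex_props[OF V] bounded_complex_props[OF X] chain_map_props[OF V X fc] abelian_group_cancel
  show "chain_map R (shift_complex V) (shift_complex X) (shift_map f)" by (rule chain_map_shift[OF V X fc])
  {
    fix n x b assume x: "x \<in> carrier (obj (shift_complex V) n)"
      and dx: "diff (shift_complex V) n x = \<zero>\<^bsub>obj (shift_complex V) (n + 1)\<^esub>"
      and b: "b \<in> carrier (obj (shift_complex X) (n - 1))"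
      and e: "shift_map f n x = diff (shift_complex X) (n - 1) b"
    have "diff V (n + 1) x = \<ominus>\<^bsub>obj V (n + 1 + 1)\<^esub> (\<ominus>\<^bsub>obj V (n + 1 + 1)\<^esub> diff V (n + 1) x)" using x by (simp add: simps)
    also have "\<dots> = \<zero>\<^bsub>obj V (n + 1 + 1)\<^esub>" using dx by (simp add: simps)
    finally have xc: "x \<in> cocycles V (n + 1)" using x by (simp add: cocycles_def)
    have zc: "\<zero>\<^bsub>obj V (n + 1)\<^esub> \<in> cocycles V (n + 1)" by (simp add: cocycles_def simps)
    have f0: "f (n + 1) \<zero>\<^bsub>obj V (n + 1)\<^esub> = \<zero>\<^bsub>obj X (n + 1)\<^esub>" by (simp add: simps)
    have "cohomologous X (n + 1) (f (n + 1) x) (f (n + 1) \<zero>\<^bsub>obj V (n + 1)\<^esub>)"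
      unfolding cohomologous_def using chain_map_cocycle[OF V X fc xc] chain_map_cocycle[OF V X fc zc] b e f0
      by (auto intro!: bexI[of _ "\<ominus>\<^bsub>obj X n\<^esub> b"] simp: simps shift_map_def)
    then have "cohomologous V (n + 1) x \<zero>\<^bsub>obj V (n + 1)\<^esub>" using fq xc zc by blast
    then obtain a where "a \<in> carrier (obj V n)" "x = diff V n a"
      by (auto simp: cohomologous_def simps)
    then show "\<exists>a \<in> carrier (obj (shift_complex V) (n - 1)). x = diff (shift_complex V) (n - 1) a"
      by (auto intro!: bexI[of _ "\<ominus>\<^bsub>obj V n\<^esub> a"] simp: simps)
  next
    fix n y assume y: "y \<in> carrier (obj (shift_complex X) n)"
      "diff (shift_complex X) n y = \<zero>\<^bsub>obj (shift_complex X) (n + 1)\<^esub>"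
    have "y \<in> cocycles X (n + 1)"
      using y by (simp add: cocycles_def simps abelian_group_minus_eq_zero)
    then obtain x b where x: "x \<in> cocycles V (n + 1)" and b: "b \<in> carrier (obj X n)"
      and e: "f (n + 1) x = diff X n b \<oplus>\<^bsub>obj X (n + 1)\<^esub> y"
      using fq unfolding cohomologous_def by fastforce
    note x' = cocyclesD[OF x]
    show "\<exists>x \<in> carrier (obj (shift_complex V) n). \<exists>b \<in> carrier (obj (shift_complex X) (n - 1)).
        diff (shift_complex V) n x = \<zero>\<^bsub>obj (shift_complex V) (n + 1)\<^esub> \<and>
        shift_map f n x = diff (shift_complex X) (n - 1) b \<oplus>\<^bsub>obj (shift_complex X) n\<^esub> y"
      using x' b by (intro bexI[of _ x] bexI[of _ "\<ominus>\<^bsub>obj X n\<^esub> b"]) (simp_all add: simps e shift_map_def)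
  }
qed

section \<open>Mapping cones\<close>

lemma cone_simps [simp]:
  "obj (cone X Y f) n = module_sum (obj X (n + 1)) (obj Y n)"
  "diff (cone X Y f) n (x, y) = (\<ominus>\<^bsub>obj X (n + 1 + 1)\<^esub> diff X (n + 1) x,
     f (n + 1) x \<oplus>\<^bsub>obj Y (n + 1)\<^esub> diff Y n y)"
  by (simp_all add: cone_def)

lemma chain_map_cone:
  assumes X: "bounded_complex R X" and Y: "bounded_complex R Y" and f: "chain_map R X Y f"
  shows "chain_map R (cone X Y f) (shift_complex X) cone_out"
    and "chain_map R Y (cone X Y f) (cone_in X)"
proof -
  note simps = bounded_complex_props[OF X] bounded_complex_props[OF Y] chain_map_props[OF X Y f]
    abelian_group_cancel
  show "chain_map R (cone X Y f) (shift_complex X) cone_out"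
    by (rule chain_mapI) (auto simp: cone_out_def simps)
  have "f n \<zero>\<^bsub>obj X n\<^esub> = \<zero>\<^bsub>obj Y n\<^esub>" "diff X n \<zero>\<^bsub>obj X n\<^esub> = \<zero>\<^bsub>obj X (n + 1)\<^esub>" 
    "\<ominus>\<^bsub>obj X n\<^esub> \<zero>\<^bsub>obj X n\<^esub> = \<zero>\<^bsub>obj X n\<^esub>" for n by (simp_all add: simps)
  note z = this[of "n + 1" for n] this[of "n + 1 + 1" for n]
  show "chain_map R Y (cone X Y f) (cone_in X)"
    by (rule chain_mapI) (auto simp: cone_in_def simps z)
qed

text \<open>A null homotopy of \<open>f a\<close> is exactly the second coordinate that
  \<open>a\<close> lacks in order to map into the cone. The source is shifted because the first
  coordinate of the cone is \<open>X[1]\<close>.\<close>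

lemma cone_lift:
  assumes V: "bounded_complex R V" and X: "bounded_complex R X" and Y: "bounded_complex R Y"
    and a: "chain_map R V X a" and f: "chain_map R X Y f"
    and h: "homotopic R V Y (f \<circ>\<circ>\<circ> a) (\<lambda>n x. \<zero>\<^bsub>obj Y n\<^esub>)"
  obtains k where "chain_map R (shift_complex V) (cone X Y f) k"
    and "cone_out \<circ>\<circ>\<circ> k = shift_map a"
proof -
  from h obtain h where H: "homotopy R V Y (f \<circ>\<circ>\<circ> a) (\<lambda>n x. \<zero>\<^bsub>obj Y n\<^esub>) h" by (rule homotopicE)
  note hp = homotopy_props[OF V Y H]
  note simps = bounded_complex_props[OF V] bounded_complex_props[OF X] bounded_complex_props[OF Y]
    chain_map_props[OF V X a] chain_map_props[OF X Y f] hp abelian_group_cancel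
  \<comment> \<open>With this sign the second coordinate of the cone differential becomes
    \<open>f a - d h\<close>, which the homotopy equates with \<open>h d\<close>, as the negated
    differential of the shift demands.\<close>
  define k where "k n v = (a (n + 1) v, \<ominus>\<^bsub>obj Y n\<^esub> h (n + 1) v)" for n v
  have "chain_map R (shift_complex V) (cone X Y f) k"
  proof (rule chain_mapI)
    fix n v assume v: "v \<in> carrier (obj (shift_complex V) n)"
    then have v': "v \<in> carrier (obj V (n + 1))" by simp
    have "f (n + 1) (a (n + 1) v) = diff Y n (h (n + 1) v) \<oplus>\<^bsub>obj Y (n + 1)\<^esub> h (n + 1 + 1) (diff V (n + 1) v)"
      using homotopy_eq[OF H v'] v' by (simp add: simps)
    moreover have "h (n + 1 + 1) (\<ominus>\<^bsub>obj V (n + 1 + 1)\<^esub> diff V (n + 1) v) =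
      \<ominus>\<^bsub>obj Y (n + 1)\<^esub> h (n + 1 + 1) (diff V (n + 1) v)"
      using hp(5)[of "diff V (n + 1) v" "n + 1 + 1"] v' by (simp add: simps add.commute)
    moreover have "h (n + 1 + 1) (diff V (n + 1) v) \<in> carrier (obj Y (n + 1))"
      by (rule hp(1)) (use v' in \<open>simp_all add: simps\<close>)
    ultimately show "diff (cone X Y f) n (k n v) = k (n + 1) (diff (shift_complex V) n v)"
      using v' by (simp add: k_def simps)
  qed (auto simp: k_def simps)
  moreover have "cone_out \<circ>\<circ>\<circ> k = shift_map a"
    by (simp add: fun_eq_iff cone_out_def k_def shift_map_def)
  ultimately show thesis by (rule that)
qed

text \<open>For a cocycle \<open>(x, y)\<close> the relation \<open>f x = - d y\<close> and
  injectivity on cohomology give \<open>x = d x'\<close>. Then \<open>y + f x'\<close> is a cocycle,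
  so by surjectivity it equals \<open>f z - d b\<close> for a cocycle \<open>z\<close>, and
  \<open>(z - x', - b)\<close> is a primitive.\<close>

lemma acyclic_cone:
  assumes X: "bounded_complex R X" and Y: "bounded_complex R Y" and f: "quasi_iso R X Y f"
  shows "acyclic_complex (cone X Y f)"
  unfolding acyclic_complex_def
proof (intro allI ballI impI)
  note fc = quasi_iso_chain_map[OF f] and fq = f[unfolded quasi_iso_iff[OF X Y]]
  note simps = bounded_complex_props[OF X] bounded_complex_props[OF Y] chain_map_props[OF X Y fc] abelian_group_cancel
  fix n p assume p: "p \<in> carrier (obj (cone X Y f) n)" and dp: "diff (cone X Y f) n p = \<zero>\<^bsub>obj (cone X Y f) (n + 1)\<^esub>"
  obtain x y where pe: "p = (x, y)" by (cases p)
  have x: "x \<in> carrier (obj X (n + 1))" and y: "y \<in> carrier (obj Y n)"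
    and dx0: "\<ominus>\<^bsub>obj X (n + 1 + 1)\<^esub> diff X (n + 1) x = \<zero>\<^bsub>obj X (n + 1 + 1)\<^esub>"
    and e: "f (n + 1) x \<oplus>\<^bsub>obj Y (n + 1)\<^esub> diff Y n y = \<zero>\<^bsub>obj Y (n + 1)\<^esub>"
    using p dp by (simp_all add: pe)
  have "diff X (n + 1) x = \<ominus>\<^bsub>obj X (n + 1 + 1)\<^esub> (\<ominus>\<^bsub>obj X (n + 1 + 1)\<^esub> diff X (n + 1) x)" using x by (simp add: simps)
  also have "\<dots> = \<zero>\<^bsub>obj X (n + 1 + 1)\<^esub>" unfolding dx0 by (simp add: simps)
  finally have xc: "x \<in> cocycles X (n + 1)" using x by (simp add: cocycles_def)
  have zc: "\<zero>\<^bsub>obj X (n + 1)\<^esub> \<in> cocycles X (n + 1)" by (simp add: cocycles_def simps)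
  have "f (n + 1) x = (f (n + 1) x \<oplus>\<^bsub>obj Y (n + 1)\<^esub> diff Y n y) \<oplus>\<^bsub>obj Y (n + 1)\<^esub> diff Y n (\<ominus>\<^bsub>obj Y n\<^esub> y)"
    using x y by (simp add: simps)
  also have "\<dots> = diff Y (n + 1 - 1) (\<ominus>\<^bsub>obj Y n\<^esub> y) \<oplus>\<^bsub>obj Y (n + 1)\<^esub> f (n + 1) \<zero>\<^bsub>obj X (n + 1)\<^esub>"
    unfolding e using y by (simp add: simps)
  finally have fx: "f (n + 1) x = diff Y (n + 1 - 1) (\<ominus>\<^bsub>obj Y n\<^esub> y) \<oplus>\<^bsub>obj Y (n + 1)\<^esub> f (n + 1) \<zero>\<^bsub>obj X (n + 1)\<^esub>" .
  moreover have "\<ominus>\<^bsub>obj Y n\<^esub> y \<in> carrier (obj Y (n + 1 - 1))" using y by (simp add: simps)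
  ultimately have "cohomologous Y (n + 1) (f (n + 1) x) (f (n + 1) \<zero>\<^bsub>obj X (n + 1)\<^esub>)"
    unfolding cohomologous_def using chain_map_cocycle[OF X Y fc xc] chain_map_cocycle[OF X Y fc zc] by blast
  then have "cohomologous X (n + 1) x \<zero>\<^bsub>obj X (n + 1)\<^esub>" using fq xc zc by blast
  then obtain x' where x': "x' \<in> carrier (obj X n)" "x = diff X n x'"
    by (auto simp: cohomologous_def simps)
  have "diff Y n (y \<oplus>\<^bsub>obj Y n\<^esub> f n x') = \<zero>\<^bsub>obj Y (n + 1)\<^esub>"
    using e x' y by (simp add: simps)
  then have "y \<oplus>\<^bsub>obj Y n\<^esub> f n x' \<in> cocycles Y n" using x' y by (simp add: cocycles_def simps)
  then obtain z b where z: "z \<in> cocycles X n" and b: "b \<in> carrier (obj Y (n - 1))"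
    and ez: "f n z = diff Y (n - 1) b \<oplus>\<^bsub>obj Y n\<^esub> (y \<oplus>\<^bsub>obj Y n\<^esub> f n x')"
    using fq unfolding cohomologous_def by blast
  note z' = cocyclesD[OF z]
  have "p = diff (cone X Y f) (n - 1) (z \<oplus>\<^bsub>obj X n\<^esub> \<ominus>\<^bsub>obj X n\<^esub> x', \<ominus>\<^bsub>obj Y (n - 1)\<^esub> b)"
    using x' y z' b by (simp add: pe simps ez)
  moreover have "(z \<oplus>\<^bsub>obj X n\<^esub> \<ominus>\<^bsub>obj X n\<^esub> x', \<ominus>\<^bsub>obj Y (n - 1)\<^esub> b) \<in> carrier (obj (cone X Y f) (n - 1))"
    using x' z' b by (simp add: simps)
  ultimately show "\<exists>b \<in> carrier (obj (cone X Y f) (n - 1)). p = diff (cone X Y f) (n - 1) b" by blast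
qed

text \<open>The quotient of the cone by \<open>Y\<close> is \<open>X[1]\<close>, which is acyclic,
  so cocycles of the cone can be moved into \<open>Y\<close>.\<close>

lemma cone_in_quasi_iso:
  assumes X: "bounded_complex R X" and Y: "bounded_complex R Y" and f: "chain_map R X Y f"
    and aX: "acyclic_complex X"
  shows "quasi_iso R Y (cone X Y f) (cone_in X)"
proof (rule quasi_isoI[OF Y bounded_cone[OF X Y f] chain_map_cone(2)[OF X Y f]])
  note simps = bounded_complex_props[OF X] bounded_complex_props[OF Y] chain_map_props[OF X Y f] abelian_group_cancel
  note ac = aX[unfolded acyclic_complex_def, rule_format]
  fix n y p assume y: "y \<in> carrier (obj Y n)" and p: "p \<in> carrier (obj (cone X Y f) (n - 1))"
    and e: "cone_in X n y = diff (cone X Y f) (n - 1) p"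
  obtain x' y' where pe: "p = (x', y')" by (cases p)
  have x': "x' \<in> carrier (obj X n)" and y': "y' \<in> carrier (obj Y (n - 1))" using p by (simp_all add: pe)
  have dx0: "\<ominus>\<^bsub>obj X (n + 1)\<^esub> diff X n x' = \<zero>\<^bsub>obj X (n + 1)\<^esub>"
    and ye: "y = f n x' \<oplus>\<^bsub>obj Y n\<^esub> diff Y (n - 1) y'"
    using e by (simp_all add: pe cone_in_def)
  have "diff X n x' = \<ominus>\<^bsub>obj X (n + 1)\<^esub> (\<ominus>\<^bsub>obj X (n + 1)\<^esub> diff X n x')" using x' by (simp add: simps)
  also have "\<dots> = \<zero>\<^bsub>obj X (n + 1)\<^esub>" unfolding dx0 by (simp add: simps)
  finally obtain x2 where x2: "x2 \<in> carrier (obj X (n - 1))" "x' = diff X (n - 1) x2" using ac x' by blast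
  have "y = diff Y (n - 1) (f (n - 1) x2 \<oplus>\<^bsub>obj Y (n - 1)\<^esub> y')" unfolding ye x2(2) using x2 y' by (simp add: simps)
  moreover have "f (n - 1) x2 \<oplus>\<^bsub>obj Y (n - 1)\<^esub> y' \<in> carrier (obj Y (n - 1))" using x2 y' by (simp add: simps)
  ultimately show "\<exists>a \<in> carrier (obj Y (n - 1)). y = diff Y (n - 1) a" by blast
next
  note simps = bounded_complex_props[OF X] bounded_complex_props[OF Y] chain_map_props[OF X Y f] abelian_group_cancel
  note ac = aX[unfolded acyclic_complex_def, rule_format]
  fix n p assume p: "p \<in> carrier (obj (cone X Y f) n)" and dp: "diff (cone X Y f) n p = \<zero>\<^bsub>obj (cone X Y f) (n + 1)\<^esub>"
  obtain x y where pe: "p = (x, y)" by (cases p)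
  have x: "x \<in> carrier (obj X (n + 1))" and y: "y \<in> carrier (obj Y n)"
    and dx0: "\<ominus>\<^bsub>obj X (n + 1 + 1)\<^esub> diff X (n + 1) x = \<zero>\<^bsub>obj X (n + 1 + 1)\<^esub>"
    and e: "f (n + 1) x \<oplus>\<^bsub>obj Y (n + 1)\<^esub> diff Y n y = \<zero>\<^bsub>obj Y (n + 1)\<^esub>"
    using p dp by (simp_all add: pe)
  have "diff X (n + 1) x = \<ominus>\<^bsub>obj X (n + 1 + 1)\<^esub> (\<ominus>\<^bsub>obj X (n + 1 + 1)\<^esub> diff X (n + 1) x)" using x by (simp add: simps)
  also have "\<dots> = \<zero>\<^bsub>obj X (n + 1 + 1)\<^esub>" unfolding dx0 by (simp add: simps)
  finally obtain x' where x': "x' \<in> carrier (obj X n)" "x = diff X n x'"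
    using ac[of x "n + 1"] x by auto
  have "diff Y n (y \<oplus>\<^bsub>obj Y n\<^esub> f n x') = \<zero>\<^bsub>obj Y (n + 1)\<^esub>"
    using e x' y by (simp add: simps)
  moreover have "y \<oplus>\<^bsub>obj Y n\<^esub> f n x' \<in> carrier (obj Y n)" using x' y by (simp add: simps)
  moreover have "cone_in X n (y \<oplus>\<^bsub>obj Y n\<^esub> f n x') =
    diff (cone X Y f) (n - 1) (x', \<zero>\<^bsub>obj Y (n - 1)\<^esub>) \<oplus>\<^bsub>obj (cone X Y f) n\<^esub> p"
    using x' y by (simp add: pe cone_in_def simps)
  moreover have "(x', \<zero>\<^bsub>obj Y (n - 1)\<^esub>) \<in> carrier (obj (cone X Y f) (n - 1))" using x' by (simp add: simps)
  ultimately show "\<exists>x \<in> carrier (obj Y n). \<exists>b \<in> carrier (obj (cone X Y f) (n - 1)).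
      diff Y n x = \<zero>\<^bsub>obj Y (n + 1)\<^esub> \<and> cone_in X n x = diff (cone X Y f) (n - 1) b \<oplus>\<^bsub>obj (cone X Y f) n\<^esub> p"
    by blast
qed

text \<open>The map is onto, and its kernel is the cone of the isomorphism from \<open>X\<close> to
  the kernel of \<open>g\<close>, hence acyclic. This is what turns short exact sequences of
  complexes into distinguished triangles.\<close>

lemma short_exact_cone_quasi_iso:
  assumes X: "bounded_complex R X" and Y: "bounded_complex R Y" and K: "bounded_complex R K"
    and f: "chain_map R X Y f" and g: "chain_map R Y K g"
    and inj: "\<And>n x. x \<in> carrier (obj X n) \<Longrightarrow> f n x = \<zero>\<^bsub>obj Y n\<^esub> \<Longrightarrow> x = \<zero>\<^bsub>obj X n\<^esub>"
    and surj: "\<And>n k. k \<in> carrier (obj K n) \<Longrightarrow> \<exists>y \<in> carrier (obj Y n). g n y = k"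
    and gf: "\<And>n x. x \<in> carrier (obj X n) \<Longrightarrow> g n (f n x) = \<zero>\<^bsub>obj K n\<^esub>"
    and ker: "\<And>n y. y \<in> carrier (obj Y n) \<Longrightarrow> g n y = \<zero>\<^bsub>obj K n\<^esub> \<Longrightarrow> \<exists>x \<in> carrier (obj X n). y = f n x"
  shows "quasi_iso R (cone X Y f) K (\<lambda>n p. g n (snd p))"
proof (rule quasi_isoI[OF bounded_cone[OF X Y f] K])
  note simps = bounded_complex_props[OF X] bounded_complex_props[OF Y] bounded_complex_props[OF K]
    chain_map_props[OF X Y f] chain_map_props[OF Y K g] gf abelian_group_cancel
  show "chain_map R (cone X Y f) K (\<lambda>n p. g n (snd p))"
    by (rule chain_mapI) (auto simp: simps)
  {
    fix n p b assume p: "p \<in> carrier (obj (cone X Y f) n)" and dp: "diff (cone X Y f) n p = \<zero>\<^bsub>obj (cone X Y f) (n + 1)\<^esub>"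
      and b: "b \<in> carrier (obj K (n - 1))" and gb: "g n (snd p) = diff K (n - 1) b"
    obtain x y where pe: "p = (x, y)" by (cases p)
    have x: "x \<in> carrier (obj X (n + 1))" and y: "y \<in> carrier (obj Y n)"
      and e: "f (n + 1) x \<oplus>\<^bsub>obj Y (n + 1)\<^esub> diff Y n y = \<zero>\<^bsub>obj Y (n + 1)\<^esub>"
      using p dp by (simp_all add: pe)
    \<comment> \<open>Lifting \<open>b\<close> puts \<open>y - d y'\<close> into the kernel of
      \<open>g\<close>, so it is some \<open>f x'\<close>. The pair \<open>(x', y')\<close> is the
      primitive: injectivity of \<open>f\<close> forces the first coordinate to be right.\<close>
    obtain y' where y': "y' \<in> carrier (obj Y (n - 1))" "g (n - 1) y' = b" using surj[OF b] by blast
    have "g n (y \<oplus>\<^bsub>obj Y n\<^esub> \<ominus>\<^bsub>obj Y n\<^esub> diff Y (n - 1) y') = \<zero>\<^bsub>obj K n\<^esub>"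
      using y y' gb b by (simp add: simps pe)
    then obtain x' where x': "x' \<in> carrier (obj X n)" "y \<oplus>\<^bsub>obj Y n\<^esub> \<ominus>\<^bsub>obj Y n\<^esub> diff Y (n - 1) y' = f n x'"
      using ker[of "y \<oplus>\<^bsub>obj Y n\<^esub> \<ominus>\<^bsub>obj Y n\<^esub> diff Y (n - 1) y'" n] y y' by (auto simp: simps)
    have ye: "y = f n x' \<oplus>\<^bsub>obj Y n\<^esub> diff Y (n - 1) y'"
      unfolding x'(2)[symmetric] using y y' by (simp add: simps)
    have "diff Y n y = diff Y n (f n x')" unfolding ye using x' y' by (simp add: simps)
    then have "f (n + 1) (x \<oplus>\<^bsub>obj X (n + 1)\<^esub> diff X n x') = \<zero>\<^bsub>obj Y (n + 1)\<^esub>"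
      using e x x' by (simp add: simps)
    then have "x \<oplus>\<^bsub>obj X (n + 1)\<^esub> diff X n x' = \<zero>\<^bsub>obj X (n + 1)\<^esub>"
      using x x' by (intro inj) (simp_all add: simps)
    moreover have "x = (x \<oplus>\<^bsub>obj X (n + 1)\<^esub> diff X n x') \<oplus>\<^bsub>obj X (n + 1)\<^esub> \<ominus>\<^bsub>obj X (n + 1)\<^esub> diff X n x'"
      using x x' by (simp add: simps)
    ultimately have "x = \<ominus>\<^bsub>obj X (n + 1)\<^esub> diff X n x'" using x' by (simp add: simps)
    then have "p = diff (cone X Y f) (n - 1) (x', y')" by (simp add: pe ye)
    moreover have "(x', y') \<in> carrier (obj (cone X Y f) (n - 1))" using x' y' by simp
    ultimately show "\<exists>a \<in> carrier (obj (cone X Y f) (n - 1)). p = diff (cone X Y f) (n - 1) a" by blast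
  next
    fix n k assume k: "k \<in> carrier (obj K n)" "diff K n k = \<zero>\<^bsub>obj K (n + 1)\<^esub>"
    obtain y where y: "y \<in> carrier (obj Y n)" "g n y = k" using surj[OF k(1)] by blast
    have "g (n + 1) (diff Y n y) = \<zero>\<^bsub>obj K (n + 1)\<^esub>" using y k by (simp add: simps)
    then obtain x where x: "x \<in> carrier (obj X (n + 1))" "diff Y n y = f (n + 1) x"
      using ker[of "diff Y n y" "n + 1"] y by (auto simp: simps)
    have "f (n + 1 + 1) (diff X (n + 1) x) = \<zero>\<^bsub>obj Y (n + 1 + 1)\<^esub>"
      using chain_map_props(6)[OF X Y f x(1), of "n + 1 + 1"] bounded_complex_props(7)[OF Y y(1), of "n + 1"] x(2)
      by simp
    then have "diff X (n + 1) x = \<zero>\<^bsub>obj X (n + 1 + 1)\<^esub>"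
      using x by (intro inj) (simp_all add: simps)
    then have "diff (cone X Y f) n (\<ominus>\<^bsub>obj X (n + 1)\<^esub> x, y) = \<zero>\<^bsub>obj (cone X Y f) (n + 1)\<^esub>"
      using x y by (simp add: simps)
    then show "\<exists>p \<in> carrier (obj (cone X Y f) n). \<exists>b \<in> carrier (obj K (n - 1)).
        diff (cone X Y f) n p = \<zero>\<^bsub>obj (cone X Y f) (n + 1)\<^esub> \<and> g n (snd p) = diff K (n - 1) b \<oplus>\<^bsub>obj K n\<^esub> k"
      using x y k by (intro bexI[of _ "(\<ominus>\<^bsub>obj X (n + 1)\<^esub> x, y)"] bexI[of _ "\<zero>\<^bsub>obj K (n - 1)\<^esub>"])
        (simp_all add: simps)
  }
qed

text \<open>Following the null homotopy by \<open>cone_out\<close> recovers \<open>a[1] t\<close>,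
  and unshifting gives \<open>a\<close>. Combined with \<open>cone_lift\<close> it yields both the
  cancellation of quasi-isomorphisms and the injectivity of Hom along a triangle.\<close>

lemma cone_null_unshift:
  assumes V: "bounded_complex R V" and X: "bounded_complex R X" and Y: "bounded_complex R Y"
    and P: "bounded_complex R P"
    and a: "chain_map R V X a" and f: "chain_map R X Y f"
    and k: "chain_map R (shift_complex V) (cone X Y f) k" "cone_out \<circ>\<circ>\<circ> k = shift_map a"
    and t: "chain_map R P (shift_complex V) t"
    and null: "homotopic R P (cone X Y f) (k \<circ>\<circ>\<circ> t) (\<lambda>n x. \<zero>\<^bsub>obj (cone X Y f) n\<^esub>)"
  shows "homotopic R (unshift_complex P) X (a \<circ>\<circ>\<circ> (\<lambda>n. t (n - 1))) (\<lambda>n x. \<zero>\<^bsub>obj X n\<^esub>)"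
proof -
  note C = bounded_cone[OF X Y f] and sX = bounded_shift[OF X] and sV = bounded_shift[OF V]
  have "homotopic R P (shift_complex X) (cone_out \<circ>\<circ>\<circ> (k \<circ>\<circ>\<circ> t)) (cone_out \<circ>\<circ>\<circ> (\<lambda>n x. \<zero>\<^bsub>obj (cone X Y f) n\<^esub>))"
    by (rule homotopic_comp_left[OF P C sX chain_map_comp[OF t k(1)] chain_map_zero[OF P C]
          chain_map_cone(1)[OF X Y f] null])
  moreover have "cone_out \<circ>\<circ>\<circ> (k \<circ>\<circ>\<circ> t) = shift_map a \<circ>\<circ>\<circ> t"
    using k(2) by (simp add: fun_eq_iff)
  moreover have "cone_out \<circ>\<circ>\<circ> (\<lambda>n x. \<zero>\<^bsub>obj (cone X Y f) n\<^esub>) = (\<lambda>n (x :: 'f). \<zero>\<^bsub>obj (shift_complex X) n\<^esub>)"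
    by (simp add: cone_out_def fun_eq_iff)
  ultimately have "homotopic R P (shift_complex X) (shift_map a \<circ>\<circ>\<circ> t) (\<lambda>n x. \<zero>\<^bsub>obj (shift_complex X) n\<^esub>)"
    by simp
  from homotopic_unshift[OF P X chain_map_comp[OF t chain_map_shift[OF V X a]] chain_map_zero[OF P sX] this]
  show ?thesis by (simp add: shift_map_def comp_def)
qed

text \<open>The null homotopy lifts \<open>a[1]\<close> to the cone of \<open>s\<close>. That cone
  is acyclic, so the lift becomes null homotopic on a quasi-isomorphic complex, and \<open>a\<close>
  with it.\<close>

lemma quasi_iso_cancel_null:
  fixes V :: "('a, 'm) cochain" and Z :: "('a, 'k) cochain" and Y :: "('a, 'l) cochain"
  assumes V: "bounded_complex R V" and Z: "bounded_complex R Z" and Y: "bounded_complex R Y"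
    and a: "chain_map R V Z a" and s: "quasi_iso R Z Y s"
    and null: "homotopic R V Y (s \<circ>\<circ>\<circ> a) (\<lambda>n x. \<zero>\<^bsub>obj Y n\<^esub>)"
  obtains U :: "('a, 'a list set) cochain" and t where "bounded_complex R U" and "quasi_iso R U V t"
    and "homotopic R U Z (a \<circ>\<circ>\<circ> t) (\<lambda>n x. \<zero>\<^bsub>obj Z n\<^esub>)"
proof -
  note sc = quasi_iso_chain_map[OF s] and C = bounded_cone[OF Z Y quasi_iso_chain_map[OF s]]
  note sV = bounded_shift[OF V]
  obtain k where k: "chain_map R (shift_complex V) (cone Z Y s) k" "cone_out \<circ>\<circ>\<circ> k = shift_map a"
    by (rule cone_lift[OF V Z Y a sc null])
  note O = bounded_zero_complex[OF bounded_complex_cring[OF V]]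
  have z: "chain_map R (zero_complex :: ('a, unit) cochain) (cone Z Y s) (\<lambda>n x. \<zero>\<^bsub>obj (cone Z Y s) n\<^esub>)"
    by (rule chain_map_zero[OF O C])
  \<comment> \<open>The acyclic cone is quasi-isomorphic to the zero complex; the Ore square over it
    makes \<open>k t\<close> homotopic to a map through zero.\<close>
  have q: "quasi_iso R (zero_complex :: ('a, unit) cochain) (cone Z Y s) (\<lambda>n x. \<zero>\<^bsub>obj (cone Z Y s) n\<^esub>)"
    by (rule chain_map_acyclic_quasi_iso[OF O C z acyclic_zero_complex acyclic_cone[OF Z Y s]])
  obtain P :: "('a, 'a list set) cochain" and t h where P: "bounded_complex R P"
    and t: "quasi_iso R P (shift_complex V) t" and h: "chain_map R P (zero_complex :: ('a, unit) cochain) h"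
    and H: "homotopic R P (cone Z Y s) (k \<circ>\<circ>\<circ> t) ((\<lambda>n x. \<zero>\<^bsub>obj (cone Z Y s) n\<^esub>) \<circ>\<circ>\<circ> h)"
    by (rule quasi_iso_ore[OF sV O C k(1) q])
  have "homotopic R P (cone Z Y s) (k \<circ>\<circ>\<circ> t) (\<lambda>n x. \<zero>\<^bsub>obj (cone Z Y s) n\<^esub>)"
    using H by (simp add: comp_def)
  from cone_null_unshift[OF V Z Y P a sc k quasi_iso_chain_map[OF t] this]
  show thesis by (rule that[OF bounded_unshift[OF P] quasi_iso_unshift[OF P V t]])
qed

section \<open>The derived category is a category with zero morphisms\<close>

text \<open>Carrying boundedness along with the maps lets the calculus of fractions be chained by
  resolution alone.\<close>

definition cx_mor :: "('a, 'r) ring_scheme \<Rightarrow> ('a, 'm) cochain \<Rightarrow> ('a, 'k) cochain \<Rightarrow> (int \<Rightarrow> 'm \<Rightarrow> 'k) \<Rightarrow> bool" where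
  "cx_mor R X Y f \<longleftrightarrow> bounded_complex R X \<and> bounded_complex R Y \<and> chain_map R X Y f"

definition cx_qis :: "('a, 'r) ring_scheme \<Rightarrow> ('a, 'm) cochain \<Rightarrow> ('a, 'k) cochain \<Rightarrow> (int \<Rightarrow> 'm \<Rightarrow> 'k) \<Rightarrow> bool" where
  "cx_qis R X Y f \<longleftrightarrow> bounded_complex R X \<and> bounded_complex R Y \<and> quasi_iso R X Y f"

definition cx_homot :: "('a, 'r) ring_scheme \<Rightarrow> ('a, 'm) cochain \<Rightarrow> ('a, 'k) cochain \<Rightarrow>
    (int \<Rightarrow> 'm \<Rightarrow> 'k) \<Rightarrow> (int \<Rightarrow> 'm \<Rightarrow> 'k) \<Rightarrow> bool" where
  "cx_homot R X Y f g \<longleftrightarrow> cx_mor R X Y f \<and> cx_mor R X Y g \<and> homotopic R X Y f g"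

lemma cx_qis_mor: "cx_qis R X Y f \<Longrightarrow> cx_mor R X Y f"
  by (simp add: cx_qis_def cx_mor_def quasi_iso_chain_map)

text \<open>Composites are written pointwise: iterated ones then coincide up to beta reduction
  whatever their bracketing, so these rules chain without rewriting by associativity.\<close>

lemma cx_mor_comp: "cx_mor R Y Z g \<Longrightarrow> cx_mor R X Y f \<Longrightarrow> cx_mor R X Z (\<lambda>n x. g n (f n x))"
  using chain_map_comp[of R X Y f Z g] by (simp add: cx_mor_def comp_def)

lemma cx_qis_comp: "cx_qis R Y Z g \<Longrightarrow> cx_qis R X Y f \<Longrightarrow> cx_qis R X Z (\<lambda>n x. g n (f n x))"
  using quasi_iso_comp[of R X Y Z f g] by (simp add: cx_qis_def comp_def)

lemma cx_qis_id: "bounded_complex R X \<Longrightarrow> cx_qis R X X (\<lambda>n x. x)"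
  by (simp add: cx_qis_def quasi_iso_id)

lemma cx_mor_id: "bounded_complex R X \<Longrightarrow> cx_mor R X X (\<lambda>n x. x)"
  by (simp add: cx_mor_def chain_map_id)

lemma cx_mor_zero: "bounded_complex R X \<Longrightarrow> bounded_complex R Y \<Longrightarrow> cx_mor R X Y (\<lambda>n x. \<zero>\<^bsub>obj Y n\<^esub>)"
  by (simp add: cx_mor_def chain_map_zero)

lemma cx_mor_map_zero: "cx_mor R X Y f \<Longrightarrow> f n \<zero>\<^bsub>obj X n\<^esub> = \<zero>\<^bsub>obj Y n\<^esub>"
  unfolding cx_mor_def by (elim conjE) (rule chain_map_props(4))

lemma cx_homot_refl: "cx_mor R X Y f \<Longrightarrow> cx_homot R X Y f f"
  by (simp add: cx_homot_def cx_mor_def homotopic_refl)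

lemma cx_homot_sym: "cx_homot R X Y f g \<Longrightarrow> cx_homot R X Y g f"
  using homotopic_sym[of R X Y f g] by (simp add: cx_homot_def cx_mor_def)

lemma cx_homot_trans [trans]: "cx_homot R X Y f g \<Longrightarrow> cx_homot R X Y g h \<Longrightarrow> cx_homot R X Y f h"
  using homotopic_trans[of R X Y f g h] by (simp add: cx_homot_def cx_mor_def)

lemma cx_homot_left: "cx_mor R Y Z k \<Longrightarrow> cx_homot R X Y f g \<Longrightarrow>
    cx_homot R X Z (\<lambda>n x. k n (f n x)) (\<lambda>n x. k n (g n x))"
  using homotopic_comp_left[of R X Y Z f g k] cx_mor_comp[of R Y Z k X f] cx_mor_comp[of R Y Z k X g]
  by (simp add: cx_homot_def cx_mor_def comp_def)

lemma cx_homot_right: "cx_homot R Y Z f g \<Longrightarrow> cx_mor R X Y k \<Longrightarrow>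
    cx_homot R X Z (\<lambda>n x. f n (k n x)) (\<lambda>n x. g n (k n x))"
  using homotopic_comp_right[of R X Y Z f g k] cx_mor_comp[of R Y Z f X k] cx_mor_comp[of R Y Z g X k]
  by (simp add: cx_homot_def cx_mor_def comp_def)

lemma cx_qis_homot: "cx_qis R X Y f \<Longrightarrow> cx_homot R X Y f g \<Longrightarrow> cx_qis R X Y g"
  using quasi_iso_homotopic[of R X Y f g] by (simp add: cx_homot_def cx_mor_def cx_qis_def)

lemma cx_qis_cancel: "cx_qis R Y Z g \<Longrightarrow> cx_mor R X Y f \<Longrightarrow> cx_qis R X Z (\<lambda>n x. g n (f n x)) \<Longrightarrow> cx_qis R X Y f"
  using quasi_iso_cancel_left[of R X Y Z f g] by (simp add: cx_mor_def cx_qis_def comp_def)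

lemma cx_ore:
  fixes W :: "('a, 'm) cochain" and Z :: "('a, 'k) cochain" and Y :: "('a, 'l) cochain"
  assumes "cx_mor R W Y f" "cx_qis R Z Y s"
  obtains V :: "('a, 'a list set) cochain" and t h where "cx_qis R V W t" "cx_mor R V Z h"
    "cx_homot R V Y (\<lambda>n x. f n (t n x)) (\<lambda>n x. s n (h n x))"
proof -
  obtain V :: "('a, 'a list set) cochain" and t h where V: "bounded_complex R V" and t: "quasi_iso R V W t"
    and h: "chain_map R V Z h" and H: "homotopic R V Y (f \<circ>\<circ>\<circ> t) (s \<circ>\<circ>\<circ> h)"
    by (rule quasi_iso_ore[of R W Z Y f s]) (use assms in \<open>auto simp: cx_mor_def cx_qis_def\<close>)
  have t': "cx_qis R V W t" and h': "cx_mor R V Z h"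
    using assms V t h by (auto simp: cx_mor_def cx_qis_def)
  show thesis
    using that[OF t' h'] H cx_mor_comp[OF assms(1) cx_qis_mor[OF t']] cx_mor_comp[OF cx_qis_mor[OF assms(2)] h']
    by (simp add: cx_homot_def comp_def)
qed

text \<open>This is \<open>quasi_iso_cancel_null\<close> for the difference \<open>a - b\<close>.
  The map \<open>s\<close> respects that difference only on the carriers, hence the passage through
  \<open>homotopic_cong\<close>.\<close>

lemma cx_cancel:
  fixes V :: "('a, 'm) cochain" and Z :: "('a, 'k) cochain" and Y :: "('a, 'l) cochain"
  assumes a: "cx_mor R V Z a" and b: "cx_mor R V Z b" and s: "cx_qis R Z Y s"
    and H: "cx_homot R V Y (\<lambda>n x. s n (a n x)) (\<lambda>n x. s n (b n x))"
  obtains U :: "('a, 'a list set) cochain" and t where "cx_qis R U V t"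
    "cx_homot R U Z (\<lambda>n x. a n (t n x)) (\<lambda>n x. b n (t n x))"
proof -
  have V: "bounded_complex R V" and Z: "bounded_complex R Z" and Y: "bounded_complex R Y"
    and ac: "chain_map R V Z a" and bc: "chain_map R V Z b" and sq: "quasi_iso R Z Y s"
    using a b s by (auto simp: cx_mor_def cx_qis_def)
  note sc = quasi_iso_chain_map[OF sq]
  let ?d = "\<lambda>n x. a n x \<ominus>\<^bsub>obj Z n\<^esub> b n x"
  have dc: "chain_map R V Z ?d" by (rule chain_map_minus[OF V Z ac bc])
  have "homotopic R V Y (s \<circ>\<circ>\<circ> ?d) (\<lambda>n x. s n (a n x) \<ominus>\<^bsub>obj Y n\<^esub> s n (b n x))"
    by (rule homotopic_cong[OF V Y]) (use chain_map_minus[OF V Y chain_map_comp[OF ac sc] chain_map_comp[OF bc sc]] in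
      \<open>simp_all add: comp_def chain_map_props[OF Z Y sc] chain_map_props[OF V Z ac] chain_map_props[OF V Z bc]
        abelian_group_cancel bounded_complex_props[OF Z] bounded_complex_props[OF Y]\<close>)
  moreover have "homotopic R V Y (\<lambda>n x. s n (a n x) \<ominus>\<^bsub>obj Y n\<^esub> s n (b n x)) (\<lambda>n x. \<zero>\<^bsub>obj Y n\<^esub>)"
    using H homotopic_minus[OF V Y chain_map_comp[OF ac sc] chain_map_comp[OF bc sc]]
    by (simp add: cx_homot_def comp_def)
  ultimately have "homotopic R V Y (s \<circ>\<circ>\<circ> ?d) (\<lambda>n x. \<zero>\<^bsub>obj Y n\<^esub>)"
    using homotopic_trans[OF V Y chain_map_comp[OF dc sc]
      chain_map_minus[OF V Y chain_map_comp[OF ac sc] chain_map_comp[OF bc sc]] chain_map_zero[OF V Y]]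
    by (simp add: comp_def)
  from quasi_iso_cancel_null[OF V Z Y dc sq this]
  obtain U :: "('a, 'a list set) cochain" and t where U: "bounded_complex R U" and t: "quasi_iso R U V t"
    and H': "homotopic R U Z (?d \<circ>\<circ>\<circ> t) (\<lambda>n x. \<zero>\<^bsub>obj Z n\<^esub>)" .
  note tc = quasi_iso_chain_map[OF t]
  have t': "cx_qis R U V t" using U V t by (simp add: cx_qis_def)
  have "homotopic R U Z (a \<circ>\<circ>\<circ> t) (b \<circ>\<circ>\<circ> t)"
    using H' homotopic_minus[OF U Z chain_map_comp[OF tc ac] chain_map_comp[OF tc bc]] by (simp add: comp_def)
  then show thesis
    using that[OF t'] cx_mor_comp[OF a cx_qis_mor[OF t']] cx_mor_comp[OF b cx_qis_mor[OF t']]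
    by (simp add: cx_homot_def comp_def)
qed

subsection \<open>Equivalence of roofs\<close>

lemma roofs_iff:
  "bounded_complex R X \<Longrightarrow> bounded_complex R Y \<Longrightarrow>
    (W, s, f) \<in> roofs R X Y \<longleftrightarrow> cx_qis R W X s \<and> cx_mor R W Y f"
  by (auto simp: roofs_def cx_qis_def cx_mor_def)

lemma roof_equiv_iff:
  fixes X Y :: "('a, 'm) cochain"
  assumes "cx_qis R W X s" "cx_mor R W Y f" "cx_qis R W' X s'" "cx_mor R W' Y f'"
  shows "roof_equiv R X Y (W, s, f) (W', s', f') \<longleftrightarrow>
    (\<exists>(V :: ('a, 'm) cochain) u u'. cx_mor R V W u \<and> cx_mor R V W' u' \<and> cx_qis R V X (\<lambda>n x. s n (u n x)) \<and>
       cx_homot R V X (\<lambda>n x. s n (u n x)) (\<lambda>n x. s' n (u' n x)) \<and>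
       cx_homot R V Y (\<lambda>n x. f n (u n x)) (\<lambda>n x. f' n (u' n x)))"
proof -
  have b: "bounded_complex R W" "bounded_complex R W'" "bounded_complex R X" "bounded_complex R Y"
    using assms by (auto simp: cx_qis_def cx_mor_def)
  have "bounded_complex R V \<and> chain_map R V W u \<and> chain_map R V W' u' \<and> quasi_iso R V X (s \<circ>\<circ>\<circ> u) \<and>
       homotopic R V X (s \<circ>\<circ>\<circ> u) (s' \<circ>\<circ>\<circ> u') \<and> homotopic R V Y (f \<circ>\<circ>\<circ> u) (f' \<circ>\<circ>\<circ> u') \<longleftrightarrow>
     cx_mor R V W u \<and> cx_mor R V W' u' \<and> cx_qis R V X (\<lambda>n x. s n (u n x)) \<and>
       cx_homot R V X (\<lambda>n x. s n (u n x)) (\<lambda>n x. s' n (u' n x)) \<and>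
       cx_homot R V Y (\<lambda>n x. f n (u n x)) (\<lambda>n x. f' n (u' n x))" (is "?L \<longleftrightarrow> ?R")
    for V :: "('a, 'm) cochain" and u u'
  proof
    assume L: ?L
    then have u: "cx_mor R V W u" "cx_mor R V W' u'" using b by (simp_all add: cx_mor_def)
    show ?R
      using L u b cx_mor_comp[OF cx_qis_mor[OF assms(1)] u(1)] cx_mor_comp[OF assms(2) u(1)]
        cx_mor_comp[OF cx_qis_mor[OF assms(3)] u(2)] cx_mor_comp[OF assms(4) u(2)]
      by (simp add: cx_qis_def cx_homot_def comp_def)
  qed (simp add: cx_mor_def cx_qis_def cx_homot_def comp_def)
  then show ?thesis unfolding roof_equiv_def prod.case by (simp only:)
qed

lemma roof_equivI:
  fixes X Y V :: "('a, 'm) cochain"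
  assumes "cx_qis R W X s" "cx_mor R W Y f" "cx_qis R W' X s'" "cx_mor R W' Y f'"
    and "cx_qis R V W u" "cx_mor R V W' u'"
    and "cx_homot R V X (\<lambda>n x. s n (u n x)) (\<lambda>n x. s' n (u' n x))"
    and "cx_homot R V Y (\<lambda>n x. f n (u n x)) (\<lambda>n x. f' n (u' n x))"
  shows "roof_equiv R X Y (W, s, f) (W', s', f')"
  unfolding roof_equiv_iff[OF assms(1-4)]
  using assms(5-) cx_qis_mor[OF assms(5)] cx_qis_comp[OF assms(1) assms(5)] by blast

text \<open>The composite \<open>s u\<close> is a quasi-isomorphism by definition and
  \<open>s' u'\<close> is homotopic to it, so two out of three makes both legs of the common
  refinement quasi-isomorphisms.\<close>

lemma roof_equivE:
  fixes X Y :: "('a, 'm) cochain"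
  assumes "cx_qis R W X s" "cx_mor R W Y f" "cx_qis R W' X s'" "cx_mor R W' Y f'"
    and "roof_equiv R X Y (W, s, f) (W', s', f')"
  obtains V :: "('a, 'm) cochain" and u u' where "cx_qis R V W u" "cx_qis R V W' u'"
    "cx_homot R V X (\<lambda>n x. s n (u n x)) (\<lambda>n x. s' n (u' n x))"
    "cx_homot R V Y (\<lambda>n x. f n (u n x)) (\<lambda>n x. f' n (u' n x))"
proof -
  from assms(5)[unfolded roof_equiv_iff[OF assms(1-4)]]
  obtain V :: "('a, 'm) cochain" and u u' where *: "cx_mor R V W u" "cx_mor R V W' u'"
    "cx_qis R V X (\<lambda>n x. s n (u n x))"
    "cx_homot R V X (\<lambda>n x. s n (u n x)) (\<lambda>n x. s' n (u' n x))"
    "cx_homot R V Y (\<lambda>n x. f n (u n x)) (\<lambda>n x. f' n (u' n x))" by blast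
  show thesis
    by (rule that[OF cx_qis_cancel[OF assms(1) *(1,3)]
          cx_qis_cancel[OF assms(3) *(2) cx_qis_homot[OF *(3,4)]] *(4,5)])
qed

lemma roof_equiv_refl:
  "cx_qis R W X s \<Longrightarrow> cx_mor R W Y f \<Longrightarrow> roof_equiv R X Y (W, s, f) (W, s, f)"
  by (rule roof_equivI[where V = W and u = "\<lambda>n x. x" and u' = "\<lambda>n x. x"])
    (auto intro: cx_qis_id cx_mor_id cx_homot_refl cx_qis_mor simp: cx_mor_def[of R W Y])

lemma roof_equiv_sym:
  assumes "cx_qis R W X s" "cx_mor R W Y f" "cx_qis R W' X s'" "cx_mor R W' Y f'"
    and "roof_equiv R X Y (W, s, f) (W', s', f')"
  shows "roof_equiv R X Y (W', s', f') (W, s, f)"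
  by (rule roof_equivE[OF assms])
    (rule roof_equivI[OF assms(3,4,1,2)]; (assumption | rule cx_qis_mor cx_homot_sym; assumption))

text \<open>The two given refinements meet over \<open>W'\<close>, and an Ore square over
  \<open>W'\<close> dominates both. The type is now fixed: \<open>cx_ore\<close> delivers its
  complex on \<open>'a list set\<close>, and \<open>roof_equiv\<close> asks for a refinement on the
  type of \<open>X\<close> and \<open>Y\<close>.\<close>

lemma roof_equiv_trans:
  fixes X Y :: "('a, 'a list set) cochain"
  assumes 1: "cx_qis R W X s" "cx_mor R W Y f" and 2: "cx_qis R W' X s'" "cx_mor R W' Y f'"
    and 3: "cx_qis R W'' X s''" "cx_mor R W'' Y f''"
    and 12: "roof_equiv R X Y (W, s, f) (W', s', f')" and 23: "roof_equiv R X Y (W', s', f') (W'', s'', f'')"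
  shows "roof_equiv R X Y (W, s, f) (W'', s'', f'')"
proof -
  obtain V :: "('a, 'a list set) cochain" and u u' where V: "cx_qis R V W u" "cx_qis R V W' u'"
    "cx_homot R V X (\<lambda>n x. s n (u n x)) (\<lambda>n x. s' n (u' n x))"
    "cx_homot R V Y (\<lambda>n x. f n (u n x)) (\<lambda>n x. f' n (u' n x))"
    by (rule roof_equivE[OF 1 2 12])
  obtain V2 :: "('a, 'a list set) cochain" and v v' where V2: "cx_qis R V2 W' v" "cx_qis R V2 W'' v'"
    "cx_homot R V2 X (\<lambda>n x. s' n (v n x)) (\<lambda>n x. s'' n (v' n x))"
    "cx_homot R V2 Y (\<lambda>n x. f' n (v n x)) (\<lambda>n x. f'' n (v' n x))"
    by (rule roof_equivE[OF 2 3 23])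
  obtain T :: "('a, 'a list set) cochain" and t h where T: "cx_qis R T V t" "cx_mor R T V2 h"
    "cx_homot R T W' (\<lambda>n x. u' n (t n x)) (\<lambda>n x. v n (h n x))"
    by (rule cx_ore[OF cx_qis_mor[OF V(2)] V2(1)])
  note tc = cx_qis_mor[OF T(1)]
  show ?thesis
  proof (rule roof_equivI[OF 1 3 cx_qis_comp[OF V(1) T(1)] cx_mor_comp[OF cx_qis_mor[OF V2(2)] T(2)]])
    show "cx_homot R T X (\<lambda>n x. s n (u n (t n x))) (\<lambda>n x. s'' n (v' n (h n x)))"
      by (rule cx_homot_trans[OF cx_homot_right[OF V(3) tc]
            cx_homot_trans[OF cx_homot_left[OF cx_qis_mor[OF 2(1)] T(3)] cx_homot_right[OF V2(3) T(2)]]])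
    show "cx_homot R T Y (\<lambda>n x. f n (u n (t n x))) (\<lambda>n x. f'' n (v' n (h n x)))"
      by (rule cx_homot_trans[OF cx_homot_right[OF V(4) tc]
            cx_homot_trans[OF cx_homot_left[OF 2(2) T(3)] cx_homot_right[OF V2(4) T(2)]]])
  qed
qed

lemma roof_class_eq_iff:
  fixes X Y :: "('a, 'a list set) cochain"
  assumes 1: "cx_qis R W X s" "cx_mor R W Y f" and 2: "cx_qis R W' X s'" "cx_mor R W' Y f'"
  shows "roof_class R X Y (W, s, f) = roof_class R X Y (W', s', f') \<longleftrightarrow> roof_equiv R X Y (W, s, f) (W', s', f')"
proof -
  have b: "bounded_complex R X" "bounded_complex R Y" using assms by (auto simp: cx_qis_def cx_mor_def)
  show ?thesis
  proof
    assume "roof_class R X Y (W, s, f) = roof_class R X Y (W', s', f')"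
    moreover have "(W', s', f') \<in> roof_class R X Y (W', s', f')"
      using roof_equiv_refl[OF 2] 2 by (simp add: roof_class_def roofs_iff[OF b])
    ultimately show "roof_equiv R X Y (W, s, f) (W', s', f')" by (auto simp: roof_class_def)
  next
    assume e: "roof_equiv R X Y (W, s, f) (W', s', f')"
    note e' = roof_equiv_sym[OF 1 2 e]
    have "roof_equiv R X Y (W, s, f) r \<longleftrightarrow> roof_equiv R X Y (W', s', f') r" if r: "r \<in> roofs R X Y" for r
    proof -
      obtain W2 s2 f2 where re: "r = (W2, s2, f2)" by (cases r)
      have q: "cx_qis R W2 X s2" "cx_mor R W2 Y f2" using r by (simp_all add: re roofs_iff[OF b])
      show ?thesis unfolding re using roof_equiv_trans[OF 2 1 q e'] roof_equiv_trans[OF 1 2 q e] by blast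
    qed
    then show "roof_class R X Y (W, s, f) = roof_class R X Y (W', s', f')"
      by (auto simp: roof_class_def)
  qed
qed

subsection \<open>Composition\<close>

text \<open>Over a common refinement of \<open>V1\<close> and \<open>V2\<close> the two maps to
  \<open>W'\<close> agree only after composition with \<open>s'\<close>. As \<open>s'\<close> is a
  quasi-isomorphism, \<open>cx_cancel\<close> removes it on a further refinement.\<close>

lemma completion_unique:
  fixes X Y Z :: "('a, 'a list set) cochain"
  assumes r: "cx_qis R W X s" "cx_mor R W Y f" and r': "cx_qis R W' Y s'" "cx_mor R W' Z g"
    and 1: "cx_qis R V1 W t1" "cx_mor R V1 W' h1" "cx_homot R V1 Y (\<lambda>n x. f n (t1 n x)) (\<lambda>n x. s' n (h1 n x))"
    and 2: "cx_qis R V2 W t2" "cx_mor R V2 W' h2" "cx_homot R V2 Y (\<lambda>n x. f n (t2 n x)) (\<lambda>n x. s' n (h2 n x))"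
  shows "roof_equiv R X Z (V1, \<lambda>n x. s n (t1 n x), \<lambda>n x. g n (h1 n x)) (V2, \<lambda>n x. s n (t2 n x), \<lambda>n x. g n (h2 n x))"
proof -
  obtain T :: "('a, 'a list set) cochain" and x1 x2 where T: "cx_qis R T V1 x1" "cx_mor R T V2 x2"
    "cx_homot R T W (\<lambda>n x. t1 n (x1 n x)) (\<lambda>n x. t2 n (x2 n x))"
    by (rule cx_ore[OF cx_qis_mor[OF 1(1)] 2(1)])
  note x1 = cx_qis_mor[OF T(1)]
  have "cx_homot R T Y (\<lambda>n x. s' n (h1 n (x1 n x))) (\<lambda>n x. s' n (h2 n (x2 n x)))"
    by (rule cx_homot_trans[OF cx_homot_sym[OF cx_homot_right[OF 1(3) x1]]
          cx_homot_trans[OF cx_homot_left[OF r(2) T(3)] cx_homot_right[OF 2(3) T(2)]]])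
  from cx_cancel[OF cx_mor_comp[OF 1(2) x1] cx_mor_comp[OF 2(2) T(2)] r'(1) this]
  obtain U :: "('a, 'a list set) cochain" and y where U: "cx_qis R U T y"
    "cx_homot R U W' (\<lambda>n x. h1 n (x1 n (y n x))) (\<lambda>n x. h2 n (x2 n (y n x)))" .
  note y = cx_qis_mor[OF U(1)]
  show ?thesis
    by (rule roof_equivI[OF cx_qis_comp[OF r(1) 1(1)] cx_mor_comp[OF r'(2) 1(2)]
          cx_qis_comp[OF r(1) 2(1)] cx_mor_comp[OF r'(2) 2(2)] cx_qis_comp[OF T(1) U(1)] cx_mor_comp[OF T(2) y]
          cx_homot_left[OF cx_qis_mor[OF r(1)] cx_homot_right[OF T(3) y]] cx_homot_left[OF r'(2) U(2)]])
qed

text \<open>Take common refinements \<open>A\<close> and \<open>B\<close> of the two pairs of roofs.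
  One Ore square \<open>V\<close> over them completes both pairs, and
  \<open>completion_unique\<close> compares it with the given completion on either side.\<close>

lemma completion_equiv:
  fixes X Y Z :: "('a, 'a list set) cochain"
  assumes r1: "cx_qis R W1 X s1" "cx_mor R W1 Y f1" and r2: "cx_qis R W2 X s2" "cx_mor R W2 Y f2"
    and r: "roof_equiv R X Y (W1, s1, f1) (W2, s2, f2)"
    and r1': "cx_qis R W1' Y s1'" "cx_mor R W1' Z g1" and r2': "cx_qis R W2' Y s2'" "cx_mor R W2' Z g2"
    and r': "roof_equiv R Y Z (W1', s1', g1) (W2', s2', g2)"
    and 1: "cx_qis R V1 W1 t1" "cx_mor R V1 W1' h1" "cx_homot R V1 Y (\<lambda>n x. f1 n (t1 n x)) (\<lambda>n x. s1' n (h1 n x))"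
    and 2: "cx_qis R V2 W2 t2" "cx_mor R V2 W2' h2" "cx_homot R V2 Y (\<lambda>n x. f2 n (t2 n x)) (\<lambda>n x. s2' n (h2 n x))"
  shows "roof_equiv R X Z (V1, \<lambda>n x. s1 n (t1 n x), \<lambda>n x. g1 n (h1 n x))
    (V2, \<lambda>n x. s2 n (t2 n x), \<lambda>n x. g2 n (h2 n x))"
proof -
  obtain A :: "('a, 'a list set) cochain" and u1 u2 where A: "cx_qis R A W1 u1" "cx_qis R A W2 u2"
    "cx_homot R A X (\<lambda>n x. s1 n (u1 n x)) (\<lambda>n x. s2 n (u2 n x))"
    "cx_homot R A Y (\<lambda>n x. f1 n (u1 n x)) (\<lambda>n x. f2 n (u2 n x))"
    by (rule roof_equivE[OF r1 r2 r])
  obtain B :: "('a, 'a list set) cochain" and v1 v2 where B: "cx_qis R B W1' v1" "cx_qis R B W2' v2"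
    "cx_homot R B Y (\<lambda>n x. s1' n (v1 n x)) (\<lambda>n x. s2' n (v2 n x))"
    "cx_homot R B Z (\<lambda>n x. g1 n (v1 n x)) (\<lambda>n x. g2 n (v2 n x))"
    by (rule roof_equivE[OF r1' r2' r'])
  obtain V :: "('a, 'a list set) cochain" and t h where V: "cx_qis R V A t" "cx_mor R V B h"
    "cx_homot R V Y (\<lambda>n x. f1 n (u1 n (t n x))) (\<lambda>n x. s1' n (v1 n (h n x)))"
    by (rule cx_ore[OF cx_mor_comp[OF r1(2) cx_qis_mor[OF A(1)]] cx_qis_comp[OF r1'(1) B(1)]])
  note tc = cx_qis_mor[OF V(1)] and qt1 = cx_qis_comp[OF A(1) V(1)] and qt2 = cx_qis_comp[OF A(2) V(1)]
  note mh1 = cx_mor_comp[OF cx_qis_mor[OF B(1)] V(2)] and mh2 = cx_mor_comp[OF cx_qis_mor[OF B(2)] V(2)]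
  have V2: "cx_homot R V Y (\<lambda>n x. f2 n (u2 n (t n x))) (\<lambda>n x. s2' n (v2 n (h n x)))"
    by (rule cx_homot_trans[OF cx_homot_sym[OF cx_homot_right[OF A(4) tc]]
          cx_homot_trans[OF V(3) cx_homot_right[OF B(3) V(2)]]])
  have e1: "roof_equiv R X Z (V1, \<lambda>n x. s1 n (t1 n x), \<lambda>n x. g1 n (h1 n x))
    (V, \<lambda>n x. s1 n (u1 n (t n x)), \<lambda>n x. g1 n (v1 n (h n x)))"
    by (rule completion_unique[OF r1 r1' 1 qt1 mh1 V(3)])
  have e2: "roof_equiv R X Z (V, \<lambda>n x. s2 n (u2 n (t n x)), \<lambda>n x. g2 n (v2 n (h n x)))
    (V2, \<lambda>n x. s2 n (t2 n x), \<lambda>n x. g2 n (h2 n x))"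
    by (rule completion_unique[OF r2 r2' qt2 mh2 V2 2])
  have V': "bounded_complex R V" using V by (simp add: cx_qis_def)
  have e12: "roof_equiv R X Z (V, \<lambda>n x. s1 n (u1 n (t n x)), \<lambda>n x. g1 n (v1 n (h n x)))
    (V, \<lambda>n x. s2 n (u2 n (t n x)), \<lambda>n x. g2 n (v2 n (h n x)))"
    by (rule roof_equivI[OF cx_qis_comp[OF r1(1) qt1] cx_mor_comp[OF r1'(2) mh1]
          cx_qis_comp[OF r2(1) qt2] cx_mor_comp[OF r2'(2) mh2] cx_qis_id[OF V'] cx_mor_id[OF V']
          cx_homot_right[OF A(3) tc] cx_homot_right[OF B(4) V(2)]])
  note q1 = cx_qis_comp[OF r1(1) qt1] cx_mor_comp[OF r1'(2) mh1]
    and q2 = cx_qis_comp[OF r2(1) qt2] cx_mor_comp[OF r2'(2) mh2]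
    and p1 = cx_qis_comp[OF r1(1) 1(1)] cx_mor_comp[OF r1'(2) 1(2)]
    and p2 = cx_qis_comp[OF r2(1) 2(1)] cx_mor_comp[OF r2'(2) 2(2)]
  show ?thesis
    by (rule roof_equiv_trans[OF p1 q1 p2 e1 roof_equiv_trans[OF q1 q2 p2 e12 e2]])
qed

section \<open>Morphisms of the derived category\<close>

definition D_mor :: "('a, 'r) ring_scheme \<Rightarrow> ('a, 'm) cochain \<Rightarrow> ('a, 'm) cochain \<Rightarrow> ('a, 'm) cochain \<Rightarrow>
    (int \<Rightarrow> 'm \<Rightarrow> 'm) \<Rightarrow> (int \<Rightarrow> 'm \<Rightarrow> 'm) \<Rightarrow> ('a, 'm) dmor" where
  "D_mor R X Y W s f = (X, Y, roof_class R X Y (W, s, f))"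

lemma D_mor_eq_iff:
  fixes X Y :: "('a, 'a list set) cochain"
  assumes "cx_qis R W X s" "cx_mor R W Y f" "cx_qis R W' X s'" "cx_mor R W' Y f'"
  shows "D_mor R X Y W s f = D_mor R X Y W' s' f' \<longleftrightarrow> roof_equiv R X Y (W, s, f) (W', s', f')"
  by (simp add: D_mor_def roof_class_eq_iff[OF assms])

text \<open>\<open>D_comp\<close> unites the classes obtained from all representatives and all
  completions. By \<open>completion_equiv\<close> these classes coincide, so any single completion
  computes the composite.\<close>

lemma D_comp_mor:
  fixes X Y Z :: "('a, 'a list set) cochain"
  assumes r: "cx_qis R W X s" "cx_mor R W Y f" and r': "cx_qis R W' Y s'" "cx_mor R W' Z g"
    and c: "cx_qis R V W t" "cx_mor R V W' h" "cx_homot R V Y (\<lambda>n x. f n (t n x)) (\<lambda>n x. s' n (h n x))"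
  shows "D_comp R (D_mor R Y Z W' s' g) (D_mor R X Y W s f) =
    D_mor R X Z V (\<lambda>n x. s n (t n x)) (\<lambda>n x. g n (h n x))"
proof -
  have b: "bounded_complex R X" "bounded_complex R Y" "bounded_complex R Z"
    using r r' by (auto simp: cx_qis_def cx_mor_def)
  let ?C = "roof_class R X Z (V, \<lambda>n x. s n (t n x), \<lambda>n x. g n (h n x))"
  let ?S = "{roof_class R X Z (V2, s2 \<circ>\<circ>\<circ> t2, g2 \<circ>\<circ>\<circ> h2) |W2 s2 f2 W2' s2' g2 V2 t2 h2.
        (W2, s2, f2) \<in> roof_class R X Y (W, s, f) \<and> (W2', s2', g2) \<in> roof_class R Y Z (W', s', g) \<and>
        bounded_complex R V2 \<and> quasi_iso R V2 W2 t2 \<and> chain_map R V2 W2' h2 \<and>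
        homotopic R V2 Y (f2 \<circ>\<circ>\<circ> t2) (s2' \<circ>\<circ>\<circ> h2)}"
  have "A = ?C" if "A \<in> ?S" for A
  proof -
    from that obtain W2 s2 f2 W2' s2' g2 V2 t2 h2 where A: "A = roof_class R X Z (V2, s2 \<circ>\<circ>\<circ> t2, g2 \<circ>\<circ>\<circ> h2)"
      and w: "(W2, s2, f2) \<in> roof_class R X Y (W, s, f)" and w': "(W2', s2', g2) \<in> roof_class R Y Z (W', s', g)"
      and V2: "bounded_complex R V2" "quasi_iso R V2 W2 t2" "chain_map R V2 W2' h2"
        "homotopic R V2 Y (f2 \<circ>\<circ>\<circ> t2) (s2' \<circ>\<circ>\<circ> h2)" by blast
    have r2: "cx_qis R W2 X s2" "cx_mor R W2 Y f2" and e: "roof_equiv R X Y (W, s, f) (W2, s2, f2)"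
      using w by (simp_all add: roof_class_def roofs_iff[OF b(1,2)])
    have r2': "cx_qis R W2' Y s2'" "cx_mor R W2' Z g2" and e': "roof_equiv R Y Z (W', s', g) (W2', s2', g2)"
      using w' by (simp_all add: roof_class_def roofs_iff[OF b(2,3)])
    have t2: "cx_qis R V2 W2 t2" and h2: "cx_mor R V2 W2' h2"
      using V2 r2 r2' by (simp_all add: cx_qis_def cx_mor_def)
    have H2: "cx_homot R V2 Y (\<lambda>n x. f2 n (t2 n x)) (\<lambda>n x. s2' n (h2 n x))"
      using V2(4) cx_mor_comp[OF r2(2) cx_qis_mor[OF t2]] cx_mor_comp[OF cx_qis_mor[OF r2'(1)] h2]
      by (simp add: cx_homot_def comp_def)
    show ?thesis
      using roof_class_eq_iff[OF cx_qis_comp[OF r(1) c(1)] cx_mor_comp[OF r'(2) c(2)]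
          cx_qis_comp[OF r2(1) t2] cx_mor_comp[OF r2'(2) h2]]
        completion_equiv[OF r r2 e r' r2' e' c t2 h2 H2]
      by (simp add: A comp_def)
  qed
  moreover have "?C \<in> ?S"
  proof -
    have "(W, s, f) \<in> roof_class R X Y (W, s, f)"
      using roof_equiv_refl[OF r] r by (simp add: roof_class_def roofs_iff[OF b(1,2)])
    moreover have "(W', s', g) \<in> roof_class R Y Z (W', s', g)"
      using roof_equiv_refl[OF r'] r' by (simp add: roof_class_def roofs_iff[OF b(2,3)])
    moreover have "bounded_complex R V" "quasi_iso R V W t" "chain_map R V W' h"
        "homotopic R V Y (f \<circ>\<circ>\<circ> t) (s' \<circ>\<circ>\<circ> h)"
      using c by (simp_all add: cx_qis_def cx_mor_def cx_homot_def comp_def)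
    moreover have "?C = roof_class R X Z (V, s \<circ>\<circ>\<circ> t, g \<circ>\<circ>\<circ> h)" by (simp add: comp_def)
    ultimately show ?thesis by blast
  qed
  ultimately have "?S = {?C}" by blast
  then show ?thesis by (simp add: D_comp_def D_mor_def)
qed

lemma D_hom_iff:
  assumes "bounded_complex R X" "bounded_complex R Y"
  shows "\<phi> \<in> D_hom R X Y \<longleftrightarrow> (\<exists>W s f. cx_qis R W X s \<and> cx_mor R W Y f \<and> \<phi> = D_mor R X Y W s f)"
proof
  assume "\<phi> \<in> D_hom R X Y"
  then obtain r where "r \<in> roofs R X Y" "\<phi> = (X, Y, roof_class R X Y r)" by (auto simp: D_hom_def)
  then show "\<exists>W s f. cx_qis R W X s \<and> cx_mor R W Y f \<and> \<phi> = D_mor R X Y W s f"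
    by (cases r) (auto simp: D_mor_def roofs_iff[OF assms])
next
  assume "\<exists>W s f. cx_qis R W X s \<and> cx_mor R W Y f \<and> \<phi> = D_mor R X Y W s f"
  then obtain W s f where "(W, s, f) \<in> roofs R X Y" "\<phi> = D_mor R X Y W s f" by (auto simp: roofs_iff[OF assms])
  then show "\<phi> \<in> D_hom R X Y" unfolding D_hom_def D_mor_def by blast
qed

lemma D_homE:
  assumes "bounded_complex R X" "bounded_complex R Y" "\<phi> \<in> D_hom R X Y"
  obtains W s f where "cx_qis R W X s" "cx_mor R W Y f" "\<phi> = D_mor R X Y W s f"
  using assms(3) unfolding D_hom_iff[OF assms(1,2)] by blast

lemma D_mor_hom: "cx_qis R W X s \<Longrightarrow> cx_mor R W Y f \<Longrightarrow> D_mor R X Y W s f \<in> D_hom R X Y"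
  by (subst D_hom_iff) (auto simp: cx_qis_def cx_mor_def)

lemma D_of_mor: "D_of R X Y f = D_mor R X Y X (\<lambda>n x. x) f"
  by (simp add: D_of_def D_mor_def)

lemma D_of_hom: "cx_mor R X Y f \<Longrightarrow> D_of R X Y f \<in> D_hom R X Y"
  unfolding D_of_mor by (rule D_mor_hom) (auto intro: cx_qis_id simp: cx_mor_def)

lemma D_comp_hom:
  fixes X Y Z :: "('a, 'a list set) cochain"
  assumes b: "bounded_complex R X" "bounded_complex R Y" "bounded_complex R Z"
    and \<phi>: "\<phi> \<in> D_hom R X Y" and \<psi>: "\<psi> \<in> D_hom R Y Z"
  shows "D_comp R \<psi> \<phi> \<in> D_hom R X Z"
proof -
  obtain W s f where r: "cx_qis R W X s" "cx_mor R W Y f" "\<phi> = D_mor R X Y W s f"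
    by (rule D_homE[OF b(1,2) \<phi>])
  obtain W' s' g where r': "cx_qis R W' Y s'" "cx_mor R W' Z g" "\<psi> = D_mor R Y Z W' s' g"
    by (rule D_homE[OF b(2,3) \<psi>])
  obtain V :: "('a, 'a list set) cochain" and t h where c: "cx_qis R V W t" "cx_mor R V W' h"
    "cx_homot R V Y (\<lambda>n x. f n (t n x)) (\<lambda>n x. s' n (h n x))"
    by (rule cx_ore[OF r(2) r'(1)])
  show ?thesis unfolding r(3) r'(3) D_comp_mor[OF r(1,2) r'(1,2) c]
    by (rule D_mor_hom[OF cx_qis_comp[OF r(1) c(1)] cx_mor_comp[OF r'(2) c(2)]])
qed

text \<open>Two Ore squares for the adjacent pairs and a third one on top of them give a complex
  \<open>T\<close> on which both bracketings are represented by the same roof.\<close>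

lemma D_comp_assoc:
  fixes X Y Z U :: "('a, 'a list set) cochain"
  assumes b: "bounded_complex R X" "bounded_complex R Y" "bounded_complex R Z" "bounded_complex R U"
    and \<phi>: "\<phi> \<in> D_hom R X Y" and \<psi>: "\<psi> \<in> D_hom R Y Z" and \<chi>: "\<chi> \<in> D_hom R Z U"
  shows "D_comp R (D_comp R \<chi> \<psi>) \<phi> = D_comp R \<chi> (D_comp R \<psi> \<phi>)"
proof -
  obtain W1 s1 f1 where 1: "cx_qis R W1 X s1" "cx_mor R W1 Y f1" "\<phi> = D_mor R X Y W1 s1 f1"
    by (rule D_homE[OF b(1,2) \<phi>])
  obtain W2 s2 f2 where 2: "cx_qis R W2 Y s2" "cx_mor R W2 Z f2" "\<psi> = D_mor R Y Z W2 s2 f2"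
    by (rule D_homE[OF b(2,3) \<psi>])
  obtain W3 s3 f3 where 3: "cx_qis R W3 Z s3" "cx_mor R W3 U f3" "\<chi> = D_mor R Z U W3 s3 f3"
    by (rule D_homE[OF b(3,4) \<chi>])
  obtain V :: "('a, 'a list set) cochain" and t h where V: "cx_qis R V W1 t" "cx_mor R V W2 h"
    "cx_homot R V Y (\<lambda>n x. f1 n (t n x)) (\<lambda>n x. s2 n (h n x))"
    by (rule cx_ore[OF 1(2) 2(1)])
  obtain V' :: "('a, 'a list set) cochain" and t' h' where V': "cx_qis R V' W2 t'" "cx_mor R V' W3 h'"
    "cx_homot R V' Z (\<lambda>n x. f2 n (t' n x)) (\<lambda>n x. s3 n (h' n x))"
    by (rule cx_ore[OF 2(2) 3(1)])
  obtain T :: "('a, 'a list set) cochain" and x y where T: "cx_qis R T V x" "cx_mor R T V' y"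
    "cx_homot R T W2 (\<lambda>n v. h n (x n v)) (\<lambda>n v. t' n (y n v))"
    by (rule cx_ore[OF V(2) V'(1)])
  note xc = cx_qis_mor[OF T(1)]
  have L: "cx_homot R T Y (\<lambda>n v. f1 n (t n (x n v))) (\<lambda>n v. s2 n (t' n (y n v)))"
    by (rule cx_homot_trans[OF cx_homot_right[OF V(3) xc] cx_homot_left[OF cx_qis_mor[OF 2(1)] T(3)]])
  have M: "cx_homot R T Z (\<lambda>n v. f2 n (h n (x n v))) (\<lambda>n v. s3 n (h' n (y n v)))"
    by (rule cx_homot_trans[OF cx_homot_left[OF 2(2) T(3)] cx_homot_right[OF V'(3) T(2)]])
  have "D_comp R (D_comp R \<chi> \<psi>) \<phi> = D_mor R X U T (\<lambda>n v. s1 n (t n (x n v))) (\<lambda>n v. f3 n (h' n (y n v)))"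
    unfolding 1(3) 2(3) 3(3) D_comp_mor[OF 2(1,2) 3(1,2) V']
    by (rule D_comp_mor[OF 1(1,2) cx_qis_comp[OF 2(1) V'(1)] cx_mor_comp[OF 3(2) V'(2)]
          cx_qis_comp[OF V(1) T(1)] T(2) L])
  moreover have "D_comp R \<chi> (D_comp R \<psi> \<phi>) = D_mor R X U T (\<lambda>n v. s1 n (t n (x n v))) (\<lambda>n v. f3 n (h' n (y n v)))"
    unfolding 1(3) 2(3) 3(3) D_comp_mor[OF 1(1,2) 2(1,2) V]
    by (rule D_comp_mor[OF cx_qis_comp[OF 1(1) V(1)] cx_mor_comp[OF 2(2) V(2)] 3(1,2)
          T(1) cx_mor_comp[OF V'(2) T(2)] M])
  ultimately show ?thesis by simp
qed

lemma D_comp_of_right: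
  fixes X Y Z :: "('a, 'a list set) cochain"
  assumes f: "cx_mor R X Y f" and r: "cx_qis R W Y s" "cx_mor R W Z g"
    and c: "cx_qis R V X t" "cx_mor R V W h" "cx_homot R V Y (\<lambda>n x. f n (t n x)) (\<lambda>n x. s n (h n x))"
  shows "D_comp R (D_mor R Y Z W s g) (D_of R X Y f) = D_mor R X Z V t (\<lambda>n x. g n (h n x))"
proof -
  have "bounded_complex R X" using f by (simp add: cx_mor_def)
  from D_comp_mor[OF cx_qis_id[OF this] f r c] show ?thesis by (simp add: D_of_mor)
qed

lemma D_comp_of_left:
  fixes X Y Z :: "('a, 'a list set) cochain"
  assumes r: "cx_qis R W X s" "cx_mor R W Y f" and g: "cx_mor R Y Z g"
  shows "D_comp R (D_of R Y Z g) (D_mor R X Y W s f) = D_mor R X Z W s (\<lambda>n x. g n (f n x))"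
proof -
  have b: "bounded_complex R Y" "bounded_complex R W" using g r by (simp_all add: cx_mor_def cx_qis_def)
  show ?thesis
    unfolding D_of_mor by (rule D_comp_mor[OF r cx_qis_id[OF b(1)] g cx_qis_id[OF b(2)] r(2) cx_homot_refl[OF r(2)]])
qed

lemma D_of_homot:
  fixes X Y :: "('a, 'a list set) cochain"
  assumes "cx_homot R X Y f g"
  shows "D_of R X Y f = D_of R X Y g"
proof -
  have b: "bounded_complex R X" and f: "cx_mor R X Y f" and g: "cx_mor R X Y g"
    using assms by (simp_all add: cx_homot_def cx_mor_def)
  note i = cx_qis_id[OF b] and ic = cx_mor_id[OF b]
  show ?thesis unfolding D_of_mor D_mor_eq_iff[OF i f i g]
    by (rule roof_equivI[OF i f i g i ic cx_homot_refl[OF ic] assms])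
qed

lemma D_comp_id:
  fixes X Y :: "('a, 'a list set) cochain"
  assumes b: "bounded_complex R X" "bounded_complex R Y" and \<phi>: "\<phi> \<in> D_hom R X Y"
  shows "D_comp R \<phi> (D_of R X X (\<lambda>n x. x)) = \<phi>" and "D_comp R (D_of R Y Y (\<lambda>n x. x)) \<phi> = \<phi>"
proof -
  obtain W s f where r: "cx_qis R W X s" "cx_mor R W Y f" "\<phi> = D_mor R X Y W s f"
    by (rule D_homE[OF b \<phi>])
  have W: "bounded_complex R W" using r by (simp add: cx_mor_def)
  show "D_comp R \<phi> (D_of R X X (\<lambda>n x. x)) = \<phi>" unfolding r(3)
    by (rule D_comp_of_right[OF cx_mor_id[OF b(1)] r(1,2) r(1) cx_mor_id[OF W] cx_homot_refl[OF cx_qis_mor[OF r(1)]]])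
  show "D_comp R (D_of R Y Y (\<lambda>n x. x)) \<phi> = \<phi>" unfolding r(3)
    by (rule D_comp_of_left[OF r(1,2) cx_mor_id[OF b(2)]])
qed

text \<open>The zero morphism is represented with apex \<open>X\<close>, so in a comparison its leg
  may be chosen as \<open>s t\<close>. The condition on the left legs is then empty and only the
  null homotopy remains.\<close>

lemma D_mor_zero_iff:
  fixes X Y :: "('a, 'a list set) cochain"
  assumes r: "cx_qis R W X s" "cx_mor R W Y f"
  shows "D_mor R X Y W s f = D_zero R X Y \<longleftrightarrow>
    (\<exists>(V :: ('a, 'a list set) cochain) t. cx_qis R V W t \<and> cx_homot R V Y (\<lambda>n x. f n (t n x)) (\<lambda>n x. \<zero>\<^bsub>obj Y n\<^esub>))"
proof -
  have b: "bounded_complex R X" "bounded_complex R Y" using r by (simp_all add: cx_mor_def cx_qis_def)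
  note i = cx_qis_id[OF b(1)] and z = cx_mor_zero[OF b]
  have *: "D_mor R X Y W s f = D_zero R X Y \<longleftrightarrow> roof_equiv R X Y (W, s, f) (X, \<lambda>n x. x, \<lambda>n x. \<zero>\<^bsub>obj Y n\<^esub>)"
    unfolding D_zero_def D_of_mor by (rule D_mor_eq_iff[OF r i z])
  show ?thesis
  proof
    assume "D_mor R X Y W s f = D_zero R X Y"
    then have e: "roof_equiv R X Y (W, s, f) (X, \<lambda>n x. x, \<lambda>n x. \<zero>\<^bsub>obj Y n\<^esub>)" by (simp only: *)
    show "\<exists>(V :: ('a, 'a list set) cochain) t. cx_qis R V W t \<and> cx_homot R V Y (\<lambda>n x. f n (t n x)) (\<lambda>n x. \<zero>\<^bsub>obj Y n\<^esub>)"
      by (rule roof_equivE[OF r i z e]) blast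
  next
    assume "\<exists>(V :: ('a, 'a list set) cochain) t. cx_qis R V W t \<and> cx_homot R V Y (\<lambda>n x. f n (t n x)) (\<lambda>n x. \<zero>\<^bsub>obj Y n\<^esub>)"
    then obtain V :: "('a, 'a list set) cochain" and t where t: "cx_qis R V W t"
      "cx_homot R V Y (\<lambda>n x. f n (t n x)) (\<lambda>n x. \<zero>\<^bsub>obj Y n\<^esub>)" by blast
    note st = cx_mor_comp[OF cx_qis_mor[OF r(1)] cx_qis_mor[OF t(1)]]
    show "D_mor R X Y W s f = D_zero R X Y" unfolding *
      by (rule roof_equivI[OF r i z t(1) st cx_homot_refl[OF st] t(2)])
  qed
qed

lemma D_comp_zero:
  fixes X Y Z :: "('a, 'a list set) cochain"
  assumes b: "bounded_complex R X" "bounded_complex R Y" "bounded_complex R Z"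
  shows "\<phi> \<in> D_hom R Y Z \<Longrightarrow> D_comp R \<phi> (D_zero R X Y) = D_zero R X Z"
    and "\<phi> \<in> D_hom R X Y \<Longrightarrow> D_comp R (D_zero R Y Z) \<phi> = D_zero R X Z"
proof -
  assume \<phi>: "\<phi> \<in> D_hom R Y Z"
  obtain W s f where r: "cx_qis R W Y s" "cx_mor R W Z f" "\<phi> = D_mor R Y Z W s f"
    by (rule D_homE[OF b(2,3) \<phi>])
  have W: "bounded_complex R W" using r by (simp add: cx_mor_def)
  have "cx_homot R X Y (\<lambda>n x. \<zero>\<^bsub>obj Y n\<^esub>) (\<lambda>n x. s n \<zero>\<^bsub>obj W n\<^esub>)"
    using cx_homot_refl[OF cx_mor_zero[OF b(1,2)]] by (simp add: cx_mor_map_zero[OF cx_qis_mor[OF r(1)]])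
  from D_comp_of_right[OF cx_mor_zero[OF b(1,2)] r(1,2) cx_qis_id[OF b(1)] cx_mor_zero[OF b(1) W] this]
  show "D_comp R \<phi> (D_zero R X Y) = D_zero R X Z"
    unfolding r(3) D_zero_def by (simp add: cx_mor_map_zero[OF r(2)] D_of_mor)
next
  assume \<phi>: "\<phi> \<in> D_hom R X Y"
  obtain W s f where r: "cx_qis R W X s" "cx_mor R W Y f" "\<phi> = D_mor R X Y W s f"
    by (rule D_homE[OF b(1,2) \<phi>])
  have W: "bounded_complex R W" using r by (simp add: cx_mor_def)
  note z = cx_mor_zero[OF W b(3)]
  have "D_comp R (D_zero R Y Z) \<phi> = D_mor R X Z W s (\<lambda>n x. \<zero>\<^bsub>obj Z n\<^esub>)"
    unfolding r(3) D_zero_def by (rule D_comp_of_left[OF r(1,2) cx_mor_zero[OF b(2,3)]])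
  also have "\<dots> = D_zero R X Z" unfolding D_mor_zero_iff[OF r(1) z]
    using cx_qis_id[OF W] cx_homot_refl[OF z] by (intro exI[of _ W] exI[of _ "\<lambda>n x. x"]) simp
  finally show "D_comp R (D_zero R Y Z) \<phi> = D_zero R X Z" .
qed

section \<open>Distinguished triangles\<close>

lemma Db_mod_simps [simp]:
  "Obj (Db_mod R) = {X. bounded_complex R X}" "Hom (Db_mod R) = D_hom R"
  "Idn (Db_mod R) X = D_of R X X (\<lambda>n x. x)" "Cmp (Db_mod R) = D_comp R" "Zer (Db_mod R) = D_zero R"
  "Shift (Db_mod R) = shift_complex" "Triangles (Db_mod R) = D_triangles R"
  by (simp_all add: Db_mod_def)

lemma iso_mor_Db_mod: "iso_mor (Db_mod R) X Y f \<longleftrightarrow> D_iso R X Y f"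
  by (simp add: iso_mor_def D_iso_def)

subsection \<open>Isomorphisms and zero objects\<close>

lemma D_iso_qis:
  fixes X Y :: "('a, 'a list set) cochain"
  assumes f: "cx_qis R X Y f"
  shows "D_iso R X Y (D_of R X Y f)" and "D_iso R Y X (D_mor R Y X X f (\<lambda>n x. x))"
    and "D_comp R (D_mor R Y X X f (\<lambda>n x. x)) (D_of R X Y f) = D_of R X X (\<lambda>n x. x)"
proof -
  have b: "bounded_complex R X" "bounded_complex R Y" using f by (simp_all add: cx_qis_def)
  note fc = cx_qis_mor[OF f] and iX = cx_qis_id[OF b(1)] and iX' = cx_mor_id[OF b(1)]
  note iY = cx_qis_id[OF b(2)] and iY' = cx_mor_id[OF b(2)]
  let ?g = "D_mor R Y X X f (\<lambda>n x. x)"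
  show 1: "D_comp R ?g (D_of R X Y f) = D_of R X X (\<lambda>n x. x)"
    unfolding D_of_mor[of R X X] by (rule D_comp_of_right[OF fc f iX' iX iX' cx_homot_refl[OF fc]])
  have "D_comp R (D_of R X Y f) ?g = D_mor R Y Y X f f"
    by (rule D_comp_of_left[OF f iX' fc])
  also have "\<dots> = D_of R Y Y (\<lambda>n x. x)"
    unfolding D_of_mor D_mor_eq_iff[OF f fc iY iY']
    by (rule roof_equivI[OF f fc iY iY' iX fc cx_homot_refl[OF fc] cx_homot_refl[OF fc]])
  finally have 2: "D_comp R (D_of R X Y f) ?g = D_of R Y Y (\<lambda>n x. x)" .
  note h = D_of_hom[OF fc] D_mor_hom[OF f iX']
  show "D_iso R X Y (D_of R X Y f)" "D_iso R Y X ?g"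
    using 1 2 h unfolding D_iso_def by blast+
qed

lemma D_isoE:
  assumes "D_iso R X Y f"
  obtains g where "f \<in> D_hom R X Y" "g \<in> D_hom R Y X" "D_comp R g f = D_of R X X (\<lambda>n x. x)"
    "D_comp R f g = D_of R Y Y (\<lambda>n x. x)"
  using assms unfolding D_iso_def by blast

lemma D_iso_sym:
  assumes "D_iso R X Y f"
  obtains g where "D_iso R Y X g"
  using assms unfolding D_iso_def by blast

lemma D_iso_trans:
  fixes X Y Z :: "('a, 'a list set) cochain"
  assumes b: "bounded_complex R X" "bounded_complex R Y" "bounded_complex R Z"
    and f: "D_iso R X Y f" and g: "D_iso R Y Z g"
  shows "D_iso R X Z (D_comp R g f)"
proof -
  obtain f' where f': "f \<in> D_hom R X Y" "f' \<in> D_hom R Y X" "D_comp R f' f = D_of R X X (\<lambda>n x. x)"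
    "D_comp R f f' = D_of R Y Y (\<lambda>n x. x)" by (rule D_isoE[OF f])
  obtain g' where g': "g \<in> D_hom R Y Z" "g' \<in> D_hom R Z Y" "D_comp R g' g = D_of R Y Y (\<lambda>n x. x)"
    "D_comp R g g' = D_of R Z Z (\<lambda>n x. x)" by (rule D_isoE[OF g])
  have gf: "D_comp R g f \<in> D_hom R X Z" by (rule D_comp_hom[OF b f'(1) g'(1)])
  have fg: "D_comp R f' g' \<in> D_hom R Z X" by (rule D_comp_hom[OF b(3,2,1) g'(2) f'(2)])
  have "D_comp R (D_comp R f' g') (D_comp R g f) = D_comp R f' (D_comp R g' (D_comp R g f))"
    by (rule D_comp_assoc[OF b(1,3,2,1) gf g'(2) f'(2)])
  also have "D_comp R g' (D_comp R g f) = D_comp R (D_comp R g' g) f"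
    by (rule D_comp_assoc[symmetric, OF b(1,2,3,2) f'(1) g'(1,2)])
  also have "\<dots> = f" unfolding g'(3) by (rule D_comp_id[OF b(1,2) f'(1)])
  finally have 1: "D_comp R (D_comp R f' g') (D_comp R g f) = D_of R X X (\<lambda>n x. x)" using f'(3) by simp
  have "D_comp R (D_comp R g f) (D_comp R f' g') = D_comp R g (D_comp R f (D_comp R f' g'))"
    by (rule D_comp_assoc[OF b(3,1,2,3) fg f'(1) g'(1)])
  also have "D_comp R f (D_comp R f' g') = D_comp R (D_comp R f f') g'"
    by (rule D_comp_assoc[symmetric, OF b(3,2,1,2) g'(2) f'(2,1)])
  also have "\<dots> = g'" unfolding f'(4) by (rule D_comp_id[OF b(3,2) g'(2)])
  finally have 2: "D_comp R (D_comp R g f) (D_comp R f' g') = D_of R Z Z (\<lambda>n x. x)" using g'(4) by simp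
  show ?thesis unfolding D_iso_def using gf fg 1 2 by blast
qed

text \<open>The identity is zero when some quasi-isomorphism onto \<open>X\<close> is null
  homotopic. Such a map is both zero and onto in cohomology; conversely, for acyclic
  \<open>X\<close> the map from the zero complex is one.\<close>

lemma zero_object_iff:
  fixes X :: "('a, 'a list set) cochain"
  assumes X: "bounded_complex R X"
  shows "zero_object (Db_mod R) X \<longleftrightarrow> acyclic_complex X"
proof -
  note i = cx_qis_id[OF X] and ic = cx_mor_id[OF X]
  have "zero_object (Db_mod R) X \<longleftrightarrow>
    (\<exists>(V :: ('a, 'a list set) cochain) t. cx_qis R V X t \<and> cx_homot R V X (\<lambda>n x. t n x) (\<lambda>n x. \<zero>\<^bsub>obj X n\<^esub>))"
    using X D_mor_zero_iff[OF i ic] by (simp add: zero_object_def D_of_mor)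
  also have "\<dots> \<longleftrightarrow> acyclic_complex X"
  proof
    assume "\<exists>(V :: ('a, 'a list set) cochain) t. cx_qis R V X t \<and> cx_homot R V X (\<lambda>n x. t n x) (\<lambda>n x. \<zero>\<^bsub>obj X n\<^esub>)"
    then obtain V :: "('a, 'a list set) cochain" and t where V: "bounded_complex R V" and q: "quasi_iso R V X t"
      and H: "homotopic R V X t (\<lambda>n x. \<zero>\<^bsub>obj X n\<^esub>)"
      by (auto simp: cx_qis_def cx_homot_def)
    show "acyclic_complex X" unfolding acyclic_complex_cohomologous[OF X]
    proof (intro allI ballI)
      fix n x assume "x \<in> cocycles X n"
      then obtain v where v: "v \<in> cocycles V n" "cohomologous X n (t n v) x"
        using q[unfolded quasi_iso_iff[OF V X]] by blast
      show "cohomologous X n x \<zero>\<^bsub>obj X n\<^esub>"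
        using cohomologous_trans[OF X cohomologous_sym[OF X v(2)]
          homotopic_cohomologous[OF V X quasi_iso_chain_map[OF q] chain_map_zero[OF V X] H v(1)]] .
    qed
  next
    assume a: "acyclic_complex X"
    note O = bounded_zero_complex[OF bounded_complex_cring[OF X]]
    have z: "cx_mor R (zero_complex :: ('a, 'a list set) cochain) X (\<lambda>n x. \<zero>\<^bsub>obj X n\<^esub>)"
      by (rule cx_mor_zero[OF O X])
    have "cx_qis R (zero_complex :: ('a, 'a list set) cochain) X (\<lambda>n x. \<zero>\<^bsub>obj X n\<^esub>)"
      using chain_map_acyclic_quasi_iso[OF O X chain_map_zero[OF O X] acyclic_zero_complex a] O X
      by (simp add: cx_qis_def cx_mor_def)
    with cx_homot_refl[OF z]
    show "\<exists>(V :: ('a, 'a list set) cochain) t. cx_qis R V X t \<and> cx_homot R V X (\<lambda>n x. t n x) (\<lambda>n x. \<zero>\<^bsub>obj X n\<^esub>)"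
      by blast
  qed
  finally show ?thesis .
qed

text \<open>The identity of \<open>X\<close> vanishes, so \<open>f\<close> does, and with it the
  identity of \<open>Y\<close>, which factors through \<open>f\<close>.\<close>

lemma D_iso_acyclic:
  fixes X Y :: "('a, 'a list set) cochain"
  assumes b: "bounded_complex R X" "bounded_complex R Y" and f: "D_iso R X Y f" and a: "acyclic_complex X"
  shows "acyclic_complex Y"
proof -
  obtain g where g: "f \<in> D_hom R X Y" "g \<in> D_hom R Y X" "D_comp R g f = D_of R X X (\<lambda>n x. x)"
    "D_comp R f g = D_of R Y Y (\<lambda>n x. x)" by (rule D_isoE[OF f])
  have "D_of R X X (\<lambda>n x. x) = D_zero R X X" using zero_object_iff[OF b(1)] a by (simp add: zero_object_def)
  then have "f = D_zero R X Y"
    using D_comp_id(1)[OF b g(1)] D_comp_zero(1)[OF b(1,1,2) g(1)] by simp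
  then have "D_of R Y Y (\<lambda>n x. x) = D_zero R Y Y"
    using g(4) D_comp_zero(2)[OF b(2,1,2) g(2)] by simp
  then show ?thesis using zero_object_iff[OF b(2)] b by (simp add: zero_object_def)
qed

subsection \<open>Triangles from cones\<close>

lemma cx_homot_shift: "cx_homot R X Y f g \<Longrightarrow>
    cx_homot R (shift_complex X) (shift_complex Y) (shift_map f) (shift_map g)"
  by (simp add: cx_homot_def cx_mor_def bounded_shift chain_map_shift homotopic_shift)

lemma cx_qis_shift: "cx_qis R X Y f \<Longrightarrow> cx_qis R (shift_complex X) (shift_complex Y) (shift_map f)"
  by (simp add: cx_qis_def bounded_shift quasi_iso_shift)

lemma cx_mor_shift: "cx_mor R X Y f \<Longrightarrow> cx_mor R (shift_complex X) (shift_complex Y) (shift_map f)"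
  by (simp add: cx_mor_def bounded_shift chain_map_shift)

text \<open>A triangle built from a cone is compared with its model by the identity on the first
  vertex, and the third square of that comparison involves the shift of this identity.\<close>

lemma D_shift_id:
  fixes X :: "('a, 'a list set) cochain"
  assumes X: "bounded_complex R X"
  shows "D_shift R (D_of R X X (\<lambda>n x. x)) = D_of R (shift_complex X) (shift_complex X) (\<lambda>n x. x)"
proof -
  let ?X = "shift_complex X"
  let ?C = "roof_class R ?X ?X (?X, \<lambda>n x. x, \<lambda>n x. x)"
  note i = cx_qis_id[OF X] cx_mor_id[OF X]
  note i' = cx_qis_id[OF bounded_shift[OF X]] cx_mor_id[OF bounded_shift[OF X]]
  have "roof_class R ?X ?X (shift_complex W, shift_map s, shift_map f) = ?C"
    if "(W, s, f) \<in> roof_class R X X (X, \<lambda>n x. x, \<lambda>n x. x)" for W s f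
  proof -
    have r: "cx_qis R W X s" "cx_mor R W X f" and e: "roof_equiv R X X (X, \<lambda>n x. x, \<lambda>n x. x) (W, s, f)"
      using that by (simp_all add: roof_class_def roofs_iff[OF X X])
    obtain V :: "('a, 'a list set) cochain" and u u' where V: "cx_qis R V X u" "cx_qis R V W u'"
      "cx_homot R V X (\<lambda>n x. u n x) (\<lambda>n x. s n (u' n x))" "cx_homot R V X (\<lambda>n x. u n x) (\<lambda>n x. f n (u' n x))"
      by (rule roof_equivE[OF i r e])
    note r' = cx_qis_shift[OF r(1)] cx_mor_shift[OF r(2)]
    show ?thesis unfolding roof_class_eq_iff[OF r' i']
      by (rule roof_equivI[OF r' i' cx_qis_shift[OF V(2)] cx_qis_mor[OF cx_qis_shift[OF V(1)]]])
        (use cx_homot_shift[OF cx_homot_sym[OF V(3)]] cx_homot_shift[OF cx_homot_sym[OF V(4)]] in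
          \<open>simp_all add: shift_map_def\<close>)
  qed
  moreover have "(X, \<lambda>n x. x, \<lambda>n x. x) \<in> roof_class R X X (X, \<lambda>n x. x, \<lambda>n x. x)"
    using roof_equiv_refl[OF i] i by (simp add: roof_class_def roofs_iff[OF X X])
  ultimately have "\<Union>{roof_class R ?X ?X (shift_complex W, shift_map s, shift_map f) |W s f.
    (W, s, f) \<in> roof_class R X X (X, \<lambda>n x. x, \<lambda>n x. x)} = ?C" by blast
  then show ?thesis by (simp add: D_shift_def D_of_def)
qed

text \<open>The model triangle is formed with a copy \<open>C\<close> of the cone on the right type,
  and \<open>K\<close> is attached through the isomorphism \<open>C -> cone -> K\<close> of the
  derived category. Thus any complex quasi-isomorphic to the cone can be the third vertex.\<close>

lemma cone_triangle:
  fixes X Y K :: "('a, 'a list set) cochain"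
  assumes u: "cx_mor R X Y u" and w: "cx_qis R (cone X Y u) K w"
  shows "\<exists>f g h. triangle (Db_mod R) X Y K f g h"
proof -
  have X: "bounded_complex R X" and Y: "bounded_complex R Y" and K: "bounded_complex R K"
    and uc: "chain_map R X Y u" using u w by (simp_all add: cx_mor_def cx_qis_def)
  note sX = bounded_shift[OF X]
  note C0 = bounded_cone[OF X Y uc] and cc = chain_map_cone[OF X Y uc]
  obtain C :: "('a, 'a list set) cochain" and e e' where C: "bounded_complex R C"
    and e: "chain_map R (cone X Y u) C e" "chain_map R C (cone X Y u) e'"
    and inv: "\<forall>n. \<forall>x \<in> carrier (obj (cone X Y u) n). e' n (e n x) = x"
      "\<forall>n. \<forall>c \<in> carrier (obj C n). e n (e' n c) = c"
    by (rule bounded_complex_small[OF C0])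
  have "cx_qis R C (cone X Y u) e'"
    using inverse_chain_maps_quasi_iso[OF C C0 e(2,1) inv(2,1)[rule_format]] C C0 by (simp add: cx_qis_def)
  from cx_qis_comp[OF w this] have q: "cx_qis R C K (\<lambda>n x. w n (e' n x))" .
  define \<phi> where "\<phi> = D_of R C K (\<lambda>n x. w n (e' n x))"
  define c where "c = D_mor R K C C (\<lambda>n x. w n (e' n x)) (\<lambda>n x. x)"
  define f' where "f' = D_of R X Y u"
  define g' where "g' = D_of R Y C (e \<circ>\<circ>\<circ> cone_in X)"
  define h' where "h' = D_of R C (shift_complex X) (cone_out \<circ>\<circ>\<circ> e')"
  have ci: "D_iso R K C c" and c\<phi>: "D_comp R c \<phi> = D_of R C C (\<lambda>n x. x)"
    unfolding c_def \<phi>_def by (rule D_iso_qis[OF q])+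
  have ch: "c \<in> D_hom R K C" using ci by (simp add: D_iso_def)
  have \<phi>h: "\<phi> \<in> D_hom R C K" unfolding \<phi>_def by (rule D_of_hom[OF cx_qis_mor[OF q]])
  have f'h: "f' \<in> D_hom R X Y" unfolding f'_def by (rule D_of_hom[OF u])
  have g'h: "g' \<in> D_hom R Y C" unfolding g'_def
    by (rule D_of_hom) (use chain_map_comp[OF cc(2) e(1)] Y C in \<open>simp add: cx_mor_def\<close>)
  have h'h: "h' \<in> D_hom R C (shift_complex X)" unfolding h'_def
    by (rule D_of_hom) (use chain_map_comp[OF e(2) cc(1)] sX C in \<open>simp add: cx_mor_def\<close>)
  have tri: "(f', g', h') \<in> D_cone_triangles R"
    unfolding D_cone_triangles_def f'_def g'_def h'_def using X Y C uc e inv by blast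
  define g where "g = D_comp R \<phi> g'"
  define h where "h = D_comp R h' c"
  have gh: "g \<in> D_hom R Y K" unfolding g_def by (rule D_comp_hom[OF Y C K g'h \<phi>h])
  have hh: "h \<in> D_hom R K (shift_complex X)" unfolding h_def by (rule D_comp_hom[OF K C sX ch h'h])
  have "D_comp R c g = D_comp R (D_comp R c \<phi>) g'"
    unfolding g_def by (rule D_comp_assoc[symmetric, OF Y C K C g'h \<phi>h ch])
  then have 1: "D_comp R c g = D_comp R g' (D_of R Y Y (\<lambda>n x. x))"
    unfolding c\<phi> D_comp_id[OF Y C g'h] .
  have 2: "D_comp R (D_shift R (D_of R X X (\<lambda>n x. x))) h = D_comp R h' c"
    unfolding D_shift_id[OF X] D_comp_id[OF K sX hh] by (simp add: h_def)
  have 3: "D_comp R (D_of R Y Y (\<lambda>n x. x)) f' = D_comp R f' (D_of R X X (\<lambda>n x. x))"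
    unfolding D_comp_id[OF X Y f'h] ..
  have i: "D_iso R X X (D_of R X X (\<lambda>n x. x))" "D_iso R Y Y (D_of R Y Y (\<lambda>n x. x))"
    by (rule D_iso_qis[OF cx_qis_id[OF X]] D_iso_qis[OF cx_qis_id[OF Y]])+
  have "(f', g, h) \<in> D_triangles R"
    unfolding D_triangles_def mem_Collect_eq prod.case
    by (rule exI[of _ X], rule exI[of _ Y], rule exI[of _ K], rule exI[of _ X], rule exI[of _ Y],
        rule exI[of _ C], rule exI[of _ f'], rule exI[of _ g'], rule exI[of _ h'],
        rule exI[of _ "D_of R X X (\<lambda>n x. x)"], rule exI[of _ "D_of R Y Y (\<lambda>n x. x)"], rule exI[of _ c])
      (intro conjI X Y K f'h gh hh g'h h'h tri i ci 1 2 3)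
  then have "triangle (Db_mod R) X Y K f' g h"
    using X Y K f'h gh hh by (simp add: triangle_def)
  then show ?thesis by blast
qed

lemma short_exact_triangle:
  fixes X Y K :: "('a, 'a list set) cochain"
  assumes f: "cx_mor R X Y f" and g: "cx_mor R Y K g"
    and inj: "\<And>n x. x \<in> carrier (obj X n) \<Longrightarrow> f n x = \<zero>\<^bsub>obj Y n\<^esub> \<Longrightarrow> x = \<zero>\<^bsub>obj X n\<^esub>"
    and surj: "\<And>n k. k \<in> carrier (obj K n) \<Longrightarrow> \<exists>y \<in> carrier (obj Y n). g n y = k"
    and gf: "\<And>n x. x \<in> carrier (obj X n) \<Longrightarrow> g n (f n x) = \<zero>\<^bsub>obj K n\<^esub>"
    and ker: "\<And>n y. y \<in> carrier (obj Y n) \<Longrightarrow> g n y = \<zero>\<^bsub>obj K n\<^esub> \<Longrightarrow> \<exists>x \<in> carrier (obj X n). y = f n x"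
  shows "\<exists>f g h. triangle (Db_mod R) X Y K f g h"
proof (rule cone_triangle[OF f])
  show "cx_qis R (cone X Y f) K (\<lambda>n p. g n (snd p))"
    using short_exact_cone_quasi_iso[of R X Y K f g] assms bounded_cone[of R X Y f]
    by (simp add: cx_mor_def cx_qis_def)
qed

section \<open>Consequences of a distinguished triangle\<close>

lemma triangle_coneE:
  fixes A B C :: "('a, 'a list set) cochain"
  assumes "triangle (Db_mod R) A B C f g h"
  obtains X Y K u e e' a b c where "chain_map R X Y u" "bounded_complex R X" "bounded_complex R Y"
    "bounded_complex R K" "chain_map R (cone X Y u) K e" "chain_map R K (cone X Y u) e'"
    "\<forall>n. \<forall>x \<in> carrier (obj (cone X Y u) n). e' n (e n x) = x"
    "\<forall>n. \<forall>c \<in> carrier (obj K n). e n (e' n c) = c"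
    "D_iso R A X a" "D_iso R B Y b" "D_iso R C K c" "D_comp R b f = D_comp R (D_of R X Y u) a"
proof -
  from assms have "(f, g, h) \<in> D_triangles R" and fh: "f \<in> D_hom R A B" "g \<in> D_hom R B C"
    by (simp_all add: triangle_def)
  then obtain A0 B0 C0 X Y K f' g' h' a b c where 1: "f \<in> D_hom R A0 B0" "g \<in> D_hom R B0 C0"
    "f' \<in> D_hom R X Y" "g' \<in> D_hom R Y K" "(f', g', h') \<in> D_cone_triangles R"
    "D_iso R A0 X a" "D_iso R B0 Y b" "D_iso R C0 K c" "D_comp R b f = D_comp R f' a"
    unfolding D_triangles_def mem_Collect_eq prod.case by (elim exE conjE) (rule that)
  \<comment> \<open>Morphisms carry their source and target, so the complexes hidden under the
    quantifiers of \<open>D_triangles\<close> are the given ones.\<close>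
  have ABC: "A0 = A" "B0 = B" "C0 = C" using fh 1(1,2) by (auto simp: D_hom_def)
  from 1(5) obtain X' Y' u K' e e' where 2: "f' = D_of R X' Y' u" "g' = D_of R Y' K' (e \<circ>\<circ>\<circ> cone_in X')"
    "bounded_complex R X'" "bounded_complex R Y'" "bounded_complex R K'" "chain_map R X' Y' u"
    "chain_map R (cone X' Y' u) K' e" "chain_map R K' (cone X' Y' u) e'"
    "\<forall>n. (\<forall>z \<in> carrier (obj (cone X' Y' u) n). e' n (e n z) = z) \<and>
             (\<forall>c \<in> carrier (obj K' n). e n (e' n c) = c)"
    unfolding D_cone_triangles_def mem_Collect_eq by (elim exE conjE Pair_inject) (rule that)
  have XYK: "X' = X" "Y' = Y" "K' = K" using 1(3,4) 2(1,2) by (auto simp: D_hom_def D_of_def)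
  show thesis
    by (rule that[of X Y u K e e' a b c]) (use 1 2 in \<open>simp_all add: ABC XYK\<close>)
qed

text \<open>In the model the first vertex is acyclic too, so \<open>Y -> cone\<close> is a
  quasi-isomorphism. Applied where a filtration becomes nonzero, this shows that its first nonzero
  term is semistable.\<close>

lemma triangle_zero_iso:
  fixes A B C :: "('a, 'a list set) cochain"
  assumes t: "triangle (Db_mod R) A B C f g h" and a: "acyclic_complex A"
  shows "\<exists>w. D_iso R C B w"
proof -
  obtain X Y K u e e' i j k where *: "chain_map R X Y u" "bounded_complex R X" "bounded_complex R Y"
    "bounded_complex R K" "chain_map R (cone X Y u) K e" "chain_map R K (cone X Y u) e'"
    "\<forall>n. \<forall>x \<in> carrier (obj (cone X Y u) n). e' n (e n x) = x"
    "\<forall>n. \<forall>c \<in> carrier (obj K n). e n (e' n c) = c"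
    "D_iso R A X i" "D_iso R B Y j" "D_iso R C K k" by (rule triangle_coneE[OF t])
  have b: "bounded_complex R A" "bounded_complex R B" "bounded_complex R C"
    using t by (simp_all add: triangle_def)
  have "acyclic_complex X" by (rule D_iso_acyclic[OF b(1) *(2,9) a])
  then have "cx_qis R Y (cone X Y u) (cone_in X)"
    using cone_in_quasi_iso[OF *(2,3,1)] bounded_cone[OF *(2,3,1)] *(3) by (simp add: cx_qis_def)
  moreover have "cx_qis R (cone X Y u) K e"
    using inverse_chain_maps_quasi_iso[OF bounded_cone[OF *(2,3,1)] *(4,5,6) *(7,8)[rule_format]]
      bounded_cone[OF *(2,3,1)] *(4) by (simp add: cx_qis_def)
  ultimately have q: "cx_qis R Y K (\<lambda>n x. e n (cone_in X n x))" by (rule cx_qis_comp[rotated])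
  obtain j' where j': "D_iso R Y B j'" by (rule D_iso_sym[OF *(10)])
  show ?thesis
    using D_iso_trans[OF b(3) *(4) b(2) *(11) D_iso_trans[OF *(4,3) b(2) D_iso_qis(2)[OF q] j']] by blast
qed

text \<open>This is exactness of \<open>Hom(T[1], C) \<rightarrow> Hom(T[1], A[1]) \<rightarrow> Hom(T[1], B[1])\<close>.\<close>

lemma triangle_hom_injective:
  fixes A B C T :: "('a, 'a list set) cochain"
  assumes t: "triangle (Db_mod R) A B C f g h" and T: "bounded_complex R T"
    and van: "D_hom R (shift_complex T) C = {D_zero R (shift_complex T) C}"
    and \<tau>: "\<tau> \<in> D_hom R T A" and f\<tau>: "D_comp R f \<tau> = D_zero R T B"
  shows "\<tau> = D_zero R T A"
proof -
  obtain X Y K u e e' i j k where *: "chain_map R X Y u" "bounded_complex R X" "bounded_complex R Y"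
    "bounded_complex R K" "chain_map R (cone X Y u) K e" "chain_map R K (cone X Y u) e'"
    "\<forall>n. \<forall>x \<in> carrier (obj (cone X Y u) n). e' n (e n x) = x"
    "\<forall>n. \<forall>c \<in> carrier (obj K n). e n (e' n c) = c"
    "D_iso R A X i" "D_iso R B Y j" "D_iso R C K k" "D_comp R j f = D_comp R (D_of R X Y u) i"
    by (rule triangle_coneE[OF t])
  have b: "bounded_complex R A" "bounded_complex R B" "bounded_complex R C" and fh: "f \<in> D_hom R A B"
    using t by (simp_all add: triangle_def)
  obtain i' where i: "i \<in> D_hom R A X" "i' \<in> D_hom R X A" "D_comp R i' i = D_of R A A (\<lambda>n x. x)"
    by (rule D_isoE[OF *(9)])
  obtain k' where k: "k \<in> D_hom R C K" "k' \<in> D_hom R K C" "D_comp R k k' = D_of R K K (\<lambda>n x. x)"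
    by (rule D_isoE[OF *(11)])
  have j: "j \<in> D_hom R B Y" using *(10) by (simp add: D_iso_def)
  have u: "cx_mor R X Y u" using * by (simp add: cx_mor_def)
  note uh = D_of_hom[OF u] and sT = bounded_shift[OF T] and cone = bounded_cone[OF *(2,3,1)]
  \<comment> \<open>The vanishing hypothesis is transported from \<open>C\<close> to its model
    \<open>K\<close>.\<close>
  have vanK: "\<sigma> = D_zero R (shift_complex T) K" if \<sigma>: "\<sigma> \<in> D_hom R (shift_complex T) K" for \<sigma>
  proof -
    have "D_comp R k' \<sigma> = D_zero R (shift_complex T) C"
      using D_comp_hom[OF sT *(4) b(3) \<sigma> k(2)] van by blast
    then have "D_zero R (shift_complex T) K = D_comp R k (D_comp R k' \<sigma>)"
      using D_comp_zero(1)[OF sT b(3) *(4) k(1)] by simp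
    also have "\<dots> = D_comp R (D_comp R k k') \<sigma>"
      by (rule D_comp_assoc[symmetric, OF sT *(4) b(3) *(4) \<sigma> k(2,1)])
    also have "\<dots> = \<sigma>" unfolding k(3) by (rule D_comp_id[OF sT *(4) \<sigma>])
    finally show ?thesis by simp
  qed
  \<comment> \<open>Transporting \<open>\<tau>\<close> to the model replaces \<open>f\<close> by the
    class of an honest chain map \<open>u\<close>.\<close>
  define \<alpha> where "\<alpha> = D_comp R i \<tau>"
  have \<alpha>: "\<alpha> \<in> D_hom R T X" unfolding \<alpha>_def by (rule D_comp_hom[OF T b(1) *(2) \<tau> i(1)])
  have "D_comp R (D_of R X Y u) \<alpha> = D_comp R (D_comp R (D_of R X Y u) i) \<tau>"
    unfolding \<alpha>_def by (rule D_comp_assoc[symmetric, OF T b(1) *(2,3) \<tau> i(1) uh])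
  also have "\<dots> = D_comp R (D_comp R j f) \<tau>" using *(12) by simp
  also have "\<dots> = D_comp R j (D_comp R f \<tau>)" by (rule D_comp_assoc[OF T b(1,2) *(3) \<tau> fh j])
  also have "\<dots> = D_zero R T Y" unfolding f\<tau> by (rule D_comp_zero(1)[OF T b(2) *(3) j])
  finally have u\<alpha>: "D_comp R (D_of R X Y u) \<alpha> = D_zero R T Y" .
  obtain W s a where w: "cx_qis R W T s" "cx_mor R W X a" "\<alpha> = D_mor R T X W s a"
    by (rule D_homE[OF T *(2) \<alpha>])
  have "D_mor R T Y W s (\<lambda>n x. u n (a n x)) = D_zero R T Y"
    using D_comp_of_left[OF w(1,2) u] u\<alpha> w(3) by simp
  then obtain V :: "('a, 'a list set) cochain" and v where v: "cx_qis R V W v"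
    "cx_homot R V Y (\<lambda>n x. u n (a n (v n x))) (\<lambda>n x. \<zero>\<^bsub>obj Y n\<^esub>)"
    unfolding D_mor_zero_iff[OF w(1) cx_mor_comp[OF u w(2)]] by blast
  have av: "cx_mor R V X (\<lambda>n x. a n (v n x))" by (rule cx_mor_comp[OF w(2) cx_qis_mor[OF v(1)]])
  have V: "bounded_complex R V" and avc: "chain_map R V X (\<lambda>n x. a n (v n x))"
    using av by (simp_all add: cx_mor_def)
  \<comment> \<open>On the refinement \<open>V\<close> the composite \<open>u a v\<close> is null
    homotopic, which lifts \<open>a v\<close> to a map from the shift of \<open>V\<close> to the
    cone.\<close>
  obtain l where l: "chain_map R (shift_complex V) (cone X Y u) l" "cone_out \<circ>\<circ>\<circ> l = shift_map (\<lambda>n x. a n (v n x))"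
    by (rule cone_lift[OF V *(2,3) avc *(1)]) (use v(2) in \<open>auto simp: cx_homot_def comp_def\<close>)
  have lm: "cx_mor R (shift_complex V) (cone X Y u) l" and em: "cx_mor R (cone X Y u) K e" "cx_mor R K (cone X Y u) e'"
    using l * cone bounded_shift[OF V] by (simp_all add: cx_mor_def)
  note el = cx_mor_comp[OF em(1) lm] and sv = cx_qis_shift[OF cx_qis_comp[OF w(1) v(1)]]
  \<comment> \<open>The lift represents a morphism from \<open>T[1]\<close> to the third vertex.
    There are only zero morphisms, so it becomes null homotopic on some \<open>P\<close>.\<close>
  have "D_mor R (shift_complex T) K (shift_complex V) (shift_map (\<lambda>n x. s n (v n x))) (\<lambda>n x. e n (l n x)) =
    D_zero R (shift_complex T) K" by (rule vanK[OF D_mor_hom[OF sv el]])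
  then obtain P :: "('a, 'a list set) cochain" and p where p: "cx_qis R P (shift_complex V) p"
    "cx_homot R P K (\<lambda>n x. e n (l n (p n x))) (\<lambda>n x. \<zero>\<^bsub>obj K n\<^esub>)"
    unfolding D_mor_zero_iff[OF sv el] by blast
  have P: "bounded_complex R P" and pq: "quasi_iso R P (shift_complex V) p" using p(1) by (simp_all add: cx_qis_def)
  note lp = cx_mor_comp[OF lm cx_qis_mor[OF p(1)]]
  have lpc: "l n (p n x) \<in> carrier (obj (cone X Y u) n)" if "x \<in> carrier (obj P n)" for n x
    using lp that chain_map_props(1)[of R P "cone X Y u" "\<lambda>n x. l n (p n x)" x n] by (simp only: cx_mor_def)
  \<comment> \<open>\<open>K\<close> is only a copy of the cone; \<open>e'\<close> carries the null
    homotopy back to the cone itself, where \<open>cone_null_unshift\<close> applies.\<close>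
  have "homotopic R P (cone X Y u) (\<lambda>n x. l n (p n x)) (\<lambda>n x. e' n (e n (l n (p n x))))"
    using cx_mor_comp[OF em(2) cx_mor_comp[OF em(1) lp]]
    by (intro homotopic_cong[OF P cone]) (simp_all only: cx_mor_def *(7)[rule_format, OF lpc])
  then have "cx_homot R P (cone X Y u) (\<lambda>n x. l n (p n x)) (\<lambda>n x. e' n (e n (l n (p n x))))"
    using lp cx_mor_comp[OF em(2) cx_mor_comp[OF em(1) lp]] by (simp add: cx_homot_def)
  also have "cx_homot R P (cone X Y u) (\<lambda>n x. e' n (e n (l n (p n x)))) (\<lambda>n x. \<zero>\<^bsub>obj (cone X Y u) n\<^esub>)"
    using cx_homot_left[OF em(2) p(2)] by (simp only: cx_mor_map_zero[OF em(2)])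
  finally have "homotopic R P (cone X Y u) (l \<circ>\<circ>\<circ> p) (\<lambda>n x. \<zero>\<^bsub>obj (cone X Y u) n\<^esub>)"
    by (simp add: cx_homot_def comp_def)
  from cone_null_unshift[OF V *(2,3) P avc *(1) l quasi_iso_chain_map[OF pq] this]
  have null: "homotopic R (unshift_complex P) X (\<lambda>n x. a n (v n (p (n - 1) x))) (\<lambda>n x. \<zero>\<^bsub>obj X n\<^esub>)"
    by (simp add: comp_def)
  have p': "cx_qis R (unshift_complex P) V (\<lambda>n. p (n - 1))"
    using quasi_iso_unshift[OF P V pq] bounded_unshift[OF P] V by (simp add: cx_qis_def)
  note vp = cx_qis_comp[OF v(1) p']
  have "cx_homot R (unshift_complex P) X (\<lambda>n x. a n (v n (p (n - 1) x))) (\<lambda>n x. \<zero>\<^bsub>obj X n\<^esub>)"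
    using null cx_mor_comp[OF w(2) cx_qis_mor[OF vp]] cx_mor_zero[OF bounded_unshift[OF P] *(2)]
    by (simp add: cx_homot_def)
  with vp have "D_mor R T X W s a = D_zero R T X"
    unfolding D_mor_zero_iff[OF w(1,2)] by blast
  then have \<alpha>0: "D_comp R i \<tau> = D_zero R T X" using w(3) by (simp add: \<alpha>_def)
  have "D_zero R T A = D_comp R i' (D_comp R i \<tau>)"
    unfolding \<alpha>0 by (rule D_comp_zero(1)[symmetric, OF T *(2) b(1) i(2)])
  also have "\<dots> = D_comp R (D_comp R i' i) \<tau>"
    by (rule D_comp_assoc[symmetric, OF T b(1) *(2) b(1) \<tau> i(1,2)])
  also have "\<dots> = \<tau>" unfolding i(3) by (rule D_comp_id[OF T b(1) \<tau>])
  finally show ?thesis by simp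
qed

subsection \<open>Additivity of the central charge\<close>

text \<open>The free generators satisfy \<open>B = A + C\<close> up to a defining relation, so the
  cosets agree, and \<open>Z\<close> is a homomorphism on cosets.\<close>

lemma K0_hom_triangle:
  assumes Z: "Z \<in> hom (K0 D) complex_group" and t: "triangle D A B C f g h"
  shows "Z (K0_class D B) = Z (K0_class D A) + Z (K0_class D C)"
proof -
  let ?F = "free_Abelian_group (Obj D)"
  interpret F: comm_group ?F by (rule abelian_free_Abelian_group)
  have ABC: "A \<in> Obj D" "B \<in> Obj D" "C \<in> Obj D" using t by (auto simp: triangle_def)
  have fr: "frag_of E \<in> carrier ?F" if "E \<in> Obj D" for E using that by simp
  let ?S = "{frag_of B - frag_of A - frag_of C |A B C. \<exists>f g h. triangle D A B C f g h}"
  have diff: "x - y \<in> carrier ?F" if "x \<in> carrier ?F" "y \<in> carrier ?F" for x y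
    using keys_diff[of x y] that by auto
  have "?S \<subseteq> carrier ?F" using diff fr by (fastforce simp: triangle_def simp del: carrier_free_Abelian_group_iff)
  then have sub: "subgroup (K0_relations D) ?F"
    unfolding K0_relations_def by (rule F.generate_is_subgroup)
  then interpret N: normal "K0_relations D" ?F by (rule F.subgroup_imp_normal)
  have "frag_of B - frag_of A - frag_of C \<in> K0_relations D"
    unfolding K0_relations_def using t by (intro generate.incl) blast
  moreover have "frag_of B = (frag_of B - frag_of A - frag_of C) \<otimes>\<^bsub>?F\<^esub> (frag_of A \<otimes>\<^bsub>?F\<^esub> frag_of C)" by simp
  ultimately have "frag_of B \<in> K0_relations D #>\<^bsub>?F\<^esub> (frag_of A \<otimes>\<^bsub>?F\<^esub> frag_of C)"
    unfolding r_coset_def by blast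
  then have "K0_class D B = K0_relations D #>\<^bsub>?F\<^esub> (frag_of A \<otimes>\<^bsub>?F\<^esub> frag_of C)"
    unfolding K0_class_def using fr[OF ABC(1)] fr[OF ABC(3)]
    by (metis F.repr_independence F.m_closed sub)
  also have "\<dots> = K0_class D A \<otimes>\<^bsub>K0 D\<^esub> K0_class D C"
    unfolding K0_class_def K0_def using N.rcos_sum[OF fr[OF ABC(1)] fr[OF ABC(3)]] by simp
  finally have "K0_class D B = K0_class D A \<otimes>\<^bsub>K0 D\<^esub> K0_class D C" .
  moreover have "K0_class D E \<in> carrier (K0 D)" if "E \<in> Obj D" for E
    unfolding K0_class_def K0_def using F.rcosetsI[OF N.subset fr[OF that]] by (simp add: FactGroup_def)
  ultimately show ?thesis
    using Z ABC by (simp add: hom_def complex_group_def)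
qed

section \<open>Additive functions vanish on complexes with torsion cohomology\<close>

subsection \<open>Finitely generated modules\<close>

lemma submodule_module: "module R M \<Longrightarrow> submodule H R M \<Longrightarrow> module R (M\<lparr>carrier := H\<rparr>)"
  by (rule submodule.submodule_is_module)

lemma preimage_submodule:
  assumes M: "module R M" and N: "module R N" and f: "f \<in> linear_maps R M N" and H: "submodule H R N"
  shows "submodule {m \<in> carrier M. f m \<in> H} R M"
proof -
  interpret M: module R M by (fact M)
  interpret N: module R N by (fact N)
  note p = linear_map_props[OF M N f] and E = N.submoduleE[OF H]
  show ?thesis
    by (rule M.submoduleI) (use submodule_zero[OF H] E in \<open>auto simp: p\<close>)
qed

lemma image_submodule:
  assumes M: "module R M" and N: "module R N" and f: "f \<in> linear_maps R M N"
  shows "submodule (f ` carrier M) R N"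
proof -
  interpret M: module R M by (fact M)
  interpret N: module R N by (fact N)
  note p = linear_map_props[OF M N f]
  show ?thesis
  proof (rule N.submoduleI)
    show "\<zero>\<^bsub>N\<^esub> \<in> f ` carrier M" using p(4) by (metis M.M.zero_closed image_eqI)
    show "\<ominus>\<^bsub>N\<^esub> y \<in> f ` carrier M" if "y \<in> f ` carrier M" for y
      using that p(5) by (auto intro!: image_eqI[of _ _ "\<ominus>\<^bsub>M\<^esub> _"])
    show "y \<oplus>\<^bsub>N\<^esub> y' \<in> f ` carrier M" if "y \<in> f ` carrier M" "y' \<in> f ` carrier M" for y y'
      using that by (auto simp flip: p(2))
    show "a \<odot>\<^bsub>N\<^esub> y \<in> f ` carrier M" if "a \<in> carrier R" "y \<in> f ` carrier M" for a y
      using that p(3) by (auto intro!: image_eqI[of _ _ "a \<odot>\<^bsub>M\<^esub> _"])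
  qed (use p in auto)
qed

lemma submodule_restrict:
  assumes N: "module R N" and K: "submodule K R N" and H: "submodule H R (N\<lparr>carrier := K\<rparr>)"
  shows "submodule H R N"
proof -
  interpret N: module R N by (fact N)
  interpret K: module R "N\<lparr>carrier := K\<rparr>" by (rule submodule_module[OF N K])
  have sub: "H \<subseteq> carrier N" using K.submoduleE(1)[OF H] N.submoduleE(1)[OF K] by simp
  moreover have "module R (N\<lparr>carrier := H\<rparr>)" using submodule_module[OF K.module_axioms H] by simp
  ultimately show ?thesis by (rule N.module_incl_imp_submodule)
qed

text \<open>Generators push forward. Coboundaries and the submodules \<open>L + Rx\<close> are both
  images, and their finite generation comes from here.\<close>

lemma fin_gen_image:
  assumes M: "fin_gen_module R M" and N: "module R N" and f: "f \<in> linear_maps R M N"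
  shows "fin_gen_module R (N\<lparr>carrier := f ` carrier M\<rparr>)"
proof -
  obtain S where S: "finite S" "S \<subseteq> carrier M"
    and gen: "\<And>H. submodule H R M \<Longrightarrow> S \<subseteq> H \<Longrightarrow> H = carrier M"
    using M by (auto simp: fin_gen_module_def)
  note M' = fin_gen_module_module[OF M]
  note im = image_submodule[OF M' N f]
  note Im = submodule_module[OF N im]
  show ?thesis
  proof (rule fin_gen_moduleI[OF Im, of "f ` S"])
    fix H assume H: "submodule H R (N\<lparr>carrier := f ` carrier M\<rparr>)" and S': "f ` S \<subseteq> H"
    have "{m \<in> carrier M. f m \<in> H} = carrier M"
      by (rule gen[OF preimage_submodule[OF M' N f submodule_restrict[OF N im H]]]) (use S S' in auto)
    then show "H = carrier (N\<lparr>carrier := f ` carrier M\<rparr>)"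
      using module.submoduleE(1)[OF Im H] by auto
  qed (use S in auto)
qed

lemma fin_gen_trivial:
  assumes M: "module R M"
  shows "fin_gen_module R (M\<lparr>carrier := {\<zero>\<^bsub>M\<^esub>}\<rparr>)" and "submodule {\<zero>\<^bsub>M\<^esub>} R M"
proof -
  interpret M: module R M by (fact M)
  show s: "submodule {\<zero>\<^bsub>M\<^esub>} R M" by (rule M.submoduleI) auto
  note m = submodule_module[OF M s]
  show "fin_gen_module R (M\<lparr>carrier := {\<zero>\<^bsub>M\<^esub>}\<rparr>)"
  proof (rule fin_gen_moduleI[OF m, of "{}"])
    fix H assume "submodule H R (M\<lparr>carrier := {\<zero>\<^bsub>M\<^esub>}\<rparr>)"
    then show "H = carrier (M\<lparr>carrier := {\<zero>\<^bsub>M\<^esub>}\<rparr>)"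
      using module.submoduleE(1,2)[OF m, of H] by auto
  qed auto
qed

section \<open>Adjoining a generator to a submodule\<close>

definition adjoin :: "('a, 'r) ring_scheme \<Rightarrow> ('a, 'm) module \<Rightarrow> 'm set \<Rightarrow> 'm \<Rightarrow> 'm set" where
  "adjoin R M L x = {l \<oplus>\<^bsub>M\<^esub> a \<odot>\<^bsub>M\<^esub> x |l a. l \<in> L \<and> a \<in> carrier R}"

definition ring_module :: "('a, 'r) ring_scheme \<Rightarrow> ('a, 'a) module" where
  "ring_module R = \<lparr>carrier = carrier R, monoid.mult = (\<lambda>_ _. undefined), one = undefined,
     ring.zero = \<zero>\<^bsub>R\<^esub>, ring.add = ring.add R, smult = monoid.mult R\<rparr>"

lemma ring_module_simps [simp]:
  "carrier (ring_module R) = carrier R" "\<zero>\<^bsub>ring_module R\<^esub> = \<zero>\<^bsub>R\<^esub>"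
  "x \<oplus>\<^bsub>ring_module R\<^esub> y = x \<oplus>\<^bsub>R\<^esub> y" "x \<odot>\<^bsub>ring_module R\<^esub> y = x \<otimes>\<^bsub>R\<^esub> y"
  by (simp_all add: ring_module_def)

lemma fin_gen_ring_module:
  assumes "cring R"
  shows "fin_gen_module R (ring_module R)"
proof -
  interpret R: cring R by (fact assms)
  have "abelian_group (ring_module R)"
    by (rule abelian_groupI) (auto simp: R.a_ac intro: R.l_neg)
  then have m: "module R (ring_module R)"
    by (intro moduleI assms) (auto simp: R.l_distr R.r_distr R.m_assoc)
  show ?thesis
  proof (rule fin_gen_moduleI[OF m, of "{\<one>\<^bsub>R\<^esub>}"])
    fix H assume H: "submodule H R (ring_module R)" and 1: "{\<one>\<^bsub>R\<^esub>} \<subseteq> H"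
    note E = module.submoduleE[OF m H]
    have "a \<in> H" if "a \<in> carrier R" for a using E(4)[OF that, of "\<one>\<^bsub>R\<^esub>"] 1 that by simp
    then show "H = carrier (ring_module R)" using E(1) by auto
  qed auto
qed

text \<open>\<open>L + Rx\<close> is the image of the sum of \<open>L\<close> and \<open>R\<close>
  under \<open>(l, a) -> l + a x\<close>, which settles linearity and finite generation at
  once.\<close>

lemma adjoin_props:
  assumes M: "module R M" and L: "submodule L R M" and x: "x \<in> carrier M"
  shows "submodule (adjoin R M L x) R M" and "L \<subseteq> adjoin R M L x" and "x \<in> adjoin R M L x"
    and "fin_gen_module R (M\<lparr>carrier := L\<rparr>) \<Longrightarrow> fin_gen_module R (M\<lparr>carrier := adjoin R M L x\<rparr>)"
proof -
  interpret M: module R M by (fact M)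
  let ?S = "module_sum (M\<lparr>carrier := L\<rparr>) (ring_module R)"
  let ?f = "\<lambda>(l, a). l \<oplus>\<^bsub>M\<^esub> a \<odot>\<^bsub>M\<^esub> x"
  have sub: "L \<subseteq> carrier M" using M.submoduleE(1)[OF L] .
  note r = fin_gen_ring_module[OF M.R.is_cring]
  have S: "module R ?S"
    by (rule module_sum_module[OF submodule_module[OF M L] fin_gen_module_module[OF r]])
  have f: "?f \<in> linear_maps R ?S M"
    by (rule linear_mapsI)
      (use sub x in \<open>auto simp: M.smult_l_distr M.smult_r_distr M.smult_assoc1 M.M.a_ac subset_iff\<close>)
  have im: "?f ` carrier ?S = adjoin R M L x" by (auto simp: adjoin_def image_iff)
  show "submodule (adjoin R M L x) R M" using image_submodule[OF S M f] im by simp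
  show "L \<subseteq> adjoin R M L x"
  proof
    fix l assume "l \<in> L"
    then show "l \<in> adjoin R M L x" unfolding adjoin_def
      using sub x by (intro CollectI exI[of _ l] exI[of _ "\<zero>\<^bsub>R\<^esub>"]) auto
  qed
  show "x \<in> adjoin R M L x" unfolding adjoin_def
    using submodule_zero[OF L] x by (intro CollectI exI[of _ "\<zero>\<^bsub>M\<^esub>"] exI[of _ "\<one>\<^bsub>R\<^esub>"]) auto
  show "fin_gen_module R (M\<lparr>carrier := adjoin R M L x\<rparr>)" if "fin_gen_module R (M\<lparr>carrier := L\<rparr>)"
    using fin_gen_image[OF fin_gen_module_sum[OF that r] M f] im by simp
qed

subsection \<open>Complexes with one or two terms\<close>

definition stalk :: "int \<Rightarrow> ('a, 'm) module \<Rightarrow> ('a, 'm) cochain" where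
  "stalk k M = \<lparr>obj = (\<lambda>n. if n = k then M else M\<lparr>carrier := {\<zero>\<^bsub>M\<^esub>}\<rparr>), diff = (\<lambda>n x. \<zero>\<^bsub>M\<^esub>)\<rparr>"

definition two_term :: "int \<Rightarrow> ('a, 'm) module \<Rightarrow> ('a, 'm) module \<Rightarrow> ('m \<Rightarrow> 'm) \<Rightarrow> ('a, 'm) cochain" where
  "two_term k M N f = \<lparr>obj = (\<lambda>n. if n = k then M else if n = k + 1 then N else M\<lparr>carrier := {\<zero>\<^bsub>M\<^esub>}\<rparr>),
     diff = (\<lambda>n x. if n = k then f x else \<zero>\<^bsub>M\<^esub>)\<rparr>"

lemma stalk_simps [simp]:
  "obj (stalk k M) n = (if n = k then M else M\<lparr>carrier := {\<zero>\<^bsub>M\<^esub>}\<rparr>)"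
  "diff (stalk k M) n x = \<zero>\<^bsub>M\<^esub>"
  by (simp_all add: stalk_def)

lemma two_term_simps [simp]:
  "obj (two_term k M N f) n = (if n = k then M else if n = k + 1 then N else M\<lparr>carrier := {\<zero>\<^bsub>M\<^esub>}\<rparr>)"
  "diff (two_term k M N f) n x = (if n = k then f x else \<zero>\<^bsub>M\<^esub>)"
  by (simp_all add: two_term_def)

lemma bounded_stalk:
  assumes M: "fin_gen_module R M"
  shows "bounded_complex R (stalk k M)"
proof (rule bounded_complexI)
  interpret M: module R M by (rule fin_gen_module_module[OF M])
  show "fin_gen_module R (obj (stalk k M) n)" for n
    using M fin_gen_trivial[OF M.module_axioms] by simp
  show "diff (stalk k M) n \<in> linear_maps R (obj (stalk k M) n) (obj (stalk k M) (n + 1))" for n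
    by (rule linear_mapsI) auto
  have "{n. carrier (obj (stalk k M) n) \<noteq> {\<zero>\<^bsub>obj (stalk k M) n\<^esub>}} \<subseteq> {k}" by auto
  then show "finite {n. carrier (obj (stalk k M) n) \<noteq> {\<zero>\<^bsub>obj (stalk k M) n\<^esub>}}"
    by (rule finite_subset) simp
qed simp_all

text \<open>In a two-term complex the other terms are copies of the zero submodule of \<open>M\<close>, and its
  differentials are \<open>\<zero>\<^bsub>M\<^esub>\<close>; hence the assumption on the zero elements.\<close>

lemma bounded_two_term:
  assumes M: "fin_gen_module R M" and N: "fin_gen_module R N" and f: "f \<in> linear_maps R M N"
    and z: "\<zero>\<^bsub>N\<^esub> = \<zero>\<^bsub>M\<^esub>"
  shows "bounded_complex R (two_term k M N f)"
proof (rule bounded_complexI)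
  interpret M: module R M by (rule fin_gen_module_module[OF M])
  interpret N: module R N by (rule fin_gen_module_module[OF N])
  note p = linear_map_props[OF M.module_axioms N.module_axioms f]
  have zN: "\<zero>\<^bsub>M\<^esub> \<in> carrier N" using N.M.zero_closed z by simp
  have zz: "\<zero>\<^bsub>M\<^esub> \<oplus>\<^bsub>N\<^esub> \<zero>\<^bsub>M\<^esub> = \<zero>\<^bsub>M\<^esub>" using N.M.l_zero[OF N.M.zero_closed] z by simp
  have za: "a \<odot>\<^bsub>N\<^esub> \<zero>\<^bsub>M\<^esub> = \<zero>\<^bsub>M\<^esub>" if "a \<in> carrier R" for a using N.smult_r_null[OF that] z by simp
  have fz: "f \<zero>\<^bsub>M\<^esub> = \<zero>\<^bsub>M\<^esub>" using p(4) z by simp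
  show "fin_gen_module R (obj (two_term k M N f) n)" for n
    using M N fin_gen_trivial[OF M.module_axioms] by simp
  show "diff (two_term k M N f) n \<in> linear_maps R (obj (two_term k M N f) n) (obj (two_term k M N f) (n + 1))" for n
    by (rule linear_mapsI) (auto simp: p zN zz za)
  show "diff (two_term k M N f) (n + 1) (diff (two_term k M N f) n x) = \<zero>\<^bsub>obj (two_term k M N f) (n + 1 + 1)\<^esub>" for n x
    using z fz by auto
  have "{n. carrier (obj (two_term k M N f) n) \<noteq> {\<zero>\<^bsub>obj (two_term k M N f) n\<^esub>}} \<subseteq> {k, k + 1}" by auto
  then show "finite {n. carrier (obj (two_term k M N f) n) \<noteq> {\<zero>\<^bsub>obj (two_term k M N f) n\<^esub>}}"
    by (rule finite_subset) simp
qed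

text \<open>The cohomology of a two-term complex is the kernel and the cokernel of its map; the last
  four hypotheses say that \<open>\<alpha>\<close> and \<open>\<beta>\<close> induce bijections on
  these, phrased without forming a quotient.\<close>

lemma two_term_quasi_iso:
  assumes M: "fin_gen_module R M" and N: "fin_gen_module R N" and f: "f \<in> linear_maps R M N"
    and z: "\<zero>\<^bsub>N\<^esub> = \<zero>\<^bsub>M\<^esub>"
    and M': "fin_gen_module R M'" and N': "fin_gen_module R N'" and f': "f' \<in> linear_maps R M' N'"
    and z': "\<zero>\<^bsub>N'\<^esub> = \<zero>\<^bsub>M'\<^esub>"
    and \<alpha>: "\<alpha> \<in> linear_maps R M M'" and \<beta>: "\<beta> \<in> linear_maps R N N'"
    and comm: "\<And>m. m \<in> carrier M \<Longrightarrow> \<beta> (f m) = f' (\<alpha> m)"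
    and ker_inj: "\<And>m. m \<in> carrier M \<Longrightarrow> f m = \<zero>\<^bsub>N\<^esub> \<Longrightarrow> \<alpha> m = \<zero>\<^bsub>M'\<^esub> \<Longrightarrow> m = \<zero>\<^bsub>M\<^esub>"
    and ker_surj: "\<And>m'. m' \<in> carrier M' \<Longrightarrow> f' m' = \<zero>\<^bsub>N'\<^esub> \<Longrightarrow> \<exists>m \<in> carrier M. f m = \<zero>\<^bsub>N\<^esub> \<and> \<alpha> m = m'"
    and coker_inj: "\<And>n m'. n \<in> carrier N \<Longrightarrow> m' \<in> carrier M' \<Longrightarrow> \<beta> n = f' m' \<Longrightarrow> \<exists>m \<in> carrier M. n = f m"
    and coker_surj: "\<And>n'. n' \<in> carrier N' \<Longrightarrow> \<exists>n \<in> carrier N. \<exists>m' \<in> carrier M'. \<beta> n = f' m' \<oplus>\<^bsub>N'\<^esub> n'"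
  shows "\<exists>\<phi>. cx_qis R (two_term k M N f) (two_term k M' N' f') \<phi>"
proof -
  let ?X = "two_term k M N f" and ?Y = "two_term k M' N' f'"
  let ?\<phi> = "\<lambda>n x. if n = k then \<alpha> x else if n = k + 1 then \<beta> x else \<zero>\<^bsub>M'\<^esub>"
  interpret M: module R M by (rule fin_gen_module_module[OF M])
  interpret N: module R N by (rule fin_gen_module_module[OF N])
  interpret M': module R M' by (rule fin_gen_module_module[OF M'])
  interpret N': module R N' by (rule fin_gen_module_module[OF N'])
  note p = linear_map_props[OF M.module_axioms N.module_axioms f]
    linear_map_props[OF M'.module_axioms N'.module_axioms f']
    linear_map_props[OF M.module_axioms M'.module_axioms \<alpha>]
    linear_map_props[OF N.module_axioms N'.module_axioms \<beta>]
  note X = bounded_two_term[OF M N f z, of k] and Y = bounded_two_term[OF M' N' f' z', of k]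
  have \<beta>z: "\<beta> \<zero>\<^bsub>M\<^esub> = \<zero>\<^bsub>M'\<^esub>" using linear_map_props(4)[OF N.module_axioms N'.module_axioms \<beta>] z z' by simp
  have zN': "\<zero>\<^bsub>M'\<^esub> \<in> carrier N'" using N'.M.zero_closed z' by simp
  have "chain_map R ?X ?Y ?\<phi>"
    by (rule chain_mapI) (auto simp: p comm z z' \<beta>z)
  moreover have "quasi_iso R ?X ?Y ?\<phi>"
  proof (rule quasi_isoI[OF X Y calculation])
    fix n x b assume x: "x \<in> carrier (obj ?X n)" "diff ?X n x = \<zero>\<^bsub>obj ?X (n + 1)\<^esub>"
      and b: "b \<in> carrier (obj ?Y (n - 1))" "?\<phi> n x = diff ?Y (n - 1) b"
    consider "n = k" | "n = k + 1" | "n \<noteq> k" "n \<noteq> k + 1" by blast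
    then show "\<exists>a \<in> carrier (obj ?X (n - 1)). x = diff ?X (n - 1) a"
    proof cases
      case 1
      then have "x = \<zero>\<^bsub>M\<^esub>" using x b by (intro ker_inj) auto
      then show ?thesis using 1 by simp
    next
      case 2
      then show ?thesis using x b coker_inj[of x b] by simp
    next
      case 3
      then show ?thesis using x by (auto intro!: bexI[of _ "\<zero>\<^bsub>obj ?X (n - 1)\<^esub>"] simp: z)
    qed
  next
    fix n y assume y: "y \<in> carrier (obj ?Y n)" "diff ?Y n y = \<zero>\<^bsub>obj ?Y (n + 1)\<^esub>"
    consider "n = k" | "n = k + 1" | "n \<noteq> k" "n \<noteq> k + 1" by blast
    then show "\<exists>x \<in> carrier (obj ?X n). \<exists>b \<in> carrier (obj ?Y (n - 1)). diff ?X n x = \<zero>\<^bsub>obj ?X (n + 1)\<^esub> \<and>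
      ?\<phi> n x = diff ?Y (n - 1) b \<oplus>\<^bsub>obj ?Y n\<^esub> y"
    proof cases
      case 1
      then obtain m where "m \<in> carrier M" "f m = \<zero>\<^bsub>N\<^esub>" "\<alpha> m = y" using y ker_surj[of y] by auto
      then show ?thesis using 1 y by (intro bexI[of _ m] bexI[of _ "\<zero>\<^bsub>M'\<^esub>"]) auto
    next
      case 2
      then obtain l m' where "l \<in> carrier N" "m' \<in> carrier M'" "\<beta> l = f' m' \<oplus>\<^bsub>N'\<^esub> y" using y coker_surj[of y] by auto
      then show ?thesis using 2 y by (intro bexI[of _ l] bexI[of _ m']) auto
    next
      case 3
      then show ?thesis using y
        by (intro bexI[of _ "\<zero>\<^bsub>M\<^esub>"] bexI[of _ "\<zero>\<^bsub>M'\<^esub>"]) (auto simp: zN')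
    qed
  qed
  ultimately show ?thesis using X Y by (auto simp: cx_qis_def)
qed

subsection \<open>Additive functions\<close>

text \<open>The scalars that carry \<open>x\<close> into \<open>L\<close> form an ideal, which is
  principal. Its generator \<open>d\<close> describes the quotient of \<open>L + Rx\<close> by
  \<open>L\<close> as \<open>R/d\<close>.\<close>

lemma submodule_generated_by_one:
  assumes "principal_domain R" and M: "module R M" and L: "submodule L R M" and x: "x \<in> carrier M"
  obtains d where "d \<in> carrier R" "\<forall>a \<in> carrier R. a \<odot>\<^bsub>M\<^esub> x \<in> L \<longleftrightarrow> (\<exists>r \<in> carrier R. a = r \<otimes>\<^bsub>R\<^esub> d)"
proof -
  interpret principal_domain R by fact
  interpret M: module R M by (fact M)
  note E = M.submoduleE[OF L]
  let ?I = "{a \<in> carrier R. a \<odot>\<^bsub>M\<^esub> x \<in> L}"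
  have "subgroup ?I (add_monoid R)"
  proof (rule add.subgroupI)
    show "?I \<noteq> {}" using submodule_zero[OF L] x by (auto intro!: exI[of _ "\<zero>\<^bsub>R\<^esub>"])
    show "\<ominus>\<^bsub>R\<^esub> a \<in> ?I" if "a \<in> ?I" for a using that E(3) x by (auto simp: M.smult_l_minus)
    show "a \<oplus>\<^bsub>R\<^esub> b \<in> ?I" if "a \<in> ?I" "b \<in> ?I" for a b using that E(5) x by (auto simp: M.smult_l_distr)
  qed auto
  moreover have "b \<otimes>\<^bsub>R\<^esub> a \<in> ?I" if "a \<in> ?I" "b \<in> carrier R" for a b
    using that E(4) x by (auto simp: M.smult_assoc1)
  moreover from this have "a \<otimes>\<^bsub>R\<^esub> b \<in> ?I" if "a \<in> ?I" "b \<in> carrier R" for a b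
    using that m_comm[of a b] by auto
  ultimately have "ideal ?I R" by (intro idealI ring_axioms)
  then obtain d where d: "d \<in> carrier R" "?I = PIdl\<^bsub>R\<^esub> d" using exists_gen by blast
  have "\<forall>a \<in> carrier R. a \<odot>\<^bsub>M\<^esub> x \<in> L \<longleftrightarrow> (\<exists>r \<in> carrier R. a = r \<otimes>\<^bsub>R\<^esub> d)"
    using d(2) by (auto simp: cgenideal_def set_eq_iff)
  with d(1) show thesis by (rule that)
qed

text \<open>\<open>R\<close> lives on \<open>'a\<close>, so a copy on \<open>'a list set\<close> is
  needed to be a term of an object; \<open>\<kappa>\<close> reads off the coordinate and
  \<open>\<iota>\<close> inverts it.\<close>

lemma free_module_rank_one:
  fixes R :: "('a, 'r) ring_scheme"
  assumes "cring R"
  obtains F :: "('a, 'a list set) module" and \<kappa> \<iota> where "fin_gen_module R F"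
    "\<kappa> \<in> linear_maps R F (ring_module R)" "\<forall>a \<in> carrier R. \<iota> a \<in> carrier F \<and> \<kappa> (\<iota> a) = a"
    "\<forall>y \<in> carrier F. \<iota> (\<kappa> y) = y"
proof -
  note r = fin_gen_ring_module[OF assms]
  obtain F :: "('a, 'a list set) module" and \<iota> where F: "fin_gen_module R F" and
    \<iota>: "\<iota> \<in> linear_maps R (ring_module R) F" "bij_betw \<iota> (carrier (ring_module R)) (carrier F)"
    using fin_gen_module_small[OF r] by blast
  show thesis
    by (rule that[OF F linear_map_inverse[OF fin_gen_module_module[OF r] fin_gen_module_module[OF F] \<iota>]])
      (use bij_betw_apply[OF \<iota>(2)] bij_betw_inv_into_left[OF \<iota>(2)] bij_betw_inv_into_right[OF \<iota>(2)] in auto)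
qed

text \<open>Isolates additivity on triangles, so that the vanishing on torsion is a statement about
  arbitrary additive functions; the central charge is plugged in at the end.\<close>

locale additive_function = principal_domain R
  for R :: "('a, 'r) ring_scheme" (structure) +
  fixes z :: "('a, 'a list set) cochain \<Rightarrow> complex"
  assumes additive: "triangle (Db_mod R) A B C f g h \<Longrightarrow> z B = z A + z C"
begin

lemma z_short_exact:
  assumes "cx_mor R X Y f" and "cx_mor R Y K g"
    and "\<And>n x. x \<in> carrier (obj X n) \<Longrightarrow> f n x = \<zero>\<^bsub>obj Y n\<^esub> \<Longrightarrow> x = \<zero>\<^bsub>obj X n\<^esub>"
    and "\<And>n k. k \<in> carrier (obj K n) \<Longrightarrow> \<exists>y \<in> carrier (obj Y n). g n y = k"
    and "\<And>n x. x \<in> carrier (obj X n) \<Longrightarrow> g n (f n x) = \<zero>\<^bsub>obj K n\<^esub>"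
    and "\<And>n y. y \<in> carrier (obj Y n) \<Longrightarrow> g n y = \<zero>\<^bsub>obj K n\<^esub> \<Longrightarrow> \<exists>x \<in> carrier (obj X n). y = f n x"
  shows "z Y = z X + z K"
proof -
  have "\<exists>f g h. triangle (Db_mod R) X Y K f g h" by (rule short_exact_triangle[OF assms])
  then show ?thesis by (auto intro: additive)
qed

lemma z_zero_complex: "z zero_complex = 0"
proof -
  note O = cx_mor_id[OF bounded_zero_complex[OF is_cring]]
  have "z zero_complex = z zero_complex + z zero_complex"
    by (rule z_short_exact[OF O O]) (auto simp: zero_complex_def zero_module_def)
  then show ?thesis by simp
qed

text \<open>The cone of \<open>0 -> X\<close> is \<open>X\<close> up to quasi-isomorphism and maps
  to \<open>Y\<close> through \<open>f\<close>. By two out of three \<open>Y\<close> completes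
  \<open>0 -> X\<close> to a triangle, in which the zero complex contributes nothing.\<close>

lemma z_quasi_iso:
  assumes q: "cx_qis R X Y f"
  shows "z X = z Y"
proof -
  let ?O = "zero_complex :: ('a, 'a list set) cochain"
  have X: "bounded_complex R X" and Y: "bounded_complex R Y" using q by (simp_all add: cx_qis_def)
  note fc = cx_qis_mor[OF q]
  note O = bounded_zero_complex[OF is_cring]
  have u: "cx_mor R ?O X (\<lambda>n x. \<zero>\<^bsub>obj X n\<^esub>)" by (rule cx_mor_zero[OF O X])
  then have uc: "chain_map R ?O X (\<lambda>n x. \<zero>\<^bsub>obj X n\<^esub>)" by (simp add: cx_mor_def)
  let ?C = "cone ?O X (\<lambda>n x. \<zero>\<^bsub>obj X n\<^esub>)"
  have C: "bounded_complex R ?C" by (rule bounded_cone[OF O X uc])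
  have fc': "chain_map R X Y f" and fq: "quasi_iso R X Y f" using fc q by (simp_all add: cx_mor_def cx_qis_def)
  have w: "chain_map R ?C Y (\<lambda>n p. f n (snd p))"
    by (rule chain_mapI) (auto simp: chain_map_props[OF X Y fc'] bounded_complex_props[OF X]
        bounded_complex_props[OF Y] abelian_group_cancel)
  have "quasi_iso R X Y ((\<lambda>n p. f n (snd p)) \<circ>\<circ>\<circ> cone_in ?O)"
    using fq by (simp add: comp_def cone_in_def)
  then have "quasi_iso R ?C Y (\<lambda>n p. f n (snd p))"
    by (rule quasi_iso_cancel_right[OF X C Y cone_in_quasi_iso[OF O X uc acyclic_zero_complex] w])
  then have "\<exists>f g h. triangle (Db_mod R) ?O X Y f g h"
    using cone_triangle[OF u] C Y by (simp add: cx_qis_def)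
  then have "z X = z ?O + z Y" by (auto intro: additive)
  then show ?thesis by (simp add: z_zero_complex)
qed

lemma z_acyclic:
  assumes X: "bounded_complex R X" and a: "acyclic_complex X"
  shows "z X = 0"
proof -
  note O = bounded_zero_complex[OF is_cring]
  have "cx_qis R zero_complex X (\<lambda>n x. \<zero>\<^bsub>obj X n\<^esub>)"
    using chain_map_acyclic_quasi_iso[OF O X chain_map_zero[OF O X] acyclic_zero_complex a] O X
    by (simp add: cx_qis_def)
  from z_quasi_iso[OF this] show ?thesis by (simp add: z_zero_complex)
qed

section \<open>Values on stalks and two-term complexes\<close>

definition \<zeta> :: "int \<Rightarrow> ('a, 'a list set) module \<Rightarrow> complex" where
  "\<zeta> k M = z (stalk k M)"

lemma zeta_trivial:
  assumes "fin_gen_module R M" "carrier M = {\<zero>\<^bsub>M\<^esub>}"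
  shows "\<zeta> k M = 0"
  unfolding \<zeta>_def by (rule z_acyclic[OF bounded_stalk[OF assms(1)]]) (auto simp: acyclic_complex_def assms(2))

text \<open>The term of degree \<open>k + 1\<close> is a subcomplex, and the quotient is the term of
  degree \<open>k\<close>.\<close>

lemma z_two_term:
  assumes M: "fin_gen_module R M" and N: "fin_gen_module R N" and f: "f \<in> linear_maps R M N"
    and z: "\<zero>\<^bsub>N\<^esub> = \<zero>\<^bsub>M\<^esub>"
  shows "z (two_term k M N f) = \<zeta> (k + 1) N + \<zeta> k M"
  unfolding \<zeta>_def
proof (rule z_short_exact)
  interpret M: module R M by (rule fin_gen_module_module[OF M])
  interpret N: module R N by (rule fin_gen_module_module[OF N])
  note p = linear_map_props[OF M.module_axioms N.module_axioms f]
  note b = bounded_two_term[OF M N f z, of k] bounded_stalk[OF M, of k] bounded_stalk[OF N, of "k + 1"]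
  have fz: "f \<zero>\<^bsub>M\<^esub> = \<zero>\<^bsub>M\<^esub>" using p(4) z by simp
  show "cx_mor R (stalk (k + 1) N) (two_term k M N f) (\<lambda>n y. if n = k + 1 then y else \<zero>\<^bsub>M\<^esub>)"
    unfolding cx_mor_def
    by (intro conjI b chain_mapI) (auto simp: z fz)
  show "cx_mor R (two_term k M N f) (stalk k M) (\<lambda>n x. if n = k then x else \<zero>\<^bsub>M\<^esub>)"
    unfolding cx_mor_def
    by (intro conjI b chain_mapI) (auto simp: z fz)
  show "\<exists>y \<in> carrier (obj (two_term k M N f) n). (if n = k then y else \<zero>\<^bsub>M\<^esub>) = x"
    if "x \<in> carrier (obj (stalk k M) n)" for n x
    using that N.M.zero_closed z by (cases "n = k") auto
  show "\<exists>x \<in> carrier (obj (stalk (k + 1) N) n). y = (if n = k + 1 then x else \<zero>\<^bsub>M\<^esub>)"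
    if "y \<in> carrier (obj (two_term k M N f) n)" "(if n = k then y else \<zero>\<^bsub>M\<^esub>) = \<zero>\<^bsub>obj (stalk k M) n\<^esub>" for n y
    using that by (cases "n = k"; cases "n = k + 1") auto
qed (auto split: if_splits)

text \<open>The two-term complex of the identity is acyclic. This gives the sign of a shift
  directly, without a rotation of triangles.\<close>

lemma zeta_Suc:
  assumes M: "fin_gen_module R M"
  shows "\<zeta> (k + 1) M = - \<zeta> k M"
proof -
  have i: "(\<lambda>x. x) \<in> linear_maps R M M" by (simp add: linear_maps_def)
  have "acyclic_complex (two_term k M M (\<lambda>x. x))"
    unfolding acyclic_complex_def
  proof (intro allI ballI impI)
    interpret M: module R M by (rule fin_gen_module_module[OF M])
    fix n x assume "x \<in> carrier (obj (two_term k M M (\<lambda>x. x)) n)"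
      "diff (two_term k M M (\<lambda>x. x)) n x = \<zero>\<^bsub>obj (two_term k M M (\<lambda>x. x)) (n + 1)\<^esub>"
    then show "\<exists>b \<in> carrier (obj (two_term k M M (\<lambda>x. x)) (n - 1)). x = diff (two_term k M M (\<lambda>x. x)) (n - 1) b"
      by (cases "n = k"; cases "n = k + 1") auto
  qed
  from z_acyclic[OF bounded_two_term[OF M M i refl] this] z_two_term[OF M M i refl]
  show ?thesis by (simp add: eq_neg_iff_add_eq_0)
qed

text \<open>The two-term complex of the inclusion of \<open>L\<close> into \<open>L + Rx\<close>
  depends up to quasi-isomorphism only on \<open>d\<close>: it is \<open>d : R -> R\<close>, whose
  two terms cancel, or \<open>0 -> R\<close>. The witness \<open>v\<close> is the value on
  \<open>R\<close> and is chosen before \<open>M\<close>, \<open>L\<close> and \<open>x\<close>,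
  since it must serve for two different modules at once.\<close>

lemma zeta_adjoin:
  obtains v where "\<forall>M L x. module R M \<longrightarrow> submodule L R M \<longrightarrow> fin_gen_module R (M\<lparr>carrier := L\<rparr>) \<longrightarrow>
    x \<in> carrier M \<longrightarrow> \<zeta> k (M\<lparr>carrier := adjoin R M L x\<rparr>) = \<zeta> k (M\<lparr>carrier := L\<rparr>) +
      (if \<exists>a \<in> carrier R. a \<noteq> \<zero> \<and> a \<odot>\<^bsub>M\<^esub> x \<in> L then 0 else v)"
proof -
  obtain F :: "('a, 'a list set) module" and \<kappa> \<iota> where F: "fin_gen_module R F" and
    \<kappa>: "\<kappa> \<in> linear_maps R F (ring_module R)" and \<iota>: "\<forall>a \<in> carrier R. \<iota> a \<in> carrier F \<and> \<kappa> (\<iota> a) = a"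
    and \<iota>\<kappa>: "\<forall>y \<in> carrier F. \<iota> (\<kappa> y) = y"
    by (rule free_module_rank_one[OF is_cring])
  interpret F: module R F by (rule fin_gen_module_module[OF F])
  note kp = linear_map_props[OF F.module_axioms fin_gen_module_module[OF fin_gen_ring_module[OF is_cring]] \<kappa>, simplified]
  have k_inj: "y = y'" if "y \<in> carrier F" "y' \<in> carrier F" "\<kappa> y = \<kappa> y'" for y y'
    using that \<iota>\<kappa> by metis
  have k0: "\<kappa> y = \<zero> \<longleftrightarrow> y = \<zero>\<^bsub>F\<^esub>" if "y \<in> carrier F" for y
    using k_inj[OF that F.M.zero_closed] kp(4) by auto
  show thesis
  proof (rule that, intro allI impI)
    fix M :: "('a, 'a list set) module" and L x
    assume M: "module R M" and L: "submodule L R M" and fL: "fin_gen_module R (M\<lparr>carrier := L\<rparr>)"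
      and x: "x \<in> carrier M"
    interpret M: module R M by (fact M)
    let ?L' = "adjoin R M L x"
    let ?U = "M\<lparr>carrier := L\<rparr>" and ?U' = "M\<lparr>carrier := ?L'\<rparr>"
    note ad = adjoin_props[OF M L x]
    note fL' = ad(4)[OF fL]
    have LM: "L \<subseteq> carrier M" by (rule M.submoduleE(1)[OF L])
    note E = M.submoduleE[OF L] and E' = M.submoduleE[OF ad(1)]
    have i: "(\<lambda>x. x) \<in> linear_maps R ?U ?U'" using ad(2) by (auto simp: linear_maps_def)
    have \<beta>: "(\<lambda>y. \<kappa> y \<odot>\<^bsub>M\<^esub> x) \<in> linear_maps R F ?U'"
      by (rule linear_mapsI) (use E'(4)[OF _ ad(3)] x in \<open>auto simp: kp M.smult_l_distr M.smult_assoc1\<close>)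
    have surj: "\<exists>y \<in> carrier F. \<exists>l \<in> L. \<kappa> y \<odot>\<^bsub>M\<^esub> x = l \<oplus>\<^bsub>M\<^esub> w" if w: "w \<in> ?L'" for w
    proof -
      from w obtain l a where la: "l \<in> L" "a \<in> carrier R" "w = l \<oplus>\<^bsub>M\<^esub> a \<odot>\<^bsub>M\<^esub> x" by (auto simp: adjoin_def)
      have "l \<in> carrier M" using la LM by blast
      then have "\<kappa> (\<iota> a) \<odot>\<^bsub>M\<^esub> x = \<ominus>\<^bsub>M\<^esub> l \<oplus>\<^bsub>M\<^esub> w"
        using la x \<iota> by (simp add: abelian_group_cancel[OF M.abelian_group_axioms])
      then show ?thesis using \<iota> la E(3)[OF la(1)] by blast
    qed
    \<comment> \<open>The copy of \<open>L + Rx\<close> sits in degree \<open>k + 1\<close> and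
      counts negatively, so the inclusion measures the change of \<open>\<zeta>\<close>.\<close>
    have z_incl: "z (two_term k ?U ?U' (\<lambda>x. x)) = \<zeta> k ?U - \<zeta> k ?U'"
      using z_two_term[OF fL fL' i, of k] zeta_Suc[OF fL', of k] by simp
    obtain d where d: "d \<in> carrier R"
      and dI': "\<forall>a \<in> carrier R. a \<odot>\<^bsub>M\<^esub> x \<in> L \<longleftrightarrow> (\<exists>r \<in> carrier R. a = r \<otimes> d)"
      by (rule submodule_generated_by_one[OF principal_domain_axioms M L x])
    note dI = bspec[OF dI']
    have dx: "d \<odot>\<^bsub>M\<^esub> x \<in> L" using dI[OF d] d by (auto intro!: bexI[of _ \<one>])
    show "\<zeta> k ?U' = \<zeta> k ?U + (if \<exists>a \<in> carrier R. a \<noteq> \<zero> \<and> a \<odot>\<^bsub>M\<^esub> x \<in> L then 0 else \<zeta> k F)"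
    proof (cases "\<exists>a \<in> carrier R. a \<noteq> \<zero> \<and> a \<odot>\<^bsub>M\<^esub> x \<in> L")
      case True
      then have d0: "d \<noteq> \<zero>" using dI d by auto
      have f: "(\<lambda>y. d \<odot>\<^bsub>F\<^esub> y) \<in> linear_maps R F F"
        by (rule linear_mapsI) (use d in \<open>simp_all add: F.smult_r_distr m_comm flip: F.smult_assoc1\<close>)
      have \<alpha>: "(\<lambda>y. \<kappa> y \<odot>\<^bsub>M\<^esub> (d \<odot>\<^bsub>M\<^esub> x)) \<in> linear_maps R F ?U"
        by (rule linear_mapsI) (use E(4)[OF _ dx] x d in \<open>auto simp: kp M.smult_l_distr M.smult_assoc1\<close>)
      \<comment> \<open>The square has \<open>y -> \<kappa>(y) d x\<close> on the left and
        \<open>y -> \<kappa>(y) x\<close> on the right. Multiplication by \<open>d\<close> is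
        injective because \<open>R\<close> is a domain, and both cokernels are \<open>R/d\<close>:
        \<open>\<kappa>(n) x\<close> lies in \<open>L\<close> exactly when \<open>d\<close> divides
        \<open>\<kappa>(n)\<close>.\<close>
      have "\<exists>\<phi>. cx_qis R (two_term k F F (\<lambda>y. d \<odot>\<^bsub>F\<^esub> y)) (two_term k ?U ?U' (\<lambda>x. x)) \<phi>"
      proof (rule two_term_quasi_iso[OF F F f refl fL fL' i _ \<alpha> \<beta>])
        show "\<kappa> (d \<odot>\<^bsub>F\<^esub> m) \<odot>\<^bsub>M\<^esub> x = \<kappa> m \<odot>\<^bsub>M\<^esub> (d \<odot>\<^bsub>M\<^esub> x)" if "m \<in> carrier F" for m
          using that d x by (simp add: kp m_comm flip: M.smult_assoc1)
        show "m = \<zero>\<^bsub>F\<^esub>" if m: "m \<in> carrier F" "d \<odot>\<^bsub>F\<^esub> m = \<zero>\<^bsub>F\<^esub>" for m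
        proof -
          have "d \<otimes> \<kappa> m = \<zero>" using kp(3)[OF d m(1)] m(2) kp(4) by simp
          then have "\<kappa> m = \<zero>" using d d0 kp(1)[OF m(1)] integral_iff by auto
          then show ?thesis using k0[OF m(1)] by simp
        qed
        show "\<exists>m \<in> carrier F. n = d \<odot>\<^bsub>F\<^esub> m"
          if n: "n \<in> carrier F" and m': "m' \<in> carrier ?U" "\<kappa> n \<odot>\<^bsub>M\<^esub> x = m'" for n m'
        proof -
          have "\<kappa> n \<odot>\<^bsub>M\<^esub> x \<in> L" using m' by simp
          then obtain r where r: "r \<in> carrier R" "\<kappa> n = r \<otimes> d" using dI[OF kp(1)[OF n]] by blast
          have "n = d \<odot>\<^bsub>F\<^esub> \<iota> r" by (rule k_inj) (use n r d \<iota> in \<open>simp_all add: kp m_comm\<close>)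
          then show ?thesis using \<iota> r by blast
        qed
      qed (use surj submodule_zero[OF L] in \<open>auto intro!: bexI[of _ "\<zero>\<^bsub>F\<^esub>"] simp: d kp x\<close>)
      then have "\<zeta> k ?U - \<zeta> k ?U' = 0"
        using z_quasi_iso z_incl z_two_term[OF F F f refl, of k] zeta_Suc[OF F, of k] by auto
      then show ?thesis using True by simp
    next
      case False
      then have d0: "d = \<zero>" using d dx by blast
      let ?F0 = "F\<lparr>carrier := {\<zero>\<^bsub>F\<^esub>}\<rparr>"
      have F0: "fin_gen_module R ?F0" by (rule fin_gen_trivial[OF F.module_axioms])
      have f: "(\<lambda>y. y) \<in> linear_maps R ?F0 F" by (auto simp: linear_maps_def)
      have \<alpha>: "(\<lambda>y. \<zero>\<^bsub>M\<^esub>) \<in> linear_maps R ?F0 ?U"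
        using submodule_zero[OF L] by (auto simp: linear_maps_def)
      \<comment> \<open>No nonzero multiple of \<open>x\<close> lies in \<open>L\<close>, so the
        quotient is all of \<open>R\<close> and the left term shrinks to zero.\<close>
      have "\<exists>\<phi>. cx_qis R (two_term k ?F0 F (\<lambda>y. y)) (two_term k ?U ?U' (\<lambda>x. x)) \<phi>"
      proof (rule two_term_quasi_iso[OF F0 F f _ fL fL' i _ \<alpha> \<beta>])
        show "\<exists>m \<in> carrier ?F0. n = m"
          if n: "n \<in> carrier F" and m': "m' \<in> carrier ?U" "\<kappa> n \<odot>\<^bsub>M\<^esub> x = m'" for n m'
        proof -
          have "\<kappa> n \<odot>\<^bsub>M\<^esub> x \<in> L" using m' by simp
          then have "\<kappa> n = \<zero>" using False kp(1)[OF n] by blast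
          then show ?thesis using k0[OF n] by simp
        qed
      qed (use surj in \<open>auto simp: kp x\<close>)
      then have "\<zeta> k ?U - \<zeta> k ?U' = - \<zeta> k F"
        using z_quasi_iso z_incl z_two_term[OF F0 F f, of k] zeta_Suc[OF F, of k] zeta_trivial[OF F0, of k] by auto
      then show ?thesis unfolding if_not_P[OF False] by (simp add: algebra_simps)
    qed
  qed
qed

text \<open>Two invariants run along the list: \<open>f\<close> maps \<open>L\<close> into
  \<open>K\<close>, and whatever \<open>f\<close> sends into \<open>K\<close> is torsion modulo
  \<open>L\<close>. They make \<open>x\<close> torsion modulo \<open>L\<close> exactly when
  \<open>f x\<close> is torsion modulo \<open>K\<close>, so both sides jump by the same amount at
  each generator.\<close>

lemma zeta_foldl_adjoin:
  assumes M: "module R M" and N: "module R N" and f: "f \<in> linear_maps R M N"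
    and "set xs \<subseteq> carrier M"
    and "submodule L R M" "fin_gen_module R (M\<lparr>carrier := L\<rparr>)"
    and "submodule K R N" "fin_gen_module R (N\<lparr>carrier := K\<rparr>)"
    and "f ` L \<subseteq> K"
    and "\<And>x. x \<in> carrier M \<Longrightarrow> f x \<in> K \<Longrightarrow> \<exists>b \<in> carrier R. b \<noteq> \<zero> \<and> b \<odot>\<^bsub>M\<^esub> x \<in> L"
  shows "submodule (foldl (adjoin R M) L xs) R M \<and> L \<union> set xs \<subseteq> foldl (adjoin R M) L xs \<and>
    submodule (foldl (adjoin R N) K (map f xs)) R N \<and> K \<union> f ` set xs \<subseteq> foldl (adjoin R N) K (map f xs) \<and>
    \<zeta> k (M\<lparr>carrier := foldl (adjoin R M) L xs\<rparr>) - \<zeta> k (M\<lparr>carrier := L\<rparr>) =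
    \<zeta> k (N\<lparr>carrier := foldl (adjoin R N) K (map f xs)\<rparr>) - \<zeta> k (N\<lparr>carrier := K\<rparr>)"
  using assms(4-)
proof (induction xs arbitrary: L K)
  case (Cons x xs)
  interpret M: module R M by (fact M)
  interpret N: module R N by (fact N)
  note fp = linear_map_props[OF M N f]
  have x: "x \<in> carrier M" using Cons.prems(1) by simp
  note L = Cons.prems(2,3) and K = Cons.prems(4,5) and fL = Cons.prems(6) and tor = Cons.prems(7)
  let ?L = "adjoin R M L x" and ?K = "adjoin R N K (f x)"
  note aL = adjoin_props[OF M L(1) x] and aK = adjoin_props[OF N K(1) fp(1)[OF x]]
  have LM: "L \<subseteq> carrier M" by (rule M.submoduleE(1)[OF L(1)])
  obtain v where v: "\<forall>M L x. module R M \<longrightarrow> submodule L R M \<longrightarrow> fin_gen_module R (M\<lparr>carrier := L\<rparr>) \<longrightarrow>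
    x \<in> carrier M \<longrightarrow> \<zeta> k (M\<lparr>carrier := adjoin R M L x\<rparr>) = \<zeta> k (M\<lparr>carrier := L\<rparr>) +
      (if \<exists>a \<in> carrier R. a \<noteq> \<zero> \<and> a \<odot>\<^bsub>M\<^esub> x \<in> L then 0 else v)" by (rule zeta_adjoin)
  \<comment> \<open>For the converse direction a scalar \<open>a\<close> that works for
    \<open>f x\<close> is multiplied by a scalar \<open>b\<close> from the torsion hypothesis; the
    product is nonzero in a domain.\<close>
  have "(\<exists>a \<in> carrier R. a \<noteq> \<zero> \<and> a \<odot>\<^bsub>M\<^esub> x \<in> L) \<longleftrightarrow> (\<exists>a \<in> carrier R. a \<noteq> \<zero> \<and> a \<odot>\<^bsub>N\<^esub> f x \<in> K)"
  proof
    assume "\<exists>a \<in> carrier R. a \<noteq> \<zero> \<and> a \<odot>\<^bsub>M\<^esub> x \<in> L"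
    then obtain a where a: "a \<in> carrier R" "a \<noteq> \<zero>" "a \<odot>\<^bsub>M\<^esub> x \<in> L" by blast
    have "a \<odot>\<^bsub>N\<^esub> f x \<in> K" unfolding fp(3)[OF a(1) x, symmetric] using fL a(3) by blast
    then show "\<exists>a \<in> carrier R. a \<noteq> \<zero> \<and> a \<odot>\<^bsub>N\<^esub> f x \<in> K" using a by blast
  next
    assume "\<exists>a \<in> carrier R. a \<noteq> \<zero> \<and> a \<odot>\<^bsub>N\<^esub> f x \<in> K"
    then obtain a where a: "a \<in> carrier R" "a \<noteq> \<zero>" "a \<odot>\<^bsub>N\<^esub> f x \<in> K" by blast
    have "f (a \<odot>\<^bsub>M\<^esub> x) \<in> K" unfolding fp(3)[OF a(1) x] by (rule a(3))
    then obtain b where b: "b \<in> carrier R" "b \<noteq> \<zero>" "b \<odot>\<^bsub>M\<^esub> (a \<odot>\<^bsub>M\<^esub> x) \<in> L"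
      using tor[OF M.smult_closed[OF a(1) x]] by blast
    then show "\<exists>a \<in> carrier R. a \<noteq> \<zero> \<and> a \<odot>\<^bsub>M\<^esub> x \<in> L"
      using a x integral_iff by (intro bexI[of _ "b \<otimes> a"]) (auto simp: M.smult_assoc1)
  qed
  then have step: "\<zeta> k (M\<lparr>carrier := ?L\<rparr>) - \<zeta> k (M\<lparr>carrier := L\<rparr>) = \<zeta> k (N\<lparr>carrier := ?K\<rparr>) - \<zeta> k (N\<lparr>carrier := K\<rparr>)"
    using v[rule_format, OF M L x] v[rule_format, OF N K fp(1)[OF x]] by simp
  have fL': "f ` ?L \<subseteq> ?K"
  proof
    fix y assume "y \<in> f ` ?L"
    then obtain l a where la: "l \<in> L" "a \<in> carrier R" "y = f (l \<oplus>\<^bsub>M\<^esub> a \<odot>\<^bsub>M\<^esub> x)" by (auto simp: adjoin_def)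
    then have "y = f l \<oplus>\<^bsub>N\<^esub> a \<odot>\<^bsub>N\<^esub> f x" using LM x by (simp add: fp subset_iff)
    moreover have "f l \<in> K" using fL la by blast
    ultimately show "y \<in> ?K" using la unfolding adjoin_def by blast
  qed
  have tor': "\<exists>b \<in> carrier R. b \<noteq> \<zero> \<and> b \<odot>\<^bsub>M\<^esub> y \<in> ?L" if y: "y \<in> carrier M" and fy: "f y \<in> ?K" for y
  proof -
    from fy obtain c a where ca: "c \<in> K" "a \<in> carrier R" "f y = c \<oplus>\<^bsub>N\<^esub> a \<odot>\<^bsub>N\<^esub> f x" by (auto simp: adjoin_def)
    have c: "c \<in> carrier N" using N.submoduleE(1)[OF K(1)] ca by blast
    \<comment> \<open>Removing a multiple of \<open>x\<close> from \<open>y\<close> brings the image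
      back into \<open>K\<close>, where the torsion hypothesis for \<open>L\<close> applies; putting
      it back costs a multiple of \<open>x\<close>, which is available in the enlarged
      submodule.\<close>
    have "f (y \<oplus>\<^bsub>M\<^esub> \<ominus>\<^bsub>M\<^esub> (a \<odot>\<^bsub>M\<^esub> x)) = c"
      using ca c x y by (simp add: fp abelian_group_cancel[OF N.abelian_group_axioms])
    then obtain b where b: "b \<in> carrier R" "b \<noteq> \<zero>" "b \<odot>\<^bsub>M\<^esub> (y \<oplus>\<^bsub>M\<^esub> \<ominus>\<^bsub>M\<^esub> (a \<odot>\<^bsub>M\<^esub> x)) \<in> L"
      using tor[of "y \<oplus>\<^bsub>M\<^esub> \<ominus>\<^bsub>M\<^esub> (a \<odot>\<^bsub>M\<^esub> x)"] ca(1,2) x y by (metis M.M.a_closed M.M.a_inv_closed M.smult_closed)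
    have "b \<odot>\<^bsub>M\<^esub> y = b \<odot>\<^bsub>M\<^esub> (y \<oplus>\<^bsub>M\<^esub> \<ominus>\<^bsub>M\<^esub> (a \<odot>\<^bsub>M\<^esub> x)) \<oplus>\<^bsub>M\<^esub> (b \<otimes> a) \<odot>\<^bsub>M\<^esub> x"
      using b ca x y by (simp add: M.smult_r_distr M.smult_r_minus M.smult_assoc1
          abelian_group_cancel[OF M.abelian_group_axioms])
    then have "b \<odot>\<^bsub>M\<^esub> y \<in> ?L" unfolding adjoin_def using b ca by blast
    with b show ?thesis by blast
  qed
  have diff_trans: "a - e = c - g" if "a - b = c - d" "b - e = d - g" for a b c d e g :: complex
    using arg_cong2[OF that, of "(+)"] by simp
  have xs: "set xs \<subseteq> carrier M" using Cons.prems(1) by simp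
  from Cons.IH[OF xs aL(1) aL(4)[OF L(2)] aK(1) aK(4)[OF K(2)] fL' tor']
  have IH: "submodule (foldl (adjoin R M) ?L xs) R M" "?L \<union> set xs \<subseteq> foldl (adjoin R M) ?L xs"
    "submodule (foldl (adjoin R N) ?K (map f xs)) R N" "?K \<union> f ` set xs \<subseteq> foldl (adjoin R N) ?K (map f xs)"
    "\<zeta> k (M\<lparr>carrier := foldl (adjoin R M) ?L xs\<rparr>) - \<zeta> k (M\<lparr>carrier := ?L\<rparr>) =
      \<zeta> k (N\<lparr>carrier := foldl (adjoin R N) ?K (map f xs)\<rparr>) - \<zeta> k (N\<lparr>carrier := ?K\<rparr>)" by simp_all
  have "L \<union> set (x # xs) \<subseteq> foldl (adjoin R M) ?L xs" using IH(2) aL(2,3) by auto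
  moreover have "K \<union> f ` set (x # xs) \<subseteq> foldl (adjoin R N) ?K (map f xs)" using IH(4) aK(2,3) by auto
  ultimately show ?case
    unfolding foldl_Cons list.map using IH(1,3) diff_trans[OF IH(5) step] by blast
qed auto

text \<open>Adjoin generators of \<open>M\<close> to \<open>L\<close> and their images to the zero
  submodule of \<open>N\<close>: both chains rise by the same total and end at \<open>M\<close> and
  \<open>N\<close>. It is enough that \<open>L\<close> exhausts the kernel of \<open>f\<close> up to
  torsion, so cohomology never has to be formed as a module.\<close>

lemma zeta_torsion_exact:
  assumes M: "fin_gen_module R M" and N: "fin_gen_module R N" and f: "f \<in> linear_maps R M N"
    and surj: "f ` carrier M = carrier N"
    and L: "submodule L R M" "fin_gen_module R (M\<lparr>carrier := L\<rparr>)" and fL: "f ` L \<subseteq> {\<zero>\<^bsub>N\<^esub>}"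
    and tor: "\<And>x. x \<in> carrier M \<Longrightarrow> f x = \<zero>\<^bsub>N\<^esub> \<Longrightarrow> \<exists>b \<in> carrier R. b \<noteq> \<zero> \<and> b \<odot>\<^bsub>M\<^esub> x \<in> L"
  shows "\<zeta> k M = \<zeta> k (M\<lparr>carrier := L\<rparr>) + \<zeta> k N"
proof -
  obtain S where S: "finite S" "S \<subseteq> carrier M" and gen: "\<And>H. submodule H R M \<Longrightarrow> S \<subseteq> H \<Longrightarrow> H = carrier M"
    using M by (auto simp: fin_gen_module_def)
  obtain xs where xs: "set xs = S" using finite_list[OF S(1)] by blast
  note M' = fin_gen_module_module[OF M] and N' = fin_gen_module_module[OF N]
  note K = fin_gen_trivial[OF N']
  let ?L = "foldl (adjoin R M) L xs" and ?K = "foldl (adjoin R N) {\<zero>\<^bsub>N\<^esub>} (map f xs)"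
  have *: "submodule ?L R M" "set xs \<subseteq> ?L" "submodule ?K R N" "f ` set xs \<subseteq> ?K"
    "\<zeta> k (M\<lparr>carrier := ?L\<rparr>) - \<zeta> k (M\<lparr>carrier := L\<rparr>) = \<zeta> k (N\<lparr>carrier := ?K\<rparr>) - \<zeta> k (N\<lparr>carrier := {\<zero>\<^bsub>N\<^esub>}\<rparr>)"
    using zeta_foldl_adjoin[OF M' N' f _ L K(2,1) fL, of xs k] tor xs S(2) by auto
  have "?L = carrier M" using gen[OF *(1)] *(2) xs by simp
  moreover have "?K = carrier N"
  proof -
    have "{m \<in> carrier M. f m \<in> ?K} = carrier M"
      by (rule gen[OF preimage_submodule[OF M' N' f *(3)]]) (use *(4) xs S in auto)
    then have "f ` carrier M \<subseteq> ?K" by blast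
    then have "carrier N \<subseteq> ?K" using surj by simp
    then show ?thesis using module.submoduleE(1)[OF N' *(3)] by auto
  qed
  ultimately show ?thesis using *(5) zeta_trivial[OF K(1), of k] by (simp add: algebra_simps)
qed

text \<open>Each term contributes the values of its own coboundaries and of the next ones, the
  latter with opposite sign once they are moved to their own degree. Over the whole complex the sum
  telescopes to zero.\<close>

lemma z_torsion:
  assumes A: "bounded_complex R A"
    and tor: "\<And>n x. x \<in> carrier (obj A n) \<Longrightarrow> diff A n x = \<zero>\<^bsub>obj A (n + 1)\<^esub> \<Longrightarrow>
      \<exists>b \<in> carrier R. b \<noteq> \<zero> \<and> b \<odot>\<^bsub>obj A n\<^esub> x \<in> coboundaries A n"
  shows "z A = 0"
proof -
  note simps = bounded_complex_props[OF A] abelian_group_cancel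
  note fg = bounded_complex_fin_gen[OF A] and md = bounded_complex_module[OF A]
  let ?B = "\<lambda>n. (obj A n)\<lparr>carrier := coboundaries A n\<rparr>"
  have dl: "diff A (n - 1) \<in> linear_maps R (obj A (n - 1)) (obj A n)" for n
    using diff_linear[OF A, of "n - 1"] by simp
  have Bs: "submodule (coboundaries A n) R (obj A n)" for n
    unfolding coboundaries_def by (rule image_submodule[OF md md dl])
  have B: "fin_gen_module R (?B n)" for n
    unfolding coboundaries_def by (rule fin_gen_image[OF fg md dl])
  have dB: "diff A n \<in> linear_maps R (obj A n) (?B (n + 1))" for n
    by (rule linear_mapsI) (auto simp: simps coboundaries_def)
  have split: "\<zeta> k (obj A k) = \<zeta> k (?B k) - \<zeta> (k + 1) (?B (k + 1))" for k
  proof -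
    \<comment> \<open>Torsion cohomology means that the coboundaries exhaust the kernel of
      \<open>diff A k\<close> up to torsion; the image of \<open>diff A k\<close> is the next module
      of coboundaries.\<close>
    have "\<zeta> k (obj A k) = \<zeta> k (?B k) + \<zeta> k (?B (k + 1))"
    proof (rule zeta_torsion_exact[OF fg B dB _ Bs B])
      show "diff A k ` carrier (obj A k) = carrier (?B (k + 1))" by (simp add: coboundaries_def)
      show "diff A k ` coboundaries A k \<subseteq> {\<zero>\<^bsub>?B (k + 1)\<^esub>}"
        by (auto simp: coboundaries_def bounded_complex_props(7)[OF A])
    qed (use tor in simp)
    then show ?thesis using zeta_Suc[OF B, of k "k + 1"] by simp
  qed
  \<comment> \<open>The brutal truncation to degrees at least \<open>k\<close>; consecutive
    truncations differ by a stalk.\<close>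
  define \<sigma> where "\<sigma> k = \<lparr>obj = (\<lambda>n. if k \<le> n then obj A n else (obj A n)\<lparr>carrier := {\<zero>\<^bsub>obj A n\<^esub>}\<rparr>),
    diff = diff A\<rparr>" for k
  have \<sigma>: "obj (\<sigma> k) n = (if k \<le> n then obj A n else (obj A n)\<lparr>carrier := {\<zero>\<^bsub>obj A n\<^esub>}\<rparr>)" "diff (\<sigma> k) = diff A" for k n
    by (simp_all add: \<sigma>_def)
  have \<sigma>b: "bounded_complex R (\<sigma> k)" for k
  proof (rule bounded_complexI)
    show "fin_gen_module R (obj (\<sigma> k) n)" for n using fg fin_gen_trivial[OF md] by (simp add: \<sigma>)
    show "diff (\<sigma> k) n \<in> linear_maps R (obj (\<sigma> k) n) (obj (\<sigma> k) (n + 1))" for n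
      by (rule linear_mapsI) (auto simp: \<sigma> simps split: if_splits)
    show "diff (\<sigma> k) (n + 1) (diff (\<sigma> k) n x) = \<zero>\<^bsub>obj (\<sigma> k) (n + 1 + 1)\<^esub>" if "x \<in> carrier (obj (\<sigma> k) n)" for n x
    proof -
      have "x \<in> carrier (obj A n)" using that by (auto simp: \<sigma> simps split: if_splits)
      then show ?thesis using bounded_complex_props(7)[OF A, of x n "n + 1"] by (simp add: \<sigma>)
    qed
    have "{n. carrier (obj (\<sigma> k) n) \<noteq> {\<zero>\<^bsub>obj (\<sigma> k) n\<^esub>}} \<subseteq> {n. carrier (obj A (n + 0)) \<noteq> {\<zero>\<^bsub>obj A (n + 0)\<^esub>}}"
      by (auto simp: \<sigma> split: if_splits)
    then show "finite {n. carrier (obj (\<sigma> k) n) \<noteq> {\<zero>\<^bsub>obj (\<sigma> k) n\<^esub>}}"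
      by (rule finite_subset) (rule bounded_complex_finite[OF A])
  qed
  have trunc: "z (\<sigma> k) = z (\<sigma> (k + 1)) + \<zeta> k (obj A k)" for k
    unfolding \<zeta>_def
  proof (rule z_short_exact)
    show "cx_mor R (\<sigma> (k + 1)) (\<sigma> k) (\<lambda>n x. x)"
      unfolding cx_mor_def by (intro conjI \<sigma>b chain_mapI) (auto simp: \<sigma> simps split: if_splits)
    show "cx_mor R (\<sigma> k) (stalk k (obj A k)) (\<lambda>n x. if n = k then x else \<zero>\<^bsub>obj A k\<^esub>)"
      unfolding cx_mor_def
    proof (intro conjI \<sigma>b bounded_stalk[OF fg] chain_mapI)
      fix n x assume "x \<in> carrier (obj (\<sigma> k) n)"
      then show "diff (stalk k (obj A k)) n (if n = k then x else \<zero>\<^bsub>obj A k\<^esub>) =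
        (if n + 1 = k then diff (\<sigma> k) n x else \<zero>\<^bsub>obj A k\<^esub>)"
        by (auto simp: \<sigma> simps split: if_splits)
    qed (auto simp: \<sigma> simps split: if_splits)
    show "\<exists>x \<in> carrier (obj (\<sigma> (k + 1)) n). y = x"
      if "y \<in> carrier (obj (\<sigma> k) n)" "(if n = k then y else \<zero>\<^bsub>obj A k\<^esub>) = \<zero>\<^bsub>obj (stalk k (obj A k)) n\<^esub>" for n y
      using that by (cases "n = k") (auto simp: \<sigma> split: if_splits)
    show "\<exists>y \<in> carrier (obj (\<sigma> k) n). (if n = k then y else \<zero>\<^bsub>obj A k\<^esub>) = x"
      if "x \<in> carrier (obj (stalk k (obj A k)) n)" for n x
    proof (cases "n = k")
      case False
      have "\<zero>\<^bsub>obj A n\<^esub> \<in> carrier (obj (\<sigma> k) n)" by (simp add: \<sigma> simps)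
      then show ?thesis using that False by (intro bexI[of _ "\<zero>\<^bsub>obj A n\<^esub>"]) simp_all
    qed (use that in \<open>simp add: \<sigma>\<close>)
  qed (auto simp: \<sigma> split: if_splits)
  \<comment> \<open>By \<open>trunc\<close> and \<open>split\<close> both parts change by the same
    amount from \<open>k\<close> to \<open>k + 1\<close>, so the difference is constant and can be
    evaluated beyond either end of the complex.\<close>
  define w where "w k = z (\<sigma> k) - \<zeta> k (?B k)" for k
  have w: "w k = w (k + 1)" for k using trunc[of k] split[of k] by (simp add: w_def)
  have "w k = w (k + int m)" for k m
  proof (induction m)
    case (Suc m)
    then show ?case using w[of "k + int m"] by (simp add: add.assoc add.commute[of 1])
  qed simp
  then have w_const: "w k = w l" if "k \<le> l" for k l
    using that by (metis zle_iff_zadd)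
  have "finite {n. carrier (obj A (n + 0)) \<noteq> {\<zero>\<^bsub>obj A (n + 0)\<^esub>}}" by (rule bounded_complex_finite[OF A])
  then have fin: "finite (insert 0 {n. carrier (obj A n) \<noteq> {\<zero>\<^bsub>obj A n\<^esub>}})" by simp
  \<comment> \<open>The \<open>0\<close> keeps the set nonempty when all terms are zero. The margin
    of one places \<open>lo\<close> and \<open>hi\<close> outside the support, so the coboundaries
    vanish there as well.\<close>
  let ?N = "insert 0 {n. carrier (obj A n) \<noteq> {\<zero>\<^bsub>obj A n\<^esub>}}"
  define lo hi where "lo = Min ?N - 1" and "hi = Max ?N + 1"
  have triv: "carrier (obj A n) = {\<zero>\<^bsub>obj A n\<^esub>}" if "n \<le> lo \<or> hi \<le> n" for n
  proof (rule ccontr)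
    assume "carrier (obj A n) \<noteq> {\<zero>\<^bsub>obj A n\<^esub>}"
    then have "n \<in> ?N" by simp
    then have "Min ?N \<le> n" "n \<le> Max ?N" using fin by (intro Min_le Max_ge; simp)+
    then show False using that by (auto simp: lo_def hi_def)
  qed
  have Bt: "\<zeta> k (?B k) = 0" if "k \<le> lo \<or> hi \<le> k" for k
  proof (rule zeta_trivial[OF B])
    show "carrier (?B k) = {\<zero>\<^bsub>?B k\<^esub>}"
      using module.submoduleE(1)[OF md Bs, of k] triv[OF that] submodule_zero[OF Bs, of k] by auto
  qed
  have "acyclic_complex (\<sigma> hi)"
    unfolding acyclic_complex_def
  proof (intro allI ballI impI)
    fix n x assume "x \<in> carrier (obj (\<sigma> hi) n)"
    then have x: "x = \<zero>\<^bsub>obj A n\<^esub>" using triv[of n] by (auto simp: \<sigma> split: if_splits)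
    have "\<zero>\<^bsub>obj A (n - 1)\<^esub> \<in> carrier (obj (\<sigma> hi) (n - 1))" by (simp add: \<sigma> simps)
    then show "\<exists>b \<in> carrier (obj (\<sigma> hi) (n - 1)). x = diff (\<sigma> hi) (n - 1) b"
      unfolding x by (intro bexI[of _ "\<zero>\<^bsub>obj A (n - 1)\<^esub>"]) (simp_all add: \<sigma> simps)
  qed
  then have "w hi = 0" using z_acyclic[OF \<sigma>b] Bt[of hi] by (simp add: w_def)
  moreover have "Min ?N \<le> Max ?N" using fin by (intro Min_le Max_in) auto
  then have "lo \<le> hi" by (simp add: lo_def hi_def)
  ultimately have "w lo = 0" using w_const by simp
  then have "z (\<sigma> lo) = 0" using Bt[of lo] by (simp add: w_def)
  moreover have eq: "carrier (obj (\<sigma> lo) n) = carrier (obj A n)" for n using triv[of n] by (auto simp: \<sigma>)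
  \<comment> \<open>Below \<open>lo\<close> the terms of \<open>A\<close> are already zero, so the
    truncation has the same carriers and the identity is an isomorphism of complexes.\<close>
  have c: "chain_map R (\<sigma> lo) A (\<lambda>n x. x)" "chain_map R A (\<sigma> lo) (\<lambda>n x. x)"
    by (rule chain_mapI; (simp only: eq)?; simp add: \<sigma>)+
  have "cx_qis R (\<sigma> lo) A (\<lambda>n x. x)"
    using inverse_chain_maps_quasi_iso[OF \<sigma>b A c] \<sigma>b A by (simp add: cx_qis_def)
  then have "z (\<sigma> lo) = z A" by (rule z_quasi_iso)
  ultimately show ?thesis by simp
qed

end

section \<open>Stability conditions on the derived category of a principal ideal domain\<close>

lemma nonzero_nonunit:
  assumes "principal_domain R" and "\<not> field R"
  obtains p where "p \<in> carrier R" "p \<noteq> \<zero>\<^bsub>R\<^esub>" "p \<notin> Units R"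
proof -
  interpret principal_domain R by fact
  have "Units R \<noteq> carrier R - {\<zero>\<^bsub>R\<^esub>}" using assms(2) by (auto simp: field_def field_axioms_def domain_axioms)
  moreover have "Units R \<subseteq> carrier R - {\<zero>\<^bsub>R\<^esub>}" using zero_not_one by (auto simp: Units_def)
  ultimately show thesis using that by blast
qed

section \<open>Scalars acting on the derived category\<close>

lemma cx_mor_smult: "bounded_complex R X \<Longrightarrow> a \<in> carrier R \<Longrightarrow> cx_mor R X X (\<lambda>n x. a \<odot>\<^bsub>obj X n\<^esub> x)"
  by (simp add: cx_mor_def chain_map_smult)

text \<open>Both legs of a roof are linear, so multiplication by \<open>a\<close> on the apex
  completes the square over \<open>X\<close> and can be pulled out through \<open>f\<close> to
  \<open>Y\<close>.\<close>

lemma D_comp_smult: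
  fixes X Y :: "('a, 'a list set) cochain"
  assumes b: "bounded_complex R X" "bounded_complex R Y" and a: "a \<in> carrier R" and \<phi>: "\<phi> \<in> D_hom R X Y"
  shows "D_comp R \<phi> (D_of R X X (\<lambda>n x. a \<odot>\<^bsub>obj X n\<^esub> x)) = D_comp R (D_of R Y Y (\<lambda>n x. a \<odot>\<^bsub>obj Y n\<^esub> x)) \<phi>"
proof -
  obtain W s f where r: "cx_qis R W X s" "cx_mor R W Y f" "\<phi> = D_mor R X Y W s f"
    by (rule D_homE[OF b \<phi>])
  have W: "bounded_complex R W" and sc: "chain_map R W X s" and fc: "chain_map R W Y f"
    using r(2) cx_qis_mor[OF r(1)] by (simp_all add: cx_mor_def)
  note aX = cx_mor_smult[OF b(1) a] and aY = cx_mor_smult[OF b(2) a] and aW = cx_mor_smult[OF W a]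
  have "homotopic R W X (\<lambda>n x. a \<odot>\<^bsub>obj X n\<^esub> s n x) (\<lambda>n x. s n (a \<odot>\<^bsub>obj W n\<^esub> x))"
    using cx_mor_comp[OF cx_qis_mor[OF r(1)] aW]
    by (intro homotopic_cong[OF W b(1)]) (simp_all add: cx_mor_def chain_map_props(3)[OF W b(1) sc] a)
  then have h: "cx_homot R W X (\<lambda>n x. a \<odot>\<^bsub>obj X n\<^esub> s n x) (\<lambda>n x. s n (a \<odot>\<^bsub>obj W n\<^esub> x))"
    using cx_mor_comp[OF cx_qis_mor[OF r(1)] aW] cx_mor_comp[OF aX cx_qis_mor[OF r(1)]] by (simp add: cx_homot_def)
  have "homotopic R W Y (\<lambda>n x. f n (a \<odot>\<^bsub>obj W n\<^esub> x)) (\<lambda>n x. a \<odot>\<^bsub>obj Y n\<^esub> f n x)"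
    using cx_mor_comp[OF aY r(2)]
    by (intro homotopic_cong[OF W b(2)]) (simp_all add: cx_mor_def chain_map_props(3)[OF W b(2) fc] a)
  then have h': "cx_homot R W Y (\<lambda>n x. f n (a \<odot>\<^bsub>obj W n\<^esub> x)) (\<lambda>n x. a \<odot>\<^bsub>obj Y n\<^esub> f n x)"
    using cx_mor_comp[OF r(2) aW] cx_mor_comp[OF aY r(2)] by (simp add: cx_homot_def)
  have "D_comp R \<phi> (D_of R X X (\<lambda>n x. a \<odot>\<^bsub>obj X n\<^esub> x)) = D_mor R X Y W s (\<lambda>n x. f n (a \<odot>\<^bsub>obj W n\<^esub> x))"
    unfolding r(3) by (rule D_comp_of_right[OF aX r(1,2) r(1) aW h])
  also have "\<dots> = D_mor R X Y W s (\<lambda>n x. a \<odot>\<^bsub>obj Y n\<^esub> f n x)"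
    unfolding D_mor_eq_iff[OF r(1) cx_mor_comp[OF r(2) aW] r(1) cx_mor_comp[OF aY r(2)]]
    by (rule roof_equivI[OF r(1) cx_mor_comp[OF r(2) aW] r(1) cx_mor_comp[OF aY r(2)] cx_qis_id[OF W]
          cx_mor_id[OF W] cx_homot_refl[OF cx_qis_mor[OF r(1)]] h'])
  also have "\<dots> = D_comp R (D_of R Y Y (\<lambda>n x. a \<odot>\<^bsub>obj Y n\<^esub> x)) \<phi>"
    unfolding r(3) by (rule D_comp_of_left[symmetric, OF r(1,2) aY])
  finally show ?thesis .
qed

text \<open>Every cocycle is cohomologous to some \<open>t v\<close> for a quasi-isomorphism
  \<open>t\<close> after which multiplication by \<open>a\<close> is null homotopic.\<close>

lemma smult_zero_cohomology:
  fixes X :: "('a, 'a list set) cochain"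
  assumes X: "bounded_complex R X" and a: "a \<in> carrier R"
    and zero: "D_of R X X (\<lambda>n x. a \<odot>\<^bsub>obj X n\<^esub> x) = D_zero R X X" and x: "x \<in> cocycles X n"
  shows "a \<odot>\<^bsub>obj X n\<^esub> x \<in> coboundaries X n"
proof -
  note aX = cx_mor_smult[OF X a]
  obtain V :: "('a, 'a list set) cochain" and t where V: "cx_qis R V X t"
    "cx_homot R V X (\<lambda>n x. a \<odot>\<^bsub>obj X n\<^esub> t n x) (\<lambda>n x. \<zero>\<^bsub>obj X n\<^esub>)"
    using zero unfolding D_of_mor D_mor_zero_iff[OF cx_qis_id[OF X] aX] by blast
  have Vb: "bounded_complex R V" and q: "quasi_iso R V X t"
    and H: "homotopic R V X (\<lambda>n x. a \<odot>\<^bsub>obj X n\<^esub> t n x) (\<lambda>n x. \<zero>\<^bsub>obj X n\<^esub>)"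
    and c: "chain_map R V X (\<lambda>n x. a \<odot>\<^bsub>obj X n\<^esub> t n x)"
    using V by (simp_all add: cx_qis_def cx_homot_def cx_mor_def)
  obtain v where v: "v \<in> cocycles V n" "cohomologous X n (t n v) x"
    using q[unfolded quasi_iso_iff[OF Vb X]] x by blast
  have "cohomologous X n (a \<odot>\<^bsub>obj X n\<^esub> x) \<zero>\<^bsub>obj X n\<^esub>"
    using cohomologous_trans[OF X cohomologous_sym[OF X chain_map_cohomologous[OF X X chain_map_smult[OF X a] v(2)]]
      homotopic_cohomologous[OF Vb X c chain_map_zero[OF Vb X] H v(1)]] .
  then obtain b where "b \<in> carrier (obj X (n - 1))" "a \<odot>\<^bsub>obj X n\<^esub> x = diff X (n - 1) b \<oplus>\<^bsub>obj X n\<^esub> \<zero>\<^bsub>obj X n\<^esub>"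
    by (auto simp: cohomologous_def)
  then show ?thesis
    unfolding coboundaries_def
    by (intro image_eqI[of _ _ b]) (simp_all add: bounded_complex_props[OF X] abelian_group_cancel)
qed

text \<open>Up to a shift, the cone of \<open>p\<close> is the complex \<open>p : F -> F\<close>
  with a copy \<open>F\<close> of \<open>R\<close> on the right type, which is an object as it
  stands. Its cokernel \<open>R/p\<close> is nonzero because \<open>p\<close> is not a unit.\<close>

lemma torsion_complex_exists:
  fixes R :: "('a, 'r) ring_scheme"
  assumes "cring R" and p: "p \<in> carrier R" "p \<notin> Units R"
  obtains X :: "('a, 'a list set) cochain" where "bounded_complex R X" "\<not> acyclic_complex X"
    "D_of R X X (\<lambda>n x. p \<odot>\<^bsub>obj X n\<^esub> x) = D_zero R X X"
proof -
  interpret cring R by fact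
  obtain F :: "('a, 'a list set) module" and \<kappa> \<iota> where F: "fin_gen_module R F" and
    \<kappa>: "\<kappa> \<in> linear_maps R F (ring_module R)" and \<iota>: "\<forall>a \<in> carrier R. \<iota> a \<in> carrier F \<and> \<kappa> (\<iota> a) = a"
    by (rule free_module_rank_one[OF is_cring])
  interpret F: module R F by (rule fin_gen_module_module[OF F])
  note kp = linear_map_props[OF F.module_axioms fin_gen_module_module[OF fin_gen_ring_module[OF is_cring]] \<kappa>, simplified]
  let ?f = "\<lambda>y. p \<odot>\<^bsub>F\<^esub> y"
  let ?X = "two_term 0 F F ?f"
  have f: "?f \<in> linear_maps R F F"
    by (rule linear_mapsI) (use p in \<open>simp_all add: F.smult_r_distr m_comm flip: F.smult_assoc1\<close>)
  note X = bounded_two_term[OF F F f refl, of 0]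
  have "\<not> acyclic_complex ?X"
  proof
    assume "acyclic_complex ?X"
    \<comment> \<open>In degree \<open>1\<close> everything is a cocycle, so acyclicity would make
      the element with coordinate \<open>\<one>\<close> a multiple of \<open>p\<close>.\<close>
    from this[unfolded acyclic_complex_def, rule_format, of "\<iota> \<one>\<^bsub>R\<^esub>" 1]
    obtain b where b: "b \<in> carrier F" "\<iota> \<one>\<^bsub>R\<^esub> = p \<odot>\<^bsub>F\<^esub> b"
      using \<iota> by auto
    then have "\<one>\<^bsub>R\<^esub> = p \<otimes>\<^bsub>R\<^esub> \<kappa> b" using \<iota> kp(3)[OF p(1) b(1)] by (metis one_closed)
    then have "p \<in> Units R" using p kp(1)[OF b(1)] m_comm[of p "\<kappa> b"] unfolding Units_def by auto
    with p show False by simp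
  qed
  moreover have "homotopic R ?X ?X (\<lambda>n x. p \<odot>\<^bsub>obj ?X n\<^esub> x) (\<lambda>n x. \<zero>\<^bsub>obj ?X n\<^esub>)"
  \<comment> \<open>The identity from degree \<open>1\<close> to degree \<open>0\<close>: composed
    with the differential in either order it gives multiplication by \<open>p\<close>.\<close>
  proof (rule homotopicI[where h = "\<lambda>n x. if n = 1 then x else \<zero>\<^bsub>F\<^esub>"])
    fix n x assume x: "x \<in> carrier (obj ?X n)"
    consider "n = 0" | "n = 1" | "n \<noteq> 0" "n \<noteq> 1" by blast
    then show "p \<odot>\<^bsub>obj ?X n\<^esub> x \<ominus>\<^bsub>obj ?X n\<^esub> \<zero>\<^bsub>obj ?X n\<^esub> = diff ?X (n - 1) (if n = 1 then x else \<zero>\<^bsub>F\<^esub>) \<oplus>\<^bsub>obj ?X n\<^esub>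
      (if n + 1 = 1 then diff ?X n x else \<zero>\<^bsub>F\<^esub>)"
    proof cases
      case 3
      then have "x = \<zero>\<^bsub>F\<^esub>" using x by simp
      moreover have "\<zero>\<^bsub>F\<^esub> \<ominus>\<^bsub>obj ?X n\<^esub> \<zero>\<^bsub>obj ?X n\<^esub> = \<zero>\<^bsub>F\<^esub>"
        using abelian_group_cancel(11,12)[OF bounded_complex_props(1)[OF X, of n]] 3 by simp
      ultimately show ?thesis using 3 p by simp
    qed (use x p in \<open>simp_all add: abelian_group_cancel[OF F.abelian_group_axioms]\<close>)
  qed auto
  then have "cx_homot R ?X ?X (\<lambda>n x. p \<odot>\<^bsub>obj ?X n\<^esub> x) (\<lambda>n x. \<zero>\<^bsub>obj ?X n\<^esub>)"
    using cx_mor_smult[OF X p(1)] cx_mor_zero[OF X X] by (simp only: cx_homot_def)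
  then have "D_of R ?X ?X (\<lambda>n x. p \<odot>\<^bsub>obj ?X n\<^esub> x) = D_zero R ?X ?X"
    unfolding D_zero_def by (rule D_of_homot)
  ultimately show thesis using X by (intro that)
qed

text \<open>If \<open>p\<close> kills \<open>X\<close>, it kills the first nonzero term of a Harder--Narasimhan filtration of \<open>X\<close>,
  because \<open>Hom(T[1], A j) = 0\<close> for all its cones makes \<open>Hom(T, T) \<rightarrow> Hom(T, X)\<close> injective.\<close>

lemma slicing_first_factor:
  fixes X :: "('a, 'a list set) cochain"
  assumes P: "slicing (Db_mod R) P" and X: "bounded_complex R X" "\<not> acyclic_complex X"
    and a: "a \<in> carrier R" and aX: "D_of R X X (\<lambda>n x. a \<odot>\<^bsub>obj X n\<^esub> x) = D_zero R X X"
  obtains T \<phi> where "T \<in> P \<phi>" "bounded_complex R T" "\<not> acyclic_complex T"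
    "D_of R T T (\<lambda>n x. a \<odot>\<^bsub>obj T n\<^esub> x) = D_zero R T T"
proof -
  have full: "full_additive_subcategory (Db_mod R) (P \<phi>)" for \<phi> using P by (simp add: slicing_def)
  have shift: "P (\<phi> + 1) = {X \<in> Obj (Db_mod R). \<exists>E \<in> P \<phi>. isomorphic (Db_mod R) X (Shift (Db_mod R) E)}" for \<phi>
    using P by (simp add: slicing_def)
  have orth: "D_hom R A B = {D_zero R A B}" if "\<psi> < \<phi>" "A \<in> P \<phi>" "B \<in> P \<psi>" for \<phi> \<psi> A B
    using P that by (simp add: slicing_def)
  have "\<exists>n \<phi> E A. HN_filtration (Db_mod R) P X n \<phi> E A"
    using P X zero_object_iff[OF X(1)] by (simp add: slicing_def)
  then obtain n \<phi> E A where HN: "HN_filtration (Db_mod R) P X n \<phi> E A" by blast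
  have E0: "zero_object (Db_mod R) (E 0)" and En: "E n = X"
    and \<phi>: "\<And>i j. i < j \<Longrightarrow> j < n \<Longrightarrow> \<phi> j < \<phi> i" and A: "\<And>j. j < n \<Longrightarrow> A j \<in> P (\<phi> j)"
    and tri: "\<And>j. j < n \<Longrightarrow> \<exists>f g h. triangle (Db_mod R) (E j) (E (Suc j)) (A j) f g h"
    using HN by (auto simp: HN_filtration_def)
  have bE: "bounded_complex R (E j)" if "j \<le> n" for j
  proof (cases "j = n")
    case False
    then show ?thesis using tri[of j] that by (auto simp: triangle_def)
  qed (simp add: En X)
  have bA: "bounded_complex R (A j)" if "j < n" for j using tri[OF that] by (auto simp: triangle_def)
  \<comment> \<open>The last term is \<open>X\<close>, which is nonzero, and the term at
    \<open>0\<close> is zero; so \<open>m\<close> exists and has a predecessor \<open>k\<close>,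
    whose term is zero.\<close>
  define m where "m = (LEAST j. \<not> acyclic_complex (E j))"
  have Em: "\<not> acyclic_complex (E m)" and mn: "m \<le> n"
    unfolding m_def using X(2) LeastI[of "\<lambda>j. \<not> acyclic_complex (E j)" n]
      Least_le[of "\<lambda>j. \<not> acyclic_complex (E j)" n] by (simp_all add: En)
  have "acyclic_complex (E 0)" using E0 zero_object_iff[OF bE[of 0]] by simp
  then obtain k where k: "m = Suc k" using Em by (cases m) auto
  then have kn: "k < n" using mn by simp
  have aEk: "acyclic_complex (E k)" using not_less_Least[of k "\<lambda>j. \<not> acyclic_complex (E j)"] k by (auto simp: m_def)
  let ?T = "E m"
  note T = bE[OF mn]
  \<comment> \<open>As \<open>E k\<close> is zero, the triangle at \<open>k\<close> identifies
    \<open>E m\<close> with the semistable cone \<open>A k\<close>.\<close>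
  obtain w where "D_iso R (A k) ?T w" using tri[OF kn] triangle_zero_iso aEk k by blast
  then have "isomorphic (Db_mod R) (A k) ?T" unfolding isomorphic_def iso_mor_Db_mod by blast
  moreover have "?T \<in> Obj (Db_mod R)" using T by simp
  ultimately have TP: "?T \<in> P (\<phi> k)"
    using full[of "\<phi> k"] A[OF kn] unfolding full_additive_subcategory_def by blast
  \<comment> \<open>\<open>slicing\<close> describes \<open>P (\<phi> + 1)\<close> up to
    isomorphism, so the shift of \<open>T\<close> itself belongs to it by way of its
    identity.\<close>
  have "D_iso R (shift_complex ?T) (shift_complex ?T) (D_of R (shift_complex ?T) (shift_complex ?T) (\<lambda>n x. x))"
    by (rule D_iso_qis[OF cx_qis_id[OF bounded_shift[OF T]]])
  then have "isomorphic (Db_mod R) (shift_complex ?T) (Shift (Db_mod R) ?T)"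
    unfolding isomorphic_def iso_mor_Db_mod Db_mod_simps by blast
  moreover have "shift_complex ?T \<in> Obj (Db_mod R)" using bounded_shift[OF T] by simp
  ultimately have TP1: "shift_complex ?T \<in> P (\<phi> k + 1)"
    unfolding shift using TP by blast
  \<comment> \<open>Phases decrease, so each of these cones has phase at most
    \<open>\<phi> k\<close>, strictly below the phase \<open>\<phi> k + 1\<close> of
    \<open>T[1]\<close>; the case \<open>j = k\<close> is included.\<close>
  have van: "D_hom R (shift_complex ?T) (A j) = {D_zero R (shift_complex ?T) (A j)}" if "k \<le> j" "j < n" for j
  proof -
    have "\<phi> j \<le> \<phi> k" using \<phi>[of k j] that by (cases "j = k") auto
    then show ?thesis by (intro orth[OF _ TP1 A[OF that(2)]]) simp
  qed
  define \<mu> where "\<mu> = D_of R ?T ?T (\<lambda>n x. a \<odot>\<^bsub>obj ?T n\<^esub> x)"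
  have \<mu>: "\<mu> \<in> D_hom R ?T ?T" unfolding \<mu>_def by (rule D_of_hom[OF cx_mor_smult[OF T a]])
  \<comment> \<open>Injectivity is tested on \<open>\<mu>\<close> alone. The map
    \<open>\<iota>\<close> is extended by one map of the filtration at a time, and
    \<open>van\<close> for the cone \<open>A (m + i)\<close> allows that map to be
    cancelled.\<close>
  have "\<exists>\<iota> \<in> D_hom R ?T (E (m + i)). D_comp R \<iota> \<mu> = D_zero R ?T (E (m + i)) \<longrightarrow> \<mu> = D_zero R ?T ?T"
    if "m + i \<le> n" for i
    using that
  proof (induction i)
    case 0
    show ?case
      by (rule bexI[of _ "D_of R ?T ?T (\<lambda>n x. x)"])
        (use D_comp_id(2)[OF T T \<mu>] D_of_hom[OF cx_mor_id[OF T]] in simp_all)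
  next
    case (Suc i)
    then obtain \<iota> where \<iota>: "\<iota> \<in> D_hom R ?T (E (m + i))"
      "D_comp R \<iota> \<mu> = D_zero R ?T (E (m + i)) \<longrightarrow> \<mu> = D_zero R ?T ?T" by auto
    have j: "m + i < n" "k \<le> m + i" using Suc.prems k by simp_all
    obtain f g h where t: "triangle (Db_mod R) (E (m + i)) (E (Suc (m + i))) (A (m + i)) f g h"
      using tri[OF j(1)] by blast
    then have f: "f \<in> D_hom R (E (m + i)) (E (Suc (m + i)))" by (simp add: triangle_def)
    have b: "bounded_complex R (E (m + i))" "bounded_complex R (E (Suc (m + i)))" using bE j by simp_all
    show ?case
    proof (rule bexI, rule impI)
      show "D_comp R f \<iota> \<in> D_hom R ?T (E (m + Suc i))" using D_comp_hom[OF T b \<iota>(1) f] by simp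
      assume "D_comp R (D_comp R f \<iota>) \<mu> = D_zero R ?T (E (m + Suc i))"
      then have "D_comp R f (D_comp R \<iota> \<mu>) = D_zero R ?T (E (Suc (m + i)))"
        using D_comp_assoc[OF T T b \<mu> \<iota>(1) f] by simp
      then have "D_comp R \<iota> \<mu> = D_zero R ?T (E (m + i))"
        by (rule triangle_hom_injective[OF t T van[OF j(2,1)] D_comp_hom[OF T T b(1) \<mu> \<iota>(1)]])
      then show "\<mu> = D_zero R ?T ?T" using \<iota>(2) by simp
    qed
  qed
  from this[of "n - m"] obtain \<iota> where \<iota>: "\<iota> \<in> D_hom R ?T X"
    "D_comp R \<iota> \<mu> = D_zero R ?T X \<longrightarrow> \<mu> = D_zero R ?T ?T" using mn En by auto
  \<comment> \<open>Naturality moves the scalar past \<open>\<iota>\<close> to \<open>X\<close>,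
    where it acts as zero.\<close>
  have "D_comp R \<iota> \<mu> = D_zero R ?T X"
    unfolding \<mu>_def D_comp_smult[OF T X(1) a \<iota>(1)] aX by (rule D_comp_zero(2)[OF T X(1) X(1) \<iota>(1)])
  then have "\<mu> = D_zero R ?T ?T" using \<iota>(2) by simp
  then show thesis unfolding \<mu>_def by (rule that[OF TP T Em])
qed

theorem proposition3p5:
  fixes R :: "('a, 'r) ring_scheme"
  assumes "principal_domain R" and "\<not> field R"
  shows "Stab (Db_mod R) = {}"
proof (rule ccontr)
  assume "Stab (Db_mod R) \<noteq> {}"
  then obtain Z P where stab: "stability_condition (Db_mod R) Z P" by (auto simp: Stab_def)
  then have Z: "Z \<in> hom (K0 (Db_mod R)) complex_group" and P: "slicing (Db_mod R) P"
    and charge: "\<And>\<phi> E. E \<in> P \<phi> \<Longrightarrow> \<not> zero_object (Db_mod R) E \<Longrightarrow>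
      \<exists>m::real. 0 < m \<and> Z (K0_class (Db_mod R) E) = of_real m * exp (\<i> * of_real pi * of_real \<phi>)"
    by (auto simp: stability_condition_def)
  interpret principal_domain R by fact
  interpret additive_function R "\<lambda>E. Z (K0_class (Db_mod R) E)"
    by unfold_locales (rule K0_hom_triangle[OF Z])
  obtain p where p: "p \<in> carrier R" "p \<noteq> \<zero>\<^bsub>R\<^esub>" "p \<notin> Units R"
    by (rule nonzero_nonunit[OF assms])
  obtain X :: "('a, 'a list set) cochain" where X: "bounded_complex R X" "\<not> acyclic_complex X"
    "D_of R X X (\<lambda>n x. p \<odot>\<^bsub>obj X n\<^esub> x) = D_zero R X X"
    by (rule torsion_complex_exists[OF is_cring p(1,3)])
  obtain T \<phi> where T: "T \<in> P \<phi>" "bounded_complex R T" "\<not> acyclic_complex T"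
    "D_of R T T (\<lambda>n x. p \<odot>\<^bsub>obj T n\<^esub> x) = D_zero R T T"
    by (rule slicing_first_factor[OF P X(1,2) p(1) X(3)])
  \<comment> \<open>The nonzero scalar \<open>p\<close> carries every cocycle of \<open>T\<close> to
    a coboundary, so the cohomology is torsion.\<close>
  have "Z (K0_class (Db_mod R) T) = 0"
  proof (rule z_torsion[OF T(2)])
    fix n x assume "x \<in> carrier (obj T n)" "diff T n x = \<zero>\<^bsub>obj T (n + 1)\<^esub>"
    then have "x \<in> cocycles T n" by (simp add: cocycles_def)
    from smult_zero_cohomology[OF T(2) p(1) T(4) this] p
    show "\<exists>b \<in> carrier R. b \<noteq> \<zero>\<^bsub>R\<^esub> \<and> b \<odot>\<^bsub>obj T n\<^esub> x \<in> coboundaries T n" by blast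
  qed
  \<comment> \<open>A positive mass times a point of the unit circle cannot vanish.\<close>
  moreover have "Z (K0_class (Db_mod R) T) \<noteq> 0"
    using charge[OF T(1)] T(3) zero_object_iff[OF T(2)] by auto
  ultimately show False by simp
qed

end
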